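(* Let $0<r_0<r_1<r_2$, let $p(r)=\frac1r$ and $\rho(r)=\frac1r\left(\frac{r^2}{r_0^2}-1\right)$ for $r\in[r_1,r_2]$, and let $\mathcal H=L^2_\rho(r_1,r_2)$. Let $\mathcal L$ be the operator in $\mathcal H$ given by $$\mathcal L R=-\frac{1}{\rho(r)}\frac{d}{dr}\left(p(r)\frac{dR}{dr}\right),\qquad D(\mathcal L)=\left\{R\in H^1_0(r_1,r_2):\ \frac{d}{dr}\left(p\frac{dR}{dr}\right)\in L^2_\rho(r_1,r_2)\right\}.$$ Then $\mathcal L$ is self-adjoint in $\mathcal H$. Its spectrum is purely discrete and consists of a sequence of positive eigenvalues $$0<\lambda_1^2\le\lambda_2^2\le\cdots,\qquad \lambda_n^2\to+\infty.$$ The corresponding eigenfunctions form a complete orthonormal basis in $\mathcal H$ (i.e. they can be chosen to form an orthonormal basis).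
   Context: $L^2_\rho(r_1,r_2)$ is the weighted Hilbert space with scalar product $\langle f,g\rangle_\rho=\int_{r_1}^{r_2}f(r)\overline{g(r)}\rho(r)\,dr$. Since $r_1>r_0>0$, the weight $\rho$ is strictly positive and bounded away from zero on $[r_1,r_2]$. $H^1_0(r_1,r_2)$ is the usual Sobolev space of functions vanishing at $r_1$ and $r_2$; derivatives are in the weak sense. *)

theory Defs
  imports "HOL-Analysis.Analysis"
begin

section \<open>The Hilbert space of square-integrable functions\<close>

text \<open>
  Elements of the Hilbert space are represented by measurable functions; two functions stand for
  the same element iff they are equal almost everywhere.
\<close>

definition L2 :: "'a measure \<Rightarrow> ('a \<Rightarrow> complex) set" where
  "L2 M = {f \<in> borel_measurable M. integrable M (\<lambda>x. (cmod (f x))\<^sup>2)}"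

definition L2_inner :: "'a measure \<Rightarrow> ('a \<Rightarrow> complex) \<Rightarrow> ('a \<Rightarrow> complex) \<Rightarrow> complex" where
  "L2_inner M f g = (LINT x|M. f x * cnj (g x))"

definition L2_norm :: "'a measure \<Rightarrow> ('a \<Rightarrow> complex) \<Rightarrow> real" where
  "L2_norm M f = sqrt (LINT x|M. (cmod (f x))\<^sup>2)"

definition L2_orthonormal :: "'a measure \<Rightarrow> (nat \<Rightarrow> 'a \<Rightarrow> complex) \<Rightarrow> bool" where
  "L2_orthonormal M e \<longleftrightarrow>
     (\<forall>n. e n \<in> L2 M) \<and> (\<forall>m n. L2_inner M (e m) (e n) = (if m = n then 1 else 0))"

definition L2_orthonormal_basis :: "'a measure \<Rightarrow> (nat \<Rightarrow> 'a \<Rightarrow> complex) \<Rightarrow> bool" where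
  "L2_orthonormal_basis M e \<longleftrightarrow> L2_orthonormal M e \<and>
     (\<forall>f\<in>L2 M. (\<lambda>N. L2_norm M (\<lambda>x. f x - (\<Sum>n<N. L2_inner M f (e n) * e n x))) \<longlonglongrightarrow> 0)"


section \<open>Unbounded operators\<close>

text \<open>
  An operator is given by its graph: a set of pairs \<open>(f, g)\<close> of representatives, meaning
  that \<open>f\<close> is in the domain and \<open>g\<close> represents the image of \<open>f\<close>.
  The graph contains all representatives of each of its elements, and the image is unique up to
  equality almost everywhere.
\<close>

type_synonym 'a operator_graph = "(('a \<Rightarrow> complex) \<times> ('a \<Rightarrow> complex)) set"

definition linear_operator_in :: "'a measure \<Rightarrow> 'a operator_graph \<Rightarrow> bool" where
  "linear_operator_in M G \<longleftrightarrow>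
     G \<subseteq> L2 M \<times> L2 M \<and>
     (\<forall>f g f' g'. (f, g) \<in> G \<and> f' \<in> borel_measurable M \<and> g' \<in> borel_measurable M \<and>
        (AE x in M. f' x = f x) \<and> (AE x in M. g' x = g x) \<longrightarrow> (f', g') \<in> G) \<and>
     (\<forall>f g g'. (f, g) \<in> G \<and> (f, g') \<in> G \<longrightarrow> (AE x in M. g x = g' x)) \<and>
     ((\<lambda>x. 0), (\<lambda>x. 0)) \<in> G \<and>
     (\<forall>f g f' g'. (f, g) \<in> G \<and> (f', g') \<in> G \<longrightarrow> ((\<lambda>x. f x + f' x), (\<lambda>x. g x + g' x)) \<in> G) \<and>
     (\<forall>c f g. (f, g) \<in> G \<longrightarrow> ((\<lambda>x. c * f x), (\<lambda>x. c * g x)) \<in> G)"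

definition densely_defined :: "'a measure \<Rightarrow> 'a operator_graph \<Rightarrow> bool" where
  "densely_defined M G \<longleftrightarrow>
     (\<forall>f\<in>L2 M. \<forall>\<epsilon>>0. \<exists>h\<in>Domain G. L2_norm M (\<lambda>x. f x - h x) < \<epsilon>)"

definition adjoint_graph :: "'a measure \<Rightarrow> 'a operator_graph \<Rightarrow> 'a operator_graph" where
  "adjoint_graph M G =
     {(u, v). u \<in> L2 M \<and> v \<in> L2 M \<and> (\<forall>(f, g)\<in>G. L2_inner M g u = L2_inner M f v)}"

definition self_adjoint_in :: "'a measure \<Rightarrow> 'a operator_graph \<Rightarrow> bool" where
  "self_adjoint_in M G \<longleftrightarrow>
     linear_operator_in M G \<and> densely_defined M G \<and> adjoint_graph M G = G"

text \<open>
  \<open>z\<close> is in the resolvent set iff \<open>G - z\<close> is injective and surjective (as a map on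
  classes) with bounded inverse.
\<close>

definition resolvent_set :: "'a measure \<Rightarrow> 'a operator_graph \<Rightarrow> complex set" where
  "resolvent_set M G = {z.
     (\<forall>(f, g)\<in>G. (AE x in M. g x - z * f x = 0) \<longrightarrow> (AE x in M. f x = 0)) \<and>
     (\<forall>h\<in>L2 M. \<exists>(f, g)\<in>G. AE x in M. g x - z * f x = h x) \<and>
     (\<exists>C. \<forall>(f, g)\<in>G. L2_norm M f \<le> C * L2_norm M (\<lambda>x. g x - z * f x))}"

definition op_spectrum :: "'a measure \<Rightarrow> 'a operator_graph \<Rightarrow> complex set" where
  "op_spectrum M G = - resolvent_set M G"

definition eigenspace :: "'a measure \<Rightarrow> 'a operator_graph \<Rightarrow> complex \<Rightarrow> ('a \<Rightarrow> complex) set" where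
  "eigenspace M G z = {f. \<exists>g. (f, g) \<in> G \<and> (AE x in M. g x = z * f x)}"

definition is_eigenvalue :: "'a measure \<Rightarrow> 'a operator_graph \<Rightarrow> complex \<Rightarrow> bool" where
  "is_eigenvalue M G z \<longleftrightarrow> (\<exists>f\<in>eigenspace M G z. \<not> (AE x in M. f x = 0))"

definition finite_multiplicity :: "'a measure \<Rightarrow> 'a operator_graph \<Rightarrow> complex \<Rightarrow> bool" where
  "finite_multiplicity M G z \<longleftrightarrow>
     (\<exists>B. finite B \<and> B \<subseteq> eigenspace M G z \<and>
        (\<forall>f\<in>eigenspace M G z. \<exists>c. AE x in M. f x = (\<Sum>b\<in>B. c b * b x)))"

definition discrete_spectrum :: "'a measure \<Rightarrow> 'a operator_graph \<Rightarrow> complex set" where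
  "discrete_spectrum M G = {z. z isolated_in op_spectrum M G \<and>
     is_eigenvalue M G z \<and> finite_multiplicity M G z}"

definition purely_discrete_spectrum :: "'a measure \<Rightarrow> 'a operator_graph \<Rightarrow> bool" where
  "purely_discrete_spectrum M G \<longleftrightarrow> op_spectrum M G = discrete_spectrum M G"


section \<open>Weak derivatives and Sobolev spaces on a bounded interval\<close>

definition test_function :: "real \<Rightarrow> real \<Rightarrow> (real \<Rightarrow> real) \<Rightarrow> bool" where
  "test_function a b \<phi> \<longleftrightarrow>
     (\<forall>n x. (deriv ^^ n) \<phi> field_differentiable at x) \<and>
     (\<exists>K. compact K \<and> K \<subseteq> {a<..<b} \<and> (\<forall>x. x \<notin> K \<longrightarrow> \<phi> x = 0))"

definition locally_integrable :: "real \<Rightarrow> real \<Rightarrow> (real \<Rightarrow> complex) \<Rightarrow> bool" where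
  "locally_integrable a b f \<longleftrightarrow>
     (\<forall>K. compact K \<and> K \<subseteq> {a<..<b} \<longrightarrow> set_integrable lborel K f)"

definition has_weak_deriv ::
    "real \<Rightarrow> real \<Rightarrow> (real \<Rightarrow> complex) \<Rightarrow> (real \<Rightarrow> complex) \<Rightarrow> bool" where
  "has_weak_deriv a b f g \<longleftrightarrow> locally_integrable a b f \<and> locally_integrable a b g \<and>
     (\<forall>\<phi>. test_function a b \<phi> \<longrightarrow>
        (LBINT x:{a<..<b}. f x * complex_of_real (deriv \<phi> x)) =
        - (LBINT x:{a<..<b}. g x * complex_of_real (\<phi> x)))"

abbreviation lborel_on :: "real \<Rightarrow> real \<Rightarrow> real measure" where
  "lborel_on a b \<equiv> restrict_space lborel {a<..<b}"

definition H1 :: "real \<Rightarrow> real \<Rightarrow> (real \<Rightarrow> complex) set" where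
  "H1 a b = {f \<in> L2 (lborel_on a b). \<exists>g\<in>L2 (lborel_on a b). has_weak_deriv a b f g}"

text \<open>The boundary values of an \<open>H1\<close> function are those of its continuous representative.\<close>

definition H1_0 :: "real \<Rightarrow> real \<Rightarrow> (real \<Rightarrow> complex) set" where
  "H1_0 a b = {f \<in> H1 a b. \<exists>u. continuous_on {a..b} u \<and>
     (AE x in lborel_on a b. f x = u x) \<and> u a = 0 \<and> u b = 0}"


section \<open>The Sturm--Liouville operator\<close>

definition coeff_p :: "real \<Rightarrow> real" where
  "coeff_p r = 1 / r"

definition weight_rho :: "real \<Rightarrow> real \<Rightarrow> real" where
  "weight_rho r0 r = 1 / r * (r\<^sup>2 / r0\<^sup>2 - 1)"

text \<open>
  The measure \<open>\<rho>(r) dr\<close> on the interval, so that \<open>L2\<close> and \<open>L2_inner\<close> of this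
  measure are the weighted space and its scalar product.
\<close>

definition rho_measure :: "real \<Rightarrow> real \<Rightarrow> real \<Rightarrow> real measure" where
  "rho_measure r0 r1 r2 = density (lborel_on r1 r2) (\<lambda>r. ennreal (weight_rho r0 r))"

definition SL_domain :: "real \<Rightarrow> real \<Rightarrow> real \<Rightarrow> (real \<Rightarrow> complex) set" where
  "SL_domain r0 r1 r2 = {R \<in> H1_0 r1 r2. \<exists>R' T. has_weak_deriv r1 r2 R R' \<and>
     has_weak_deriv r1 r2 (\<lambda>r. complex_of_real (coeff_p r) * R' r) T \<and>
     T \<in> L2 (rho_measure r0 r1 r2)}"

definition SL_operator :: "real \<Rightarrow> real \<Rightarrow> real \<Rightarrow> real operator_graph" where
  "SL_operator r0 r1 r2 = {(R, S). R \<in> SL_domain r0 r1 r2 \<and>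
     S \<in> borel_measurable (rho_measure r0 r1 r2) \<and>
     (\<exists>R' T. has_weak_deriv r1 r2 R R' \<and>
        has_weak_deriv r1 r2 (\<lambda>r. complex_of_real (coeff_p r) * R' r) T \<and>
        (AE r in rho_measure r0 r1 r2. S r = - complex_of_real (1 / weight_rho r0 r) * T r))}"

end

theory Submission
  imports Defs "HOL-Complex_Analysis.Great_Picard"
begin

text \<open>
  With \<open>q = 1 / p\<close>, the equation \<open>- (p R')' = \<rho> h\<close> with Dirichlet conditions is solved by two
  successive integrations: \<open>p R' = c - \<integral> \<rho> h\<close> and \<open>R = \<integral> q (p R')\<close>, the constant \<open>c\<close> being fixed by
  \<open>R(r2) = 0\<close>. The resulting solution operator \<open>K\<close> maps bounded sets of \<open>L2\<close> to bounded
  equi-Lipschitz sets, so it is compact by Arzela--Ascoli, and integration by parts gives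
  \<open>\<langle>K h, g\<rangle> = \<integral> q (p (K h)') cnj (p (K g)')\<close>, so it is symmetric and positive. By the
  du Bois-Reymond lemma the weakly defined operator is exactly the inverse of \<open>K\<close>, and all
  claims follow from the spectral theorem for compact positive injective operators, which is proved by
  successively maximizing \<open>\<parallel>K f\<parallel>\<close> over unit vectors orthogonal to the eigenfunctions
  already found.
\<close>

section \<open>Geometry of the space of square-integrable functions\<close>

text \<open>Elements of the Hilbert space are functions rather than classes, so operators are
  relations and uniqueness holds only almost everywhere; \<open>K\<close>, in contrast, is a genuine
  map, linear as an equation between functions. Passing to the inverse removes what is hard about an
  unbounded operator. Its range is all of \<open>L2\<close>, so a pair in the adjoint can be tested
  against any vector, and self-adjointness becomes algebra. The spectrum becomes arithmetic on
  coefficients: an eigenvalue \<open>\<mu>\<close> of \<open>K\<close> turns into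
  \<open>1 / \<mu>\<close>, and for every other \<open>z\<close> one divides by the numbers
  \<open>1 - z * \<mu> n\<close>, which are nonzero and tend to 1. Maximizing the norm of
  \<open>K f\<close> rather than the quadratic form makes a maximizing sequence an approximate
  eigenvector of the square of \<open>K\<close> by expanding a single square. The selection never
  stops because the space is infinite-dimensional, which has to be shown separately. In the weak
  formulation the flux is only the integral of an integrable function, so integration by parts is
  derived from Fubini's theorem instead of from pointwise derivatives.\<close>

lemma borel_measurable_cnj [measurable (raw)]:
  "f \<in> borel_measurable M \<Longrightarrow> (\<lambda>x. cnj (f x)) \<in> borel_measurable M"
  by (rule borel_measurable_continuous_on) (intro continuous_intros)

lemma L2_measurable: "f \<in> L2 M \<Longrightarrow> f \<in> borel_measurable M"
  and L2_integrable: "f \<in> L2 M \<Longrightarrow> integrable M (\<lambda>x. (cmod (f x))\<^sup>2)"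
  by (auto simp: L2_def)

lemma L2I: "f \<in> borel_measurable M \<Longrightarrow> integrable M (\<lambda>x. (cmod (f x))\<^sup>2) \<Longrightarrow> f \<in> L2 M"
  by (simp add: L2_def)

lemma L2_zero [simp, intro]: "(\<lambda>x. 0) \<in> L2 M"
  by (simp add: L2_def)

lemma L2_scale [simp, intro]: "f \<in> L2 M \<Longrightarrow> (\<lambda>x. c * f x) \<in> L2 M"
  by (auto simp: L2_def norm_mult power_mult_distrib)

lemma L2_add [simp, intro]:
  assumes "f \<in> L2 M" "g \<in> L2 M" shows "(\<lambda>x. f x + g x) \<in> L2 M"
proof (rule L2I)
  note [measurable] = assms[THEN L2_measurable]
  show "(\<lambda>x. f x + g x) \<in> borel_measurable M" by measurable
  have "integrable M (\<lambda>x. 2 * ((cmod (f x))\<^sup>2 + (cmod (g x))\<^sup>2))"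
    using assms[THEN L2_integrable] by simp
  then show "integrable M (\<lambda>x. (cmod (f x + g x))\<^sup>2)"
  proof (rule Bochner_Integration.integrable_bound)
    have "(cmod (f x + g x))\<^sup>2 \<le> 2 * ((cmod (f x))\<^sup>2 + (cmod (g x))\<^sup>2)" for x
    proof -
      have "(cmod (f x + g x))\<^sup>2 \<le> (cmod (f x) + cmod (g x))\<^sup>2"
        by (intro power_mono norm_triangle_ineq) simp
      also have "\<dots> \<le> 2 * ((cmod (f x))\<^sup>2 + (cmod (g x))\<^sup>2)"
        using sum_squares_bound[of "cmod (f x)" "cmod (g x)"] by (simp add: power2_sum)
      finally show ?thesis .
    qed
    then show "AE x in M. norm ((cmod (f x + g x))\<^sup>2) \<le> norm (2 * ((cmod (f x))\<^sup>2 + (cmod (g x))\<^sup>2))"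
      by (auto intro!: AE_I2)
  qed measurable
qed

lemma L2_uminus [simp, intro]: "f \<in> L2 M \<Longrightarrow> (\<lambda>x. - f x) \<in> L2 M"
  using L2_scale[of f M "-1"] by simp

lemma L2_diff [simp, intro]: "f \<in> L2 M \<Longrightarrow> g \<in> L2 M \<Longrightarrow> (\<lambda>x. f x - g x) \<in> L2 M"
  using L2_add[of f M "\<lambda>x. - g x"] by simp

lemma L2_sum [simp, intro]:
  "(\<And>i. i \<in> I \<Longrightarrow> f i \<in> L2 M) \<Longrightarrow> (\<lambda>x. \<Sum>i\<in>I. f i x) \<in> L2 M"
  by (induction I rule: infinite_finite_induct) auto

text \<open>Measurability of \<open>g\<close> is a separate hypothesis because the measure is not
  assumed complete: equality almost everywhere does not transfer it.\<close>

lemma L2_AE_cong: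
  assumes "f \<in> L2 M" "g \<in> borel_measurable M" "AE x in M. g x = f x" shows "g \<in> L2 M"
proof (rule L2I)
  note [measurable] = assms(2) L2_measurable[OF assms(1)]
  show "integrable M (\<lambda>x. (cmod (g x))\<^sup>2)"
    using L2_integrable[OF assms(1)]
    by (rule Bochner_Integration.integrable_cong_AE_imp) (use assms(3) in auto)
qed (fact assms)

lemma L2_integrable_mult:
  assumes "f \<in> L2 M" "g \<in> L2 M" shows "integrable M (\<lambda>x. f x * g x)"
proof -
  note [measurable] = assms[THEN L2_measurable]
  have "integrable M (\<lambda>x. (cmod (f x))\<^sup>2 + (cmod (g x))\<^sup>2)"
    using assms[THEN L2_integrable] by simp
  then show ?thesis
  proof (rule Bochner_Integration.integrable_bound)
    have "cmod (f x) * cmod (g x) \<le> (cmod (f x))\<^sup>2 + (cmod (g x))\<^sup>2" for x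
    proof -
      have "2 * (cmod (f x) * cmod (g x)) \<le> (cmod (f x))\<^sup>2 + (cmod (g x))\<^sup>2"
        using sum_squares_bound[of "cmod (f x)" "cmod (g x)"] by simp
      moreover have "0 \<le> cmod (f x) * cmod (g x)" by simp
      ultimately show ?thesis by linarith
    qed
    then show "AE x in M. norm (f x * g x) \<le> norm ((cmod (f x))\<^sup>2 + (cmod (g x))\<^sup>2)"
      by (auto simp: norm_mult)
  qed measurable
qed

lemma L2_cnj: "f \<in> L2 M \<Longrightarrow> (\<lambda>x. cnj (f x)) \<in> L2 M"
  by (auto simp: L2_def)

lemma L2_inner_integrable: "f \<in> L2 M \<Longrightarrow> g \<in> L2 M \<Longrightarrow> integrable M (\<lambda>x. f x * cnj (g x))"
  by (intro L2_integrable_mult L2_cnj)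

section \<open>Algebra of the scalar product\<close>

lemma L2_inner_commute: "L2_inner M g f = cnj (L2_inner M f g)"
  by (simp add: L2_inner_def mult.commute flip: Bochner_Integration.integral_cnj)

lemma L2_inner_add_left:
  "f \<in> L2 M \<Longrightarrow> g \<in> L2 M \<Longrightarrow> h \<in> L2 M \<Longrightarrow>
    L2_inner M (\<lambda>x. f x + g x) h = L2_inner M f h + L2_inner M g h"
  by (simp add: L2_inner_def ring_distribs L2_inner_integrable)

lemma L2_inner_diff_left:
  "f \<in> L2 M \<Longrightarrow> g \<in> L2 M \<Longrightarrow> h \<in> L2 M \<Longrightarrow>
    L2_inner M (\<lambda>x. f x - g x) h = L2_inner M f h - L2_inner M g h"
  by (simp add: L2_inner_def ring_distribs L2_inner_integrable)

lemma L2_inner_scale_left: "L2_inner M (\<lambda>x. c * f x) h = c * L2_inner M f h"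
  by (simp add: L2_inner_def mult.assoc)

lemma L2_inner_zero_left [simp]: "L2_inner M (\<lambda>x. 0) h = 0"
  by (simp add: L2_inner_def)

lemma L2_inner_sum_left:
  "(\<And>i. i \<in> I \<Longrightarrow> f i \<in> L2 M) \<Longrightarrow> h \<in> L2 M \<Longrightarrow>
    L2_inner M (\<lambda>x. \<Sum>i\<in>I. f i x) h = (\<Sum>i\<in>I. L2_inner M (f i) h)"
  by (induction I rule: infinite_finite_induct) (auto simp: L2_inner_add_left)

lemma L2_inner_add_right:
  "f \<in> L2 M \<Longrightarrow> g \<in> L2 M \<Longrightarrow> h \<in> L2 M \<Longrightarrow>
    L2_inner M h (\<lambda>x. f x + g x) = L2_inner M h f + L2_inner M h g"
  by (subst (1 2 3) L2_inner_commute) (simp add: L2_inner_add_left)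

lemma L2_inner_diff_right:
  "f \<in> L2 M \<Longrightarrow> g \<in> L2 M \<Longrightarrow> h \<in> L2 M \<Longrightarrow>
    L2_inner M h (\<lambda>x. f x - g x) = L2_inner M h f - L2_inner M h g"
  by (subst (1 2 3) L2_inner_commute) (simp add: L2_inner_diff_left)

lemma L2_inner_scale_right: "L2_inner M h (\<lambda>x. c * f x) = cnj c * L2_inner M h f"
  by (subst (1 2) L2_inner_commute) (simp add: L2_inner_scale_left)

lemma L2_inner_zero_right [simp]: "L2_inner M h (\<lambda>x. 0) = 0"
  by (simp add: L2_inner_def)

lemma L2_inner_sum_right:
  "(\<And>i. i \<in> I \<Longrightarrow> f i \<in> L2 M) \<Longrightarrow> h \<in> L2 M \<Longrightarrow>
    L2_inner M h (\<lambda>x. \<Sum>i\<in>I. f i x) = (\<Sum>i\<in>I. L2_inner M h (f i))"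
  by (induction I rule: infinite_finite_induct) (auto simp: L2_inner_add_right)

lemmas L2_inner_algebra =
  L2_inner_add_left L2_inner_diff_left L2_inner_scale_left
  L2_inner_add_right L2_inner_diff_right L2_inner_scale_right

lemma L2_inner_cong_AE:
  assumes "f \<in> L2 M" "g \<in> L2 M" "f' \<in> L2 M" "g' \<in> L2 M"
    and "AE x in M. f x = f' x" "AE x in M. g x = g' x"
  shows "L2_inner M f g = L2_inner M f' g'"
proof -
  note [measurable] = assms(1-4)[THEN L2_measurable]
  show ?thesis
    unfolding L2_inner_def by (rule Bochner_Integration.integral_cong_AE) (use assms(5,6) in auto)
qed

section \<open>The norm, Cauchy-Schwarz and the triangle inequality\<close>

lemma L2_norm_nonneg [simp]: "0 \<le> L2_norm M f"
  by (simp add: L2_norm_def)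

lemma L2_inner_self: "L2_inner M f f = complex_of_real ((L2_norm M f)\<^sup>2)"
  by (simp add: L2_inner_def L2_norm_def complex_norm_square[symmetric] del: of_real_power)

lemma L2_norm_power2: "(L2_norm M f)\<^sup>2 = Re (L2_inner M f f)"
  by (simp add: L2_inner_self)

lemma L2_norm_cong_AE:
  assumes "f \<in> L2 M" "g \<in> L2 M" "AE x in M. f x = g x" shows "L2_norm M f = L2_norm M g"
proof -
  note [measurable] = assms(1-2)[THEN L2_measurable]
  show ?thesis
    unfolding L2_norm_def
    by (rule arg_cong[where f=sqrt], rule Bochner_Integration.integral_cong_AE) (use assms(3) in auto)
qed

lemma L2_norm_eq_0_iff:
  assumes "f \<in> L2 M" shows "L2_norm M f = 0 \<longleftrightarrow> (AE x in M. f x = 0)"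
  using integral_nonneg_eq_0_iff_AE[OF L2_integrable[OF assms]] by (simp add: L2_norm_def)

lemma L2_norm_scale: "L2_norm M (\<lambda>x. c * f x) = cmod c * L2_norm M f"
  by (simp add: L2_norm_def norm_mult power_mult_distrib real_sqrt_mult)

lemma L2_norm_minus_commute: "L2_norm M (\<lambda>x. f x - g x) = L2_norm M (\<lambda>x. g x - f x)"
  by (simp add: L2_norm_def norm_minus_commute)

lemma L2_norm_add_power2:
  assumes "f \<in> L2 M" "g \<in> L2 M"
  shows "(L2_norm M (\<lambda>x. f x + g x))\<^sup>2 = (L2_norm M f)\<^sup>2 + (L2_norm M g)\<^sup>2 + 2 * Re (L2_inner M f g)"
  using assms by (simp add: L2_norm_power2 L2_inner_algebra L2_inner_commute[of M g f])

lemma L2_norm_diff_power2: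
  assumes "f \<in> L2 M" "g \<in> L2 M"
  shows "(L2_norm M (\<lambda>x. f x - g x))\<^sup>2 = (L2_norm M f)\<^sup>2 + (L2_norm M g)\<^sup>2 - 2 * Re (L2_inner M f g)"
  using assms by (simp add: L2_norm_power2 L2_inner_algebra L2_inner_commute[of M g f])

lemma L2_cauchy_schwarz:
  assumes f: "f \<in> L2 M" and g: "g \<in> L2 M"
  shows "cmod (L2_inner M f g) \<le> L2_norm M f * L2_norm M g"
proof (cases "L2_norm M g = 0")
  case True
  then have "L2_inner M f g = L2_inner M f (\<lambda>x. 0)"
    using f g by (intro L2_inner_cong_AE) (auto simp: L2_norm_eq_0_iff)
  then show ?thesis by simp
next
  case False
  define n where "n = L2_norm M g"
  have n: "n > 0" using False L2_norm_nonneg[of M g] by (simp add: n_def less_le)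
  define a where "a = L2_inner M f g"
  \<comment> \<open>\<open>c * g\<close> is the orthogonal projection of \<open>f\<close> onto
    \<open>g\<close>; among all multiples of \<open>g\<close> it makes the squared distance
    smallest, and nonnegativity of that distance is the inequality.\<close>
  define c where "c = a / of_real (n\<^sup>2)"
  have "0 \<le> (L2_norm M (\<lambda>x. f x - c * g x))\<^sup>2" by simp
  also have "\<dots> = (L2_norm M f)\<^sup>2 + (cmod c * n)\<^sup>2 - 2 * Re (cnj c * a)"
    using f g by (simp add: L2_norm_diff_power2 L2_inner_scale_right L2_norm_scale n_def a_def)
  also have "(cmod c * n)\<^sup>2 = (cmod a)\<^sup>2 / n\<^sup>2"
    using n by (simp add: c_def norm_divide power2_eq_square norm_mult)
  also have "Re (cnj c * a) = (cmod a)\<^sup>2 / n\<^sup>2"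
  proof -
    have "cnj c * a = of_real ((cmod a)\<^sup>2 / n\<^sup>2)"
      using n by (simp add: c_def complex_norm_square[symmetric] mult.commute del: of_real_power)
    then show ?thesis by (simp only: Re_complex_of_real)
  qed
  finally have "(cmod a)\<^sup>2 / n\<^sup>2 \<le> (L2_norm M f)\<^sup>2" by simp
  then have "(cmod a)\<^sup>2 \<le> (L2_norm M f * n)\<^sup>2"
    using n by (simp add: pos_divide_le_eq power_mult_distrib)
  then show ?thesis
    using n by (simp add: a_def n_def power2_le_iff_abs_le)
qed

lemma L2_norm_triangle:
  assumes f: "f \<in> L2 M" and g: "g \<in> L2 M"
  shows "L2_norm M (\<lambda>x. f x + g x) \<le> L2_norm M f + L2_norm M g"
proof (rule power2_le_imp_le)
  have "Re (L2_inner M f g) \<le> L2_norm M f * L2_norm M g"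
    using L2_cauchy_schwarz[OF f g] complex_Re_le_cmod[of "L2_inner M f g"] by linarith
  then show "(L2_norm M (\<lambda>x. f x + g x))\<^sup>2 \<le> (L2_norm M f + L2_norm M g)\<^sup>2"
    using f g by (simp add: L2_norm_add_power2 power2_sum)
qed simp

lemma L2_norm_diff_triangle:
  assumes "f \<in> L2 M" "g \<in> L2 M" "h \<in> L2 M"
  shows "L2_norm M (\<lambda>x. f x - h x) \<le> L2_norm M (\<lambda>x. f x - g x) + L2_norm M (\<lambda>x. g x - h x)"
  using L2_norm_triangle[of "\<lambda>x. f x - g x" M "\<lambda>x. g x - h x"] assms by simp

text \<open>Converts uniform bounds into mean-square bounds; this is how the pointwise estimates on
  \<open>K\<close> and the uniform convergence from Arzela-Ascoli reach the Hilbert space.\<close>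

lemma L2_norm_le_bound:
  assumes "finite_measure M" and f: "f \<in> borel_measurable M" and "C \<ge> 0"
    and le: "\<And>x. x \<in> space M \<Longrightarrow> cmod (f x) \<le> C"
  shows "f \<in> L2 M" "L2_norm M f \<le> C * sqrt (measure M (space M))"
proof -
  interpret finite_measure M by fact
  note [measurable] = f
  have le2: "(cmod (f x))\<^sup>2 \<le> C\<^sup>2" if "x \<in> space M" for x
    using le[OF that] by (simp add: power_mono)
  have int: "integrable M (\<lambda>x. (cmod (f x))\<^sup>2)"
    using le2 by (intro integrable_const_bound[where B="C\<^sup>2"]) auto
  then show "f \<in> L2 M" by (simp add: L2_def)
  have "(LINT x|M. (cmod (f x))\<^sup>2) \<le> (LINT x|M. C\<^sup>2)"
    using int le2 by (intro integral_mono) auto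
  then have "L2_norm M f \<le> sqrt (C\<^sup>2 * measure M (space M))"
    unfolding L2_norm_def by (simp add: mult.commute)
  then show "L2_norm M f \<le> C * sqrt (measure M (space M))"
    using \<open>C \<ge> 0\<close> by (simp add: real_sqrt_mult)
qed

lemma L2_norm_one:
  assumes "finite_measure M"
  shows "(\<lambda>x. 1) \<in> L2 M" "L2_norm M (\<lambda>x. 1) = sqrt (measure M (space M))"
proof -
  interpret finite_measure M by fact
  show "(\<lambda>x. 1) \<in> L2 M" by (simp add: L2_def)
  show "L2_norm M (\<lambda>x. 1) = sqrt (measure M (space M))" by (simp add: L2_norm_def)
qed

text \<open>Cauchy-Schwarz for the modulus of \<open>f\<close> against the constant 1, which lies in
  \<open>L2\<close> because the measure is finite.\<close>

lemma L2_imp_integrable: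
  assumes "finite_measure M" "f \<in> L2 M"
  shows "integrable M f"
    and "(LINT x|M. cmod (f x)) \<le> L2_norm M f * sqrt (measure M (space M))"
proof -
  note one = L2_norm_one[OF assms(1)]
  show "integrable M f" using L2_integrable_mult[OF assms(2) one(1)] by simp
  have f': "(\<lambda>x. complex_of_real (cmod (f x))) \<in> L2 M"
    using assms(2) by (auto simp: L2_def)
  have "cmod (L2_inner M (\<lambda>x. complex_of_real (cmod (f x))) (\<lambda>x. 1))
      \<le> L2_norm M (\<lambda>x. complex_of_real (cmod (f x))) * L2_norm M (\<lambda>x. 1)"
    by (rule L2_cauchy_schwarz[OF f' one(1)])
  moreover have "L2_norm M (\<lambda>x. complex_of_real (cmod (f x))) = L2_norm M f"
    by (simp add: L2_norm_def)
  moreover have "L2_inner M (\<lambda>x. complex_of_real (cmod (f x))) (\<lambda>x. 1) = of_real (LINT x|M. cmod (f x))"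
    by (simp add: L2_inner_def)
  ultimately show "(LINT x|M. cmod (f x)) \<le> L2_norm M f * sqrt (measure M (space M))"
    using one(2) by simp
qed

lemma L2_norm_triangle_diff:
  assumes "f \<in> L2 M" "g \<in> L2 M"
  shows "\<bar>L2_norm M f - L2_norm M g\<bar> \<le> L2_norm M (\<lambda>x. f x - g x)"
proof -
  have "L2_norm M f \<le> L2_norm M (\<lambda>x. f x - g x) + L2_norm M g"
    using L2_norm_triangle[of "\<lambda>x. f x - g x" M g] assms by simp
  moreover have "L2_norm M g \<le> L2_norm M (\<lambda>x. f x - g x) + L2_norm M f"
    using L2_norm_triangle[of "\<lambda>x. g x - f x" M f] L2_norm_minus_commute[of M f g] assms by simp
  ultimately show ?thesis by linarith
qed

section \<open>Limits and completeness in mean square\<close>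

lemma L2_tendsto_imp_norm_tendsto:
  assumes "\<And>n. s n \<in> L2 M" "f \<in> L2 M" "(\<lambda>n. L2_norm M (\<lambda>x. s n x - f x)) \<longlonglongrightarrow> 0"
  shows "(\<lambda>n. L2_norm M (s n)) \<longlonglongrightarrow> L2_norm M f"
proof (rule LIM_zero_cancel, rule Lim_null_comparison[OF always_eventually[OF allI] assms(3)])
  show "norm (L2_norm M (s n) - L2_norm M f) \<le> L2_norm M (\<lambda>x. s n x - f x)" for n
    using L2_norm_triangle_diff[OF assms(1,2)] by simp
qed

lemma L2_tendsto_imp_inner_tendsto:
  assumes "\<And>n. s n \<in> L2 M" "f \<in> L2 M" "(\<lambda>n. L2_norm M (\<lambda>x. s n x - f x)) \<longlonglongrightarrow> 0" "h \<in> L2 M"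
  shows "(\<lambda>n. L2_inner M (s n) h) \<longlonglongrightarrow> L2_inner M f h"
proof -
  have "(\<lambda>n. L2_norm M (\<lambda>x. s n x - f x) * L2_norm M h) \<longlonglongrightarrow> 0"
    using tendsto_mult_left_zero[OF assms(3)] .
  moreover have "norm (L2_inner M (s n) h - L2_inner M f h) \<le> L2_norm M (\<lambda>x. s n x - f x) * L2_norm M h" for n
    using L2_cauchy_schwarz[of "\<lambda>x. s n x - f x" M h] assms by (simp add: L2_inner_diff_left)
  ultimately have "(\<lambda>n. L2_inner M (s n) h - L2_inner M f h) \<longlonglongrightarrow> 0"
    by (rule Lim_null_comparison[OF always_eventually[OF allI], rotated])
  then show ?thesis by (rule LIM_zero_cancel)
qed

text \<open>Membership of \<open>f\<close> belongs to the conclusion: in the completeness proof the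
  pointwise limit is at first known only to be measurable.\<close>

lemma L2_fatou:
  assumes s: "\<And>i. s i \<in> L2 M" and f: "f \<in> borel_measurable M"
    and lim: "AE x in M. (\<lambda>i. s i x) \<longlonglongrightarrow> f x" and bound: "\<And>i. L2_norm M (s i) \<le> e"
  shows "f \<in> L2 M" "L2_norm M f \<le> e"
proof -
  note [measurable] = s[THEN L2_measurable] f
  have e: "e \<ge> 0" using bound[of 0] L2_norm_nonneg[of M "s 0"] by linarith
  have eq: "(\<integral>\<^sup>+x. ennreal ((cmod (s i x))\<^sup>2) \<partial>M) = ennreal ((L2_norm M (s i))\<^sup>2)" for i
    using L2_integrable[OF s[of i]] by (subst nn_integral_eq_integral) (auto simp: L2_norm_def)
  have "(\<integral>\<^sup>+x. ennreal ((cmod (f x))\<^sup>2) \<partial>M) = (\<integral>\<^sup>+x. liminf (\<lambda>i. ennreal ((cmod (s i x))\<^sup>2)) \<partial>M)"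
  proof (rule nn_integral_cong_AE)
    show "AE x in M. ennreal ((cmod (f x))\<^sup>2) = liminf (\<lambda>i. ennreal ((cmod (s i x))\<^sup>2))"
      using lim
    proof eventually_elim
      case (elim x)
      then have "(\<lambda>i. ennreal ((cmod (s i x))\<^sup>2)) \<longlonglongrightarrow> ennreal ((cmod (f x))\<^sup>2)"
        by (intro tendsto_intros)
      then show ?case by (intro lim_imp_Liminf[symmetric]) auto
    qed
  qed
  also have "\<dots> \<le> liminf (\<lambda>i. \<integral>\<^sup>+x. ennreal ((cmod (s i x))\<^sup>2) \<partial>M)"
    by (rule nn_integral_liminf) measurable
  also have "\<dots> \<le> liminf (\<lambda>i::nat. ennreal (e\<^sup>2))"
    unfolding eq by (intro Liminf_mono always_eventually allI ennreal_leI power_mono bound) simp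
  also have "\<dots> = ennreal (e\<^sup>2)" by (simp add: Liminf_const)
  finally have le: "(\<integral>\<^sup>+x. ennreal ((cmod (f x))\<^sup>2) \<partial>M) \<le> ennreal (e\<^sup>2)" .
  then have int: "integrable M (\<lambda>x. (cmod (f x))\<^sup>2)"
    by (intro integrableI_bounded) (auto simp: top_unique intro: le_less_trans)
  then show "f \<in> L2 M" by (simp add: L2_def)
  have "ennreal (LINT x|M. (cmod (f x))\<^sup>2) \<le> ennreal (e\<^sup>2)"
    using le int by (subst (asm) nn_integral_eq_integral) auto
  then have "(LINT x|M. (cmod (f x))\<^sup>2) \<le> e\<^sup>2" by (subst (asm) ennreal_le_iff) auto
  then show "L2_norm M f \<le> e"
    unfolding L2_norm_def using e by (simp add: real_le_lsqrt)
qed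

text \<open>A Cauchy sequence in the mean square sense is Cauchy in the mean, so it has an almost
  everywhere convergent subsequence; Fatou's lemma identifies the pointwise limit as the limit.\<close>

theorem L2_complete:
  assumes "finite_measure M" and s: "\<And>n. s n \<in> L2 M"
    and cauchy: "\<And>e. e > 0 \<Longrightarrow> \<exists>N. \<forall>i\<ge>N. \<forall>j\<ge>N. L2_norm M (\<lambda>x. s i x - s j x) < e"
  obtains f where "f \<in> L2 M" "(\<lambda>n. L2_norm M (\<lambda>x. s n x - f x)) \<longlonglongrightarrow> 0"
proof -
  \<comment> \<open>The summand 1 keeps \<open>C\<close> positive even if the whole space is
    null.\<close>
  define C where "C = sqrt (measure M (space M)) + 1"
  have C: "C > 0" by (simp add: C_def add_nonneg_pos)
  note [measurable] = s[THEN L2_measurable]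
  have "\<exists>N. \<forall>i\<ge>N. \<forall>j\<ge>N. (LINT x|M. norm (s i x - s j x)) < e" if "e > 0" for e
  proof -
    obtain N where N: "\<And>i j. i \<ge> N \<Longrightarrow> j \<ge> N \<Longrightarrow> L2_norm M (\<lambda>x. s i x - s j x) < e / C"
      using cauchy[of "e / C"] \<open>e > 0\<close> C by auto
    have "(LINT x|M. norm (s i x - s j x)) < e" if "i \<ge> N" "j \<ge> N" for i j
    proof -
      have "(LINT x|M. norm (s i x - s j x)) \<le> L2_norm M (\<lambda>x. s i x - s j x) * sqrt (measure M (space M))"
        by (rule L2_imp_integrable(2)[OF assms(1)]) (use s in auto)
      also have "\<dots> \<le> L2_norm M (\<lambda>x. s i x - s j x) * C"
        by (intro mult_left_mono) (auto simp: C_def)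
      also have "\<dots> < e" using N[OF that] C by (simp add: field_simps)
      finally show ?thesis .
    qed
    then show ?thesis by blast
  qed
  then obtain r where r: "strict_mono r" and ae: "AE x in M. Cauchy (\<lambda>i. s (r i) x)"
    using cauchy_L1_AE_cauchy_subseq[of M s] L2_imp_integrable(1)[OF assms(1) s] by blast
  define f where "f = (\<lambda>x. lim (\<lambda>i. s (r i) x))"
  have f [measurable]: "f \<in> borel_measurable M" unfolding f_def by measurable
  have lim: "AE x in M. (\<lambda>i. s (r i) x) \<longlonglongrightarrow> f x"
    using ae by eventually_elim (simp add: f_def Cauchy_convergent convergent_LIMSEQ_iff[symmetric])
  \<comment> \<open>Fatou is applied to the differences \<open>s n - s (r (i + N))\<close> with
    \<open>n\<close> fixed, so one application yields both the bound and that
    \<open>s n - f\<close>, hence \<open>f\<close>, is square-integrable.\<close>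
  have main: "\<exists>N. \<forall>n\<ge>N. (\<lambda>x. s n x - f x) \<in> L2 M \<and> L2_norm M (\<lambda>x. s n x - f x) \<le> e" if e: "e > 0" for e
  proof -
    obtain N where N: "\<And>i j. i \<ge> N \<Longrightarrow> j \<ge> N \<Longrightarrow> L2_norm M (\<lambda>x. s i x - s j x) < e"
      using cauchy[OF e] by auto
    have "(\<lambda>x. s n x - f x) \<in> L2 M \<and> L2_norm M (\<lambda>x. s n x - f x) \<le> e" if n: "n \<ge> N" for n
    proof -
      have "AE x in M. (\<lambda>i. s n x - s (r (i + N)) x) \<longlonglongrightarrow> s n x - f x"
        using lim
      proof eventually_elim
        case (elim x)
        then show ?case by (intro tendsto_intros LIMSEQ_ignore_initial_segment)
      qed
      moreover have "L2_norm M (\<lambda>x. s n x - s (r (i + N)) x) \<le> e" for i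
        using N[OF n, of "r (i + N)"] seq_suble[OF r, of "i + N"] by (simp add: less_imp_le)
      ultimately show ?thesis
        using L2_fatou[of "\<lambda>i x. s n x - s (r (i + N)) x" M "\<lambda>x. s n x - f x" e] s by auto
    qed
    then show ?thesis by blast
  qed
  obtain n where n: "(\<lambda>x. s n x - f x) \<in> L2 M" using main[of 1] by auto
  have "(\<lambda>x. s n x - (s n x - f x)) \<in> L2 M" by (rule L2_diff[OF s n])
  then have "f \<in> L2 M" by simp
  moreover have "(\<lambda>n. L2_norm M (\<lambda>x. s n x - f x)) \<longlonglongrightarrow> 0"
  proof (rule LIMSEQ_I)
    fix e :: real assume "e > 0"
    then show "\<exists>N. \<forall>n\<ge>N. norm (L2_norm M (\<lambda>x. s n x - f x) - 0) < e"
      using main[of "e / 2"] by fastforce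
  qed
  ultimately show ?thesis by (rule that)
qed

lemma cnj_mult_self: "cnj z * z = complex_of_real ((cmod z)\<^sup>2)"
  by (simp only: complex_norm_square mult.commute)

subsection \<open>Orthonormal sequences\<close>

lemma L2_orthonormalD:
  assumes "L2_orthonormal M e"
  shows "e n \<in> L2 M" "L2_inner M (e m) (e n) = (if m = n then 1 else 0)" "L2_norm M (e n) = 1"
proof -
  show e: "e n \<in> L2 M" "L2_inner M (e m) (e n) = (if m = n then 1 else 0)" for m n
    using assms by (auto simp: L2_orthonormal_def)
  have "(L2_norm M (e n))\<^sup>2 = 1" using e(2)[of n n] by (simp add: L2_norm_power2)
  then show "L2_norm M (e n) = 1" using L2_norm_nonneg[of M "e n"] by (auto simp: power2_eq_1_iff)
qed

context
  fixes M :: "'a measure" and e assumes e: "L2_orthonormal M e"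
begin

lemma inner_orthonormal_sum:
  assumes "finite I"
  shows "L2_inner M (\<lambda>x. \<Sum>i\<in>I. a i * e i x) (e n) = (if n \<in> I then a n else 0)"
  using L2_orthonormalD[OF e] assms
  by (simp add: L2_inner_sum_left L2_inner_scale_left if_distrib[of "\<lambda>x. _ * x"] sum.delta cong: if_cong)

lemma norm_orthonormal_sum:
  assumes "finite I"
  shows "(L2_norm M (\<lambda>x. \<Sum>i\<in>I. a i * e i x))\<^sup>2 = (\<Sum>i\<in>I. (cmod (a i))\<^sup>2)"
proof -
  have "L2_inner M (\<lambda>x. \<Sum>i\<in>I. a i * e i x) (\<lambda>x. \<Sum>i\<in>I. a i * e i x)
      = (\<Sum>j\<in>I. cnj (a j) * L2_inner M (\<lambda>x. \<Sum>i\<in>I. a i * e i x) (e j))"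
    using L2_orthonormalD[OF e] by (subst L2_inner_sum_right) (auto simp: L2_inner_scale_right)
  also have "\<dots> = (\<Sum>j\<in>I. of_real ((cmod (a j))\<^sup>2))"
    using assms by (intro sum.cong) (simp_all add: inner_orthonormal_sum complex_norm_square mult.commute del: of_real_power)
  finally show ?thesis by (simp add: L2_norm_power2)
qed

text \<open>The scalar product of \<open>f\<close> with its projection and the squared norm of the
  projection are the same sum, so in the expanded square two copies of it are subtracted and one is
  added.\<close>

lemma bessel_identity:
  assumes f: "f \<in> L2 M" and "finite I"
  shows "(L2_norm M (\<lambda>x. f x - (\<Sum>i\<in>I. L2_inner M f (e i) * e i x)))\<^sup>2 =
    (L2_norm M f)\<^sup>2 - (\<Sum>i\<in>I. (cmod (L2_inner M f (e i)))\<^sup>2)"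
proof -
  have "L2_inner M f (\<lambda>x. \<Sum>i\<in>I. L2_inner M f (e i) * e i x)
      = (\<Sum>i\<in>I. of_real ((cmod (L2_inner M f (e i)))\<^sup>2))"
    using L2_orthonormalD[OF e] f
    by (subst L2_inner_sum_right)
       (auto simp: L2_inner_scale_right cnj_mult_self simp del: of_real_power)
  then show ?thesis
    using L2_orthonormalD[OF e] f \<open>finite I\<close>
    by (subst L2_norm_diff_power2) (auto simp: norm_orthonormal_sum)
qed

lemma bessel_inequality:
  assumes "f \<in> L2 M" "finite I"
  shows "(\<Sum>i\<in>I. (cmod (L2_inner M f (e i)))\<^sup>2) \<le> (L2_norm M f)\<^sup>2"
  using bessel_identity[OF assms] zero_le_power2[of "L2_norm M (\<lambda>x. f x - (\<Sum>i\<in>I. L2_inner M f (e i) * e i x))"]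
  by linarith

lemma bessel_summable:
  assumes "f \<in> L2 M" shows "summable (\<lambda>i. (cmod (L2_inner M f (e i)))\<^sup>2)"
  by (rule summableI_nonneg_bounded[where x="(L2_norm M f)\<^sup>2"]) (auto intro: bessel_inequality assms)

text \<open>The squared distance of two partial sums is a block of the convergent series of squares,
  so the partial sums are Cauchy and completeness provides \<open>g\<close>.\<close>

lemma riesz_fischer:
  assumes "finite_measure M" and "summable (\<lambda>i. (cmod (a i))\<^sup>2)"
  obtains g where "g \<in> L2 M" "\<And>n. L2_inner M g (e n) = a n"
    "(\<lambda>N. L2_norm M (\<lambda>x. (\<Sum>n<N. a n * e n x) - g x)) \<longlonglongrightarrow> 0"
proof -
  define s where "s = (\<lambda>N x. \<Sum>n<N. a n * e n x)"
  have s: "s N \<in> L2 M" for N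
    unfolding s_def using L2_orthonormalD[OF e] by auto
  have diff: "L2_norm M (\<lambda>x. s j x - s i x) = sqrt (\<Sum>n\<in>{i..<j}. (cmod (a n))\<^sup>2)" if "i \<le> j" for i j
  proof -
    have "s j x - s i x = (\<Sum>n\<in>{i..<j}. a n * e n x)" for x
      using sum.atLeastLessThan_concat[of 0 i j "\<lambda>n. a n * e n x"] that
      by (simp add: s_def lessThan_atLeast0 algebra_simps)
    then show ?thesis
      using norm_orthonormal_sum[of "{i..<j}" a] by (simp add: real_sqrt_unique)
  qed
  have "\<exists>N. \<forall>i\<ge>N. \<forall>j\<ge>N. L2_norm M (\<lambda>x. s i x - s j x) < \<epsilon>" if "\<epsilon> > 0" for \<epsilon>
  proof -
    obtain N where N: "\<And>m n. m \<ge> N \<Longrightarrow> norm (\<Sum>i\<in>{m..<n}. (cmod (a i))\<^sup>2) < \<epsilon>\<^sup>2"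
      using assms(2) \<open>\<epsilon> > 0\<close> unfolding summable_Cauchy by (meson zero_less_power)
    have *: "L2_norm M (\<lambda>x. s j x - s i x) < \<epsilon>" if "N \<le> i" "i \<le> j" for i j
    proof -
      have "(\<Sum>n\<in>{i..<j}. (cmod (a n))\<^sup>2) < \<epsilon>\<^sup>2" using N[OF that(1), of j] by simp
      then show ?thesis unfolding diff[OF that(2)]
        using \<open>\<epsilon> > 0\<close> by (metis less_imp_le real_sqrt_less_iff real_sqrt_unique)
    qed
    have "L2_norm M (\<lambda>x. s i x - s j x) < \<epsilon>" if "i \<ge> N" "j \<ge> N" for i j
      using *[of i j] *[of j i] that L2_norm_minus_commute[of M "s i" "s j"] by (cases "i \<le> j") auto
    then show ?thesis by blast
  qed
  then obtain g where g: "g \<in> L2 M" "(\<lambda>N. L2_norm M (\<lambda>x. s N x - g x)) \<longlonglongrightarrow> 0"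
    using L2_complete[OF assms(1), of s] s by blast
  have "L2_inner M g (e n) = a n" for n
  proof (rule LIMSEQ_unique)
    show "(\<lambda>N. L2_inner M (s N) (e n)) \<longlonglongrightarrow> L2_inner M g (e n)"
      using L2_tendsto_imp_inner_tendsto[OF s g] L2_orthonormalD(1)[OF e] by blast
    \<comment> \<open>The n-th coefficient of a partial sum is constant as soon as
      \<open>N > n\<close>.\<close>
    have "\<forall>\<^sub>F N in sequentially. L2_inner M (s N) (e n) = a n"
      using eventually_gt_at_top[of n]
      by eventually_elim (auto simp: s_def inner_orthonormal_sum)
    then show "(\<lambda>N. L2_inner M (s N) (e n)) \<longlonglongrightarrow> a n" by (rule tendsto_eventually)
  qed
  then show ?thesis using that g by (auto simp: s_def)
qed

end

section \<open>Compact positive operators\<close>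

text \<open>\<open>K\<close> acts on representatives. Additivity and homogeneity are equations
  between functions, while injectivity is up to null sets. Compactness is stated sequentially on the
  unit ball, and an infinite orthonormal sequence encodes infinite dimension.\<close>

locale compact_positive_operator =
  fixes M :: "'a measure" and K :: "('a \<Rightarrow> complex) \<Rightarrow> 'a \<Rightarrow> complex"
  assumes finite: "finite_measure M"
    and K_L2 [simp, intro]: "f \<in> L2 M \<Longrightarrow> K f \<in> L2 M"
    and K_add: "f \<in> L2 M \<Longrightarrow> g \<in> L2 M \<Longrightarrow> K (\<lambda>x. f x + g x) = (\<lambda>x. K f x + K g x)"
    and K_scale: "f \<in> L2 M \<Longrightarrow> K (\<lambda>x. c * f x) = (\<lambda>x. c * K f x)"
    and K_bounded: "\<exists>C. \<forall>f\<in>L2 M. L2_norm M (K f) \<le> C * L2_norm M f"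
    and K_symmetric: "f \<in> L2 M \<Longrightarrow> g \<in> L2 M \<Longrightarrow> L2_inner M (K f) g = L2_inner M f (K g)"
    and K_positive: "f \<in> L2 M \<Longrightarrow> 0 \<le> Re (L2_inner M (K f) f)"
    and K_injective: "f \<in> L2 M \<Longrightarrow> AE x in M. K f x = 0 \<Longrightarrow> AE x in M. f x = 0"
    and K_compact: "(\<And>n. s n \<in> L2 M) \<Longrightarrow> (\<And>n. L2_norm M (s n) \<le> 1) \<Longrightarrow>
      \<exists>r g. strict_mono (r :: nat \<Rightarrow> nat) \<and> g \<in> L2 M \<and> (\<lambda>n. L2_norm M (\<lambda>x. K (s (r n)) x - g x)) \<longlonglongrightarrow> 0"
    and infinite_dimensional: "\<exists>\<omega>. L2_orthonormal M \<omega>"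
begin

lemma K_diff: "f \<in> L2 M \<Longrightarrow> g \<in> L2 M \<Longrightarrow> K (\<lambda>x. f x - g x) = (\<lambda>x. K f x - K g x)"
  using K_add[of f "\<lambda>x. -1 * g x"] K_scale[of g "-1"] by (simp add: fun_eq_iff)

lemma K_zero: "K (\<lambda>x. 0) = (\<lambda>x. 0)"
  using K_scale[OF L2_zero, of 0] by simp

lemma K_bound: obtains C where "C > 0" "\<And>f. f \<in> L2 M \<Longrightarrow> L2_norm M (K f) \<le> C * L2_norm M f"
proof -
  obtain C where C: "\<And>f. f \<in> L2 M \<Longrightarrow> L2_norm M (K f) \<le> C * L2_norm M f"
    using K_bounded by blast
  have "L2_norm M (K f) \<le> (\<bar>C\<bar> + 1) * L2_norm M f" if "f \<in> L2 M" for f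
  proof -
    have "C * L2_norm M f \<le> (\<bar>C\<bar> + 1) * L2_norm M f" by (intro mult_right_mono) auto
    then show ?thesis using C[OF that] by linarith
  qed
  then show ?thesis by (intro that[of "\<bar>C\<bar> + 1"]) auto
qed

text \<open>That \<open>K\<close> is well defined on classes is a consequence of boundedness,
  applied to the null function \<open>f - g\<close>.\<close>

lemma K_cong_AE:
  assumes "f \<in> L2 M" "g \<in> L2 M" "AE x in M. f x = g x"
  shows "AE x in M. K f x = K g x"
proof -
  obtain C where C: "\<And>f. f \<in> L2 M \<Longrightarrow> L2_norm M (K f) \<le> C * L2_norm M f" using K_bound by blast
  have "L2_norm M (\<lambda>x. f x - g x) = 0"
    using assms by (subst L2_norm_eq_0_iff) auto
  then have "L2_norm M (K (\<lambda>x. f x - g x)) = 0"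
    using C[of "\<lambda>x. f x - g x"] assms L2_norm_nonneg[of M "K (\<lambda>x. f x - g x)"] by simp
  then have "AE x in M. K (\<lambda>x. f x - g x) x = 0"
    using assms by (subst (asm) L2_norm_eq_0_iff) auto
  then show ?thesis by (simp add: K_diff assms)
qed

lemma K_tendsto:
  assumes "\<And>n. s n \<in> L2 M" "g \<in> L2 M" "(\<lambda>n. L2_norm M (\<lambda>x. s n x - g x)) \<longlonglongrightarrow> 0"
  shows "(\<lambda>n. L2_norm M (\<lambda>x. K (s n) x - K g x)) \<longlonglongrightarrow> 0"
proof -
  obtain C where C: "\<And>f. f \<in> L2 M \<Longrightarrow> L2_norm M (K f) \<le> C * L2_norm M f" using K_bound by blast
  have "(\<lambda>n. C * L2_norm M (\<lambda>x. s n x - g x)) \<longlonglongrightarrow> 0"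
    using tendsto_mult_right_zero[OF assms(3)] .
  then show ?thesis
  proof (rule Lim_null_comparison[OF always_eventually[OF allI], rotated])
    fix n
    show "norm (L2_norm M (\<lambda>x. K (s n) x - K g x)) \<le> C * L2_norm M (\<lambda>x. s n x - g x)"
      using C[of "\<lambda>x. s n x - g x"] assms by (simp add: K_diff)
  qed
qed

section \<open>Eigenfunctions and invariant orthogonal complements\<close>

definition orthogonal_to :: "('a \<Rightarrow> complex) set \<Rightarrow> ('a \<Rightarrow> complex) set" where
  "orthogonal_to E = {f \<in> L2 M. \<forall>u\<in>E. L2_inner M f u = 0}"

definition eigenfunction :: "complex \<Rightarrow> ('a \<Rightarrow> complex) \<Rightarrow> bool" where
  "eigenfunction c u \<longleftrightarrow> u \<in> L2 M \<and> (AE x in M. K u x = c * u x)"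

lemma orthogonal_to_L2: "f \<in> orthogonal_to E \<Longrightarrow> f \<in> L2 M"
  by (simp add: orthogonal_to_def)

lemma inner_K_eigenfunction:
  assumes "eigenfunction c u" "f \<in> L2 M"
  shows "L2_inner M (K f) u = cnj c * L2_inner M f u"
proof -
  have "L2_inner M (K f) u = L2_inner M f (K u)"
    using assms by (simp add: K_symmetric eigenfunction_def)
  also have "\<dots> = L2_inner M f (\<lambda>x. c * u x)"
    using assms by (intro L2_inner_cong_AE) (auto simp: eigenfunction_def)
  finally show ?thesis by (simp add: L2_inner_scale_right)
qed

text \<open>Symmetry moves \<open>K\<close> onto the eigenfunction, where it only produces a factor.
  This invariance allows the maximization to be repeated on smaller and smaller complements.\<close>

lemma K_orthogonal_to:
  assumes "\<And>u. u \<in> E \<Longrightarrow> \<exists>c. eigenfunction c u" "f \<in> orthogonal_to E"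
  shows "K f \<in> orthogonal_to E"
proof -
  have "L2_inner M (K f) u = 0" if "u \<in> E" for u
  proof -
    obtain c where "eigenfunction c u" using assms(1)[OF \<open>u \<in> E\<close>] by blast
    then show ?thesis
      using inner_K_eigenfunction[of c u f] assms(2) that by (simp add: orthogonal_to_def)
  qed
  then show ?thesis using assms(2) by (auto simp: orthogonal_to_def)
qed

lemma orthogonal_to_scale: "f \<in> orthogonal_to E \<Longrightarrow> (\<lambda>x. c * f x) \<in> orthogonal_to E"
  by (auto simp: orthogonal_to_def L2_inner_scale_left)

lemma orthogonal_to_add:
  "E \<subseteq> L2 M \<Longrightarrow> f \<in> orthogonal_to E \<Longrightarrow> g \<in> orthogonal_to E \<Longrightarrow> (\<lambda>x. f x + g x) \<in> orthogonal_to E"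
  by (auto simp: orthogonal_to_def L2_inner_add_left subset_iff)

text \<open>With \<open>m\<close> the norm of \<open>K\<close> on the orthogonal complement, a maximizing sequence converges
  to some \<open>v\<close> with \<open>K (K v) = m\<^sup>2 v\<close>; by positivity \<open>K v + m v\<close> is nonzero, and it is the
  eigenfunction.\<close>

lemma exists_eigenfunction_orthogonal_to:
  assumes E: "\<And>u. u \<in> E \<Longrightarrow> \<exists>c. eigenfunction c u"
    and f0: "f0 \<in> orthogonal_to E" "\<not> (AE x in M. f0 x = 0)"
  obtains m e where "m > 0" "e \<in> orthogonal_to E" "L2_norm M e = 1"
    "eigenfunction (complex_of_real m) e"
    "\<And>f. f \<in> orthogonal_to E \<Longrightarrow> L2_norm M (K f) \<le> m * L2_norm M f"
proof -
  have E_L2: "E \<subseteq> L2 M" using E by (auto simp: eigenfunction_def)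
  obtain C where C: "C > 0" "\<And>f. f \<in> L2 M \<Longrightarrow> L2_norm M (K f) \<le> C * L2_norm M f" using K_bound by blast
  define S where "S = (\<lambda>f. L2_norm M (K f)) ` {f \<in> orthogonal_to E. L2_norm M f = 1}"
  define m where "m = Sup S"
  have bdd: "bdd_above S"
    unfolding S_def using C(2)[OF orthogonal_to_L2] by (intro bdd_aboveI[of _ C]) fastforce
  have normalized: "(\<lambda>x. complex_of_real (1 / L2_norm M f) * f x) \<in> orthogonal_to E"
      "L2_norm M (\<lambda>x. complex_of_real (1 / L2_norm M f) * f x) = 1"
      "L2_norm M (K (\<lambda>x. complex_of_real (1 / L2_norm M f) * f x)) = L2_norm M (K f) / L2_norm M f"
    if "f \<in> orthogonal_to E" "L2_norm M f \<noteq> 0" for f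
  proof -
    have "L2_norm M f > 0" using that L2_norm_nonneg[of M f] by linarith
    then show "(\<lambda>x. complex_of_real (1 / L2_norm M f) * f x) \<in> orthogonal_to E"
      "L2_norm M (\<lambda>x. complex_of_real (1 / L2_norm M f) * f x) = 1"
      "L2_norm M (K (\<lambda>x. complex_of_real (1 / L2_norm M f) * f x)) = L2_norm M (K f) / L2_norm M f"
      using that orthogonal_to_L2[OF that(1)]
      by (auto simp only: orthogonal_to_scale K_scale L2_norm_scale norm_of_real) auto
  qed
  have ratio: "L2_norm M (K f) / L2_norm M f \<in> S" if "f \<in> orthogonal_to E" "L2_norm M f \<noteq> 0" for f
    unfolding S_def using normalized[OF that]
    by (intro image_eqI[of _ _ "\<lambda>x. complex_of_real (1 / L2_norm M f) * f x"]) auto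
  have le_m: "L2_norm M (K f) \<le> m * L2_norm M f" if f: "f \<in> orthogonal_to E" for f
  proof (cases "L2_norm M f = 0")
    case True
    then show ?thesis using C(2)[OF orthogonal_to_L2[OF f]] by simp
  next
    case False
    then have "L2_norm M (K f) / L2_norm M f \<le> m"
      unfolding m_def by (intro cSup_upper ratio f bdd)
    then show ?thesis using False L2_norm_nonneg[of M f] by (simp add: pos_divide_le_eq less_le)
  qed
  have f0_norm: "L2_norm M f0 \<noteq> 0"
    using f0 by (simp add: L2_norm_eq_0_iff orthogonal_to_L2)
  have Kf0: "L2_norm M (K f0) \<noteq> 0"
    using f0 K_injective[of f0] by (auto simp: L2_norm_eq_0_iff orthogonal_to_L2)
  have m_pos: "m > 0"
  proof -
    have "0 < L2_norm M (K f0)" using Kf0 L2_norm_nonneg[of M "K f0"] by linarith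
    also have "\<dots> \<le> m * L2_norm M f0" by (rule le_m[OF f0(1)])
    finally show ?thesis using L2_norm_nonneg[of M f0] by (simp add: zero_less_mult_iff)
  qed
  have "\<exists>f. f \<in> orthogonal_to E \<and> L2_norm M f = 1 \<and> m - 1 / Suc n < L2_norm M (K f)" for n :: nat
  proof -
    have "m - 1 / Suc n < Sup S" by (simp add: m_def)
    then obtain y where "y \<in> S" "m - 1 / Suc n < y"
      using less_cSupE[of _ S] ratio[OF f0(1) f0_norm] by blast
    then show ?thesis by (auto simp: S_def)
  qed
  then obtain s where s: "\<And>n. s n \<in> orthogonal_to E" "\<And>n. L2_norm M (s n) = 1"
      "\<And>n::nat. m - 1 / Suc n < L2_norm M (K (s n))"
    by metis
  have s_L2: "s n \<in> L2 M" for n using s(1) by (rule orthogonal_to_L2)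
  have lim_Ks: "(\<lambda>n. L2_norm M (K (s n))) \<longlonglongrightarrow> m"
  proof (rule real_tendsto_sandwich)
    show "(\<lambda>n. m - 1 / Suc n) \<longlonglongrightarrow> m"
      using tendsto_diff[OF tendsto_const[of m] LIMSEQ_Suc[OF lim_1_over_n]] by simp
    show "\<forall>\<^sub>F n in sequentially. m - 1 / Suc n \<le> L2_norm M (K (s n))"
      using s(3) by (intro always_eventually) (auto intro: less_imp_le)
    show "\<forall>\<^sub>F n in sequentially. L2_norm M (K (s n)) \<le> m"
      using le_m[OF s(1)] s(2) by (intro always_eventually) auto
  qed simp
  \<comment> \<open>Expand the square: by symmetry the cross term is \<open>m\<^sup>2\<close> times
    the squared norm of \<open>K (s n)\<close>, and the first term is at most the same quantity
    because \<open>K (s n)\<close> is again orthogonal to \<open>E\<close>, where \<open>m\<close>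
    bounds \<open>K\<close>.\<close>
  have near: "(L2_norm M (\<lambda>x. K (K (s n)) x - of_real (m\<^sup>2) * s n x))\<^sup>2
      \<le> m\<^sup>2 * (m\<^sup>2 - (L2_norm M (K (s n)))\<^sup>2)" for n
  proof -
    have "L2_norm M (K (K (s n))) \<le> m * L2_norm M (K (s n))"
      by (intro le_m K_orthogonal_to E s)
    then have "(L2_norm M (K (K (s n))))\<^sup>2 \<le> m\<^sup>2 * (L2_norm M (K (s n)))\<^sup>2"
      using power_mono[of "L2_norm M (K (K (s n)))" "m * L2_norm M (K (s n))" 2]
      by (simp add: power_mult_distrib)
    moreover have "Re (L2_inner M (K (K (s n))) (\<lambda>x. of_real (m\<^sup>2) * s n x)) = m\<^sup>2 * (L2_norm M (K (s n)))\<^sup>2"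
    proof -
      have "L2_inner M (K (K (s n))) (\<lambda>x. of_real (m\<^sup>2) * s n x) = of_real (m\<^sup>2) * L2_inner M (K (s n)) (K (s n))"
        by (subst L2_inner_scale_right) (simp add: K_symmetric s_L2)
      also have "\<dots> = of_real (m\<^sup>2 * (L2_norm M (K (s n)))\<^sup>2)"
        by (simp add: L2_inner_self)
      finally show ?thesis by (simp only: Re_complex_of_real)
    qed
    moreover have "(L2_norm M (\<lambda>x. of_real (m\<^sup>2) * s n x))\<^sup>2 = m\<^sup>2 * m\<^sup>2"
      by (subst L2_norm_scale) (simp only: norm_of_real, simp add: s power2_eq_square)
    moreover have "(L2_norm M (\<lambda>x. K (K (s n)) x - of_real (m\<^sup>2) * s n x))\<^sup>2 =
        (L2_norm M (K (K (s n))))\<^sup>2 + (L2_norm M (\<lambda>x. of_real (m\<^sup>2) * s n x))\<^sup>2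
        - 2 * Re (L2_inner M (K (K (s n))) (\<lambda>x. of_real (m\<^sup>2) * s n x))"
      by (rule L2_norm_diff_power2) (use s_L2 in auto)
    ultimately show ?thesis unfolding right_diff_distrib by linarith
  qed
  have near0: "(\<lambda>n. L2_norm M (\<lambda>x. K (K (s n)) x - of_real (m\<^sup>2) * s n x)) \<longlonglongrightarrow> 0"
  proof -
    have "(\<lambda>n. m\<^sup>2 * (m\<^sup>2 - (L2_norm M (K (s n)))\<^sup>2)) \<longlonglongrightarrow> m\<^sup>2 * (m\<^sup>2 - m\<^sup>2)"
      by (intro tendsto_intros lim_Ks)
    then have "(\<lambda>n. m\<^sup>2 * (m\<^sup>2 - (L2_norm M (K (s n)))\<^sup>2)) \<longlonglongrightarrow> 0" by simp
    then have "(\<lambda>n. (L2_norm M (\<lambda>x. K (K (s n)) x - of_real (m\<^sup>2) * s n x))\<^sup>2) \<longlonglongrightarrow> 0"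
      by (rule Lim_null_comparison[OF always_eventually[OF allI], rotated])
         (simp only: real_norm_def abs_power2 near)
    then have "(\<lambda>n. sqrt ((L2_norm M (\<lambda>x. K (K (s n)) x - of_real (m\<^sup>2) * s n x))\<^sup>2)) \<longlonglongrightarrow> sqrt 0"
      by (intro tendsto_real_sqrt)
    then show ?thesis by simp
  qed
  obtain r g where r: "strict_mono (r :: nat \<Rightarrow> nat)" and g: "g \<in> L2 M"
      "(\<lambda>n. L2_norm M (\<lambda>x. K (s (r n)) x - g x)) \<longlonglongrightarrow> 0"
    using K_compact[of s] s(2) s_L2 by force
  \<comment> \<open>Since \<open>K (K (s (r n)))\<close> is close to
    \<open>m\<^sup>2 * s (r n)\<close> and tends to \<open>K g\<close>, the vectors
    \<open>s (r n)\<close> themselves must converge to this multiple of \<open>K g\<close>.\<close>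
  define v where "v = (\<lambda>x. of_real (1 / m\<^sup>2) * K g x)"
  have v_L2: "v \<in> L2 M" unfolding v_def by (intro L2_scale K_L2 g)
  have near_r: "(\<lambda>n. L2_norm M (\<lambda>x. K (K (s (r n))) x - of_real (m\<^sup>2) * s (r n) x)) \<longlonglongrightarrow> 0"
    using LIMSEQ_subseq_LIMSEQ[OF near0 r] by (simp add: o_def)
  have sv: "(\<lambda>n. L2_norm M (\<lambda>x. s (r n) x - v x)) \<longlonglongrightarrow> 0"
  proof -
    have "(\<lambda>n. L2_norm M (\<lambda>x. K (K (s (r n))) x - K g x)) \<longlonglongrightarrow> 0"
      by (rule K_tendsto) (use s_L2 g in auto)
    from tendsto_mult_right_zero[OF tendsto_add_zero[OF near_r this], of "1 / m\<^sup>2"]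
    have "(\<lambda>n. 1 / m\<^sup>2 * (L2_norm M (\<lambda>x. K (K (s (r n))) x - of_real (m\<^sup>2) * s (r n) x)
        + L2_norm M (\<lambda>x. K (K (s (r n))) x - K g x))) \<longlonglongrightarrow> 0"
      .
    then show ?thesis
    proof (rule Lim_null_comparison[OF always_eventually[OF allI], rotated])
      fix n
      have eq: "s (r n) x - v x = of_real (1 / m\<^sup>2) * (of_real (m\<^sup>2) * s (r n) x - K g x)" for x
        using m_pos by (simp add: v_def field_simps)
      have "L2_norm M (\<lambda>x. s (r n) x - v x) = 1 / m\<^sup>2 * L2_norm M (\<lambda>x. of_real (m\<^sup>2) * s (r n) x - K g x)"
        unfolding eq by (subst L2_norm_scale) (simp only: norm_of_real, simp)
      also have "\<dots> \<le> 1 / m\<^sup>2 * (L2_norm M (\<lambda>x. of_real (m\<^sup>2) * s (r n) x - K (K (s (r n))) x)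
          + L2_norm M (\<lambda>x. K (K (s (r n))) x - K g x))"
        by (intro mult_left_mono L2_norm_diff_triangle) (use s_L2 g in auto)
      finally show "norm (L2_norm M (\<lambda>x. s (r n) x - v x)) \<le> 1 / m\<^sup>2 *
          (L2_norm M (\<lambda>x. K (K (s (r n))) x - of_real (m\<^sup>2) * s (r n) x)
          + L2_norm M (\<lambda>x. K (K (s (r n))) x - K g x))"
        using L2_norm_minus_commute[of M "K (K (s (r n)))"] by simp
    qed
  qed
  have v_norm: "L2_norm M v = 1"
    using L2_tendsto_imp_norm_tendsto[OF s_L2 v_L2 sv] s(2) by (simp add: LIMSEQ_const_iff)
  have v_orth: "v \<in> orthogonal_to E"
  proof -
    have "L2_inner M v u = 0" if "u \<in> E" for u
      using L2_tendsto_imp_inner_tendsto[OF s_L2 v_L2 sv, of u] s(1) that E_L2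
      by (auto simp: orthogonal_to_def LIMSEQ_const_iff)
    then show ?thesis using v_L2 by (simp add: orthogonal_to_def)
  qed
  have KKv: "AE x in M. K (K v) x = of_real (m\<^sup>2) * v x"
  proof -
    have "(\<lambda>n. L2_norm M (\<lambda>x. (K (K (s (r n))) x - of_real (m\<^sup>2) * s (r n) x)
        - (K (K v) x - of_real (m\<^sup>2) * v x))) \<longlonglongrightarrow> 0"
    proof (rule Lim_null_comparison[OF always_eventually[OF allI]])
      fix n
      have "L2_norm M (\<lambda>x. (K (K (s (r n))) x - of_real (m\<^sup>2) * s (r n) x)
        - (K (K v) x - of_real (m\<^sup>2) * v x)) =
        L2_norm M (\<lambda>x. (K (K (s (r n))) x - K (K v) x) + of_real (- (m\<^sup>2)) * (s (r n) x - v x))"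
        by (simp add: algebra_simps)
      also have "\<dots> \<le> L2_norm M (\<lambda>x. K (K (s (r n))) x - K (K v) x) + m\<^sup>2 * L2_norm M (\<lambda>x. s (r n) x - v x)"
        using L2_norm_triangle[of "\<lambda>x. K (K (s (r n))) x - K (K v) x" M "\<lambda>x. of_real (- (m\<^sup>2)) * (s (r n) x - v x)"]
          L2_norm_scale[of M "of_real (- (m\<^sup>2))" "\<lambda>x. s (r n) x - v x"] s_L2 v_L2
        by (simp add: norm_power)
      finally show "norm (L2_norm M (\<lambda>x. (K (K (s (r n))) x - of_real (m\<^sup>2) * s (r n) x)
        - (K (K v) x - of_real (m\<^sup>2) * v x)))
        \<le> L2_norm M (\<lambda>x. K (K (s (r n))) x - K (K v) x) + m\<^sup>2 * L2_norm M (\<lambda>x. s (r n) x - v x)"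
        by simp
    next
      have "(\<lambda>n. L2_norm M (\<lambda>x. K (K (s (r n))) x - K (K v) x)) \<longlonglongrightarrow> 0"
        by (intro K_tendsto sv) (use s_L2 v_L2 in auto)
      from tendsto_add[OF this tendsto_mult_right_zero[OF sv, of "m\<^sup>2"]]
      show "(\<lambda>n. L2_norm M (\<lambda>x. K (K (s (r n))) x - K (K v) x) + m\<^sup>2 * L2_norm M (\<lambda>x. s (r n) x - v x)) \<longlonglongrightarrow> 0"
        by simp
    qed
    then have "(\<lambda>n. L2_norm M (\<lambda>x. K (K (s (r n))) x - of_real (m\<^sup>2) * s (r n) x))
        \<longlonglongrightarrow> L2_norm M (\<lambda>x. K (K v) x - of_real (m\<^sup>2) * v x)"
      by (rule L2_tendsto_imp_norm_tendsto[rotated 2]) (use s_L2 v_L2 in auto)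
    then have "L2_norm M (\<lambda>x. K (K v) x - of_real (m\<^sup>2) * v x) = 0"
      using near_r LIMSEQ_unique by blast
    then have "AE x in M. K (K v) x - of_real (m\<^sup>2) * v x = 0"
      using v_L2 by (subst (asm) L2_norm_eq_0_iff) auto
    then show ?thesis by simp
  qed
  define u where "u = (\<lambda>x. K v x + of_real m * v x)"
  have u_orth: "u \<in> orthogonal_to E"
    unfolding u_def by (intro orthogonal_to_add E_L2 K_orthogonal_to E v_orth orthogonal_to_scale)
  have u_L2: "u \<in> L2 M" using u_orth by (rule orthogonal_to_L2)
  have "K u = (\<lambda>x. K (K v) x + of_real m * K v x)"
    unfolding u_def using v_L2 by (simp add: K_add K_scale)
  \<comment> \<open>This is the factorization \<open>(K - m) (K + m) v = 0\<close>.\<close>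
  then have Ku: "AE x in M. K u x = of_real m * u x"
    using KKv by (auto simp: u_def algebra_simps power2_eq_square)
  have u_norm: "L2_norm M u \<noteq> 0"
  proof
    assume "L2_norm M u = 0"
    then have "AE x in M. u x = 0" using u_L2 by (simp add: L2_norm_eq_0_iff)
    then have "L2_inner M u v = L2_inner M (\<lambda>x. 0) v"
      using u_L2 v_L2 by (intro L2_inner_cong_AE) auto
    \<comment> \<open>If \<open>u\<close> were null, pairing it with the unit vector
      \<open>v\<close> would give a sum of a nonnegative and a positive number equal to 0.\<close>
    then have "L2_inner M (K v) v + of_real m = 0"
      using v_L2 by (simp add: u_def L2_inner_algebra L2_inner_self v_norm)
    from arg_cong[OF this, of Re] have "Re (L2_inner M (K v) v) + m = 0" by simp
    then show False using K_positive[OF v_L2] m_pos by linarith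
  qed
  define e where "e = (\<lambda>x. complex_of_real (1 / L2_norm M u) * u x)"
  have "e \<in> L2 M" unfolding e_def by (rule L2_scale[OF u_L2])
  moreover have "K e = (\<lambda>x. complex_of_real (1 / L2_norm M u) * K u x)"
    unfolding e_def by (rule K_scale[OF u_L2])
  ultimately have "eigenfunction (of_real m) e"
    using Ku by (auto simp: eigenfunction_def e_def)
  then show ?thesis
    using that[of m e] m_pos normalized(1,2)[OF u_orth u_norm] le_m by (simp add: e_def)
qed

text \<open>A dimension count: the n+1 orthonormal vectors
  \<open>\<omega> 0, ..., \<omega> n\<close> cannot all lie in the span of \<open>n\<close> vectors.
  If every residual vanished, the double sum of squared coefficients would be n+1 when summed by
  rows, but at most \<open>n\<close> by columns, by Bessel's inequality for each
  \<open>b j\<close>.\<close>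

lemma exists_nonnull_orthogonal_to:
  fixes n :: nat
  assumes "L2_orthonormal M \<omega>" and "\<And>j. j < n \<Longrightarrow> b j \<in> L2 M"
    and "\<And>i j. i < n \<Longrightarrow> j < n \<Longrightarrow> L2_inner M (b i) (b j) = (if i = j then 1 else 0)"
  obtains f where "f \<in> orthogonal_to (b ` {..<n})" "\<not> (AE x in M. f x = 0)"
proof -
  \<comment> \<open>The part of \<open>\<omega> k\<close> left over after projecting onto the span
    of the \<open>b j\<close>.\<close>
  define p where "p k x = \<omega> k x - (\<Sum>j<n. L2_inner M (\<omega> k) (b j) * b j x)" for k x
  note \<omega> = L2_orthonormalD[OF assms(1)]
  have sum_L2: "(\<lambda>x. \<Sum>j<n. c j * b j x) \<in> L2 M" for c
    using assms(2) by (intro L2_sum L2_scale) auto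
  have p_L2: "(\<lambda>x. p k x) \<in> L2 M" for k
    unfolding p_def using \<omega> sum_L2 by (intro L2_diff)
  have p_b: "L2_inner M (\<lambda>x. p k x) (b i) = 0" if "i < n" for i k
  proof -
    have "L2_inner M (\<lambda>x. p k x) (b i)
        = L2_inner M (\<omega> k) (b i) - L2_inner M (\<lambda>x. \<Sum>j<n. L2_inner M (\<omega> k) (b j) * b j x) (b i)"
      unfolding p_def using \<omega> assms(2) that by (intro L2_inner_diff_left L2_sum L2_scale) auto
    also have "L2_inner M (\<lambda>x. \<Sum>j<n. L2_inner M (\<omega> k) (b j) * b j x) (b i)
        = (\<Sum>j<n. if j = i then L2_inner M (\<omega> k) (b i) else 0)"
      using assms(2) that
      by (subst L2_inner_sum_left) (auto simp: L2_inner_scale_left assms(3)[OF _ that] simp del: sum.delta intro!: sum.cong L2_scale)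
    finally show ?thesis using that by simp
  qed
  have p_norm: "(L2_norm M (\<lambda>x. p k x))\<^sup>2 = 1 - (\<Sum>j<n. (cmod (L2_inner M (b j) (\<omega> k)))\<^sup>2)" for k
  proof -
    have "L2_inner M (\<lambda>x. p k x) (\<lambda>x. p k x)
        = L2_inner M (\<lambda>x. p k x) (\<omega> k) - (\<Sum>j<n. cnj (L2_inner M (\<omega> k) (b j)) * L2_inner M (\<lambda>x. p k x) (b j))"
    proof -
      have "L2_inner M (\<lambda>x. p k x) (\<lambda>x. \<Sum>j<n. L2_inner M (\<omega> k) (b j) * b j x)
          = (\<Sum>j<n. cnj (L2_inner M (\<omega> k) (b j)) * L2_inner M (\<lambda>x. p k x) (b j))"
        using p_L2 assms(2)
        by (subst L2_inner_sum_right) (auto simp: L2_inner_scale_right intro!: sum.cong L2_scale)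
      then show ?thesis
        using L2_inner_diff_right[OF \<omega>(1)[of k] sum_L2[of "\<lambda>j. L2_inner M (\<omega> k) (b j)"] p_L2[of k]]
        by (simp add: p_def[abs_def])
    qed
    also have "\<dots> = L2_inner M (\<lambda>x. p k x) (\<omega> k)" by (simp add: p_b)
    also have "\<dots> = 1 - (\<Sum>j<n. L2_inner M (\<omega> k) (b j) * L2_inner M (b j) (\<omega> k))"
    proof -
      have "L2_inner M (\<lambda>x. \<Sum>j<n. L2_inner M (\<omega> k) (b j) * b j x) (\<omega> k)
          = (\<Sum>j<n. L2_inner M (\<omega> k) (b j) * L2_inner M (b j) (\<omega> k))"
        using \<omega> assms(2)
        by (subst L2_inner_sum_left) (auto simp: L2_inner_scale_left intro!: sum.cong L2_scale)
      then show ?thesis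
        using L2_inner_diff_left[OF \<omega>(1)[of k] sum_L2[of "\<lambda>j. L2_inner M (\<omega> k) (b j)"] \<omega>(1)[of k]]
        by (simp add: p_def[abs_def] \<omega>(2))
    qed
    also have "\<dots> = of_real (1 - (\<Sum>j<n. (cmod (L2_inner M (b j) (\<omega> k)))\<^sup>2))"
      unfolding L2_inner_commute[of M "\<omega> k"] cnj_mult_self by simp
    finally show ?thesis by (simp only: L2_norm_power2 Re_complex_of_real)
  qed
  have "\<exists>k\<le>n. L2_norm M (\<lambda>x. p k x) \<noteq> 0"
  proof (rule ccontr)
    assume "\<not> ?thesis"
    then have "(\<Sum>j<n. (cmod (L2_inner M (b j) (\<omega> k)))\<^sup>2) = 1" if "k \<le> n" for k
      using p_norm[of k] that by auto
    then have "real (Suc n) = (\<Sum>k\<le>n. \<Sum>j<n. (cmod (L2_inner M (b j) (\<omega> k)))\<^sup>2)" by simp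
    also have "\<dots> = (\<Sum>j<n. \<Sum>k\<le>n. (cmod (L2_inner M (b j) (\<omega> k)))\<^sup>2)" by (rule sum.swap)
    also have "\<dots> \<le> (\<Sum>j<n. 1)"
    proof (intro sum_mono)
      fix j assume j: "j \<in> {..<n}"
      then have "(L2_norm M (b j))\<^sup>2 = 1" using assms(3)[of j j] by (simp add: L2_norm_power2)
      then show "(\<Sum>k\<le>n. (cmod (L2_inner M (b j) (\<omega> k)))\<^sup>2) \<le> 1"
        using bessel_inequality[OF assms(1), of "b j" "{..n}"] assms(2) j by simp
    qed
    finally show False by simp
  qed
  then obtain k where "L2_norm M (\<lambda>x. p k x) \<noteq> 0" by blast
  then show ?thesis
    using that[of "\<lambda>x. p k x"] p_L2[of k] p_b by (auto simp: orthogonal_to_def L2_norm_eq_0_iff)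
qed

theorem spectral_theorem:
  obtains e \<mu> where "L2_orthonormal_basis M e" "\<And>n. \<mu> n > (0 :: real)" "\<And>n. \<mu> (Suc n) \<le> \<mu> n"
    "\<mu> \<longlonglongrightarrow> 0" "\<And>n. eigenfunction (complex_of_real (\<mu> n)) (e n)"
proof -
  obtain \<omega> where \<omega>: "L2_orthonormal M \<omega>" using infinite_dimensional by blast
  \<comment> \<open>\<open>r\<close> pairs a candidate eigenfunction with its eigenvalue.
    \<open>P f n\<close> looks at \<open>f\<close> only below \<open>n\<close>, as well-founded
    recursion requires; the last conjunct records maximality and drives monotonicity, convergence to
    0 and completeness.\<close>
  define P where "P f n r \<longleftrightarrow> snd r > 0 \<and> fst r \<in> orthogonal_to ((fst \<circ> f) ` {..<n}) \<and> L2_norm M (fst r) = 1 \<and>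
      eigenfunction (complex_of_real (snd r)) (fst r) \<and>
      (\<forall>g\<in>orthogonal_to ((fst \<circ> f) ` {..<n}). L2_norm M (K g) \<le> snd r * L2_norm M g)"
    for f :: "nat \<Rightarrow> ('a \<Rightarrow> complex) \<times> real" and n r
  have ortho: "L2_inner M (fst (f i)) (fst (f j)) = (if i = j then 1 else 0)"
    if "\<And>k. k < n \<Longrightarrow> P f k (f k)" "i < n" "j < n" for f n i j
  proof -
    have *: "L2_inner M (fst (f i)) (fst (f j)) = 0" if "j < i" "i < n" for i j
      using \<open>\<And>k. k < n \<Longrightarrow> P f k (f k)\<close>[of i] that by (auto simp: P_def orthogonal_to_def)
    have "L2_inner M (fst (f i)) (fst (f i)) = 1"
      using that(1)[OF that(2)] by (simp add: P_def L2_inner_self)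
    then show ?thesis
      using *[of i j] *[of j i] that(2,3) L2_inner_commute[of M "fst (f i)" "fst (f j)"]
      by (cases i j rule: linorder_cases) auto
  qed
  have "\<exists>f. \<forall>n. P f n (f n)"
  proof (rule dependent_wf_choice[of less_than])
    show "P f n r = P g n r" if "\<And>z. (z, n) \<in> less_than \<Longrightarrow> f z = g z" for f g n r
    proof -
      have "(fst \<circ> f) ` {..<n} = (fst \<circ> g) ` {..<n}" using that by (intro image_cong) auto
      then show ?thesis by (simp add: P_def)
    qed
    show "\<exists>r. P f n r" if "\<And>y. (y, n) \<in> less_than \<Longrightarrow> P f y (f y)" for n f
    proof -
      have Pf: "P f k (f k)" if "k < n" for k
        using \<open>\<And>y. (y, n) \<in> less_than \<Longrightarrow> P f y (f y)\<close> that by simp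
      have "(fst \<circ> f) j \<in> L2 M" if "j < n" for j
        using Pf[OF that] by (auto simp: P_def orthogonal_to_def)
      moreover have "L2_inner M ((fst \<circ> f) i) ((fst \<circ> f) j) = (if i = j then 1 else 0)" if "i < n" "j < n" for i j
        using ortho[OF Pf that] by simp
      ultimately obtain f0 where f0: "f0 \<in> orthogonal_to ((fst \<circ> f) ` {..<n})" "\<not> (AE x in M. f0 x = 0)"
        using exists_nonnull_orthogonal_to[OF \<omega>, of n "fst \<circ> f"] by blast
      have "\<exists>c. eigenfunction c u" if "u \<in> (fst \<circ> f) ` {..<n}" for u
        using Pf that by (auto simp: P_def)
      from exists_eigenfunction_orthogonal_to[OF this f0] obtain m e where
        "m > 0" "e \<in> orthogonal_to ((fst \<circ> f) ` {..<n})" "L2_norm M e = 1"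
        "eigenfunction (complex_of_real m) e"
        "\<And>g. g \<in> orthogonal_to ((fst \<circ> f) ` {..<n}) \<Longrightarrow> L2_norm M (K g) \<le> m * L2_norm M g"
        by metis
      then have "P f n (e, m)" by (simp add: P_def)
      then show ?thesis by blast
    qed
  qed simp
  then obtain f where f: "\<And>n. P f n (f n)" by blast
  define e where "e n = fst (f n)" for n
  define \<mu> where "\<mu> n = snd (f n)" for n
  have orth: "e n \<in> orthogonal_to (e ` {..<n})" for n
    using f[of n] by (auto simp: P_def e_def o_def)
  have e: "L2_orthonormal M e"
    unfolding L2_orthonormal_def
  proof (intro conjI allI)
    show "e n \<in> L2 M" for n using orth orthogonal_to_L2 by blast
    show "L2_inner M (e m) (e n) = (if m = n then 1 else 0)" for m n
      unfolding e_def by (rule ortho[of "Suc (max m n)"]) (use f in auto)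
  qed
  note eD = L2_orthonormalD[OF e]
  have \<mu>_pos: "\<mu> n > 0" for n using f[of n] by (simp add: P_def \<mu>_def)
  have eig: "eigenfunction (complex_of_real (\<mu> n)) (e n)" for n
    using f[of n] by (simp add: P_def \<mu>_def e_def)
  have le: "L2_norm M (K g) \<le> \<mu> n * L2_norm M g" if "g \<in> orthogonal_to (e ` {..<n})" for g n
    using f[of n] that by (auto simp: P_def \<mu>_def e_def o_def)
  have norm_K: "L2_norm M (K (e n)) = \<mu> n" for n
  proof -
    have "L2_norm M (K (e n)) = L2_norm M (\<lambda>x. complex_of_real (\<mu> n) * e n x)"
      using eig[of n] by (intro L2_norm_cong_AE) (auto simp: eigenfunction_def)
    then show ?thesis using \<mu>_pos[of n] by (simp add: L2_norm_scale eD)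
  qed
  have anti: "\<mu> n \<le> \<mu> m" if "m \<le> n" for m n
  proof -
    \<comment> \<open>\<open>e n\<close> already competes at the earlier stage \<open>m\<close>,
      where it has to be orthogonal to fewer vectors.\<close>
    have "e n \<in> orthogonal_to (e ` {..<m})"
      using orth[of n] that by (force simp: orthogonal_to_def)
    then show ?thesis using le[of "e n" m] by (simp add: norm_K eD)
  qed
  have "\<mu> \<longlonglongrightarrow> 0"
  proof (rule LIMSEQ_I)
    fix d :: real assume "d > 0"
    \<comment> \<open>Otherwise the \<open>K (e n)\<close> are mutually orthogonal of norm at least
      \<open>d\<close>, so any two are at distance at least \<open>d\<close>, and no subsequence of
      them can converge.\<close>
    have "\<exists>n. \<mu> n < d"
    proof (rule ccontr)
      assume "\<not> ?thesis"
      then have big: "\<mu> n \<ge> d" for n by (simp add: not_less)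
      obtain r g where r: "strict_mono (r :: nat \<Rightarrow> nat)" and g: "g \<in> L2 M"
          "(\<lambda>n. L2_norm M (\<lambda>x. K (e (r n)) x - g x)) \<longlonglongrightarrow> 0"
        using K_compact[of e] eD by fastforce
      obtain N where N: "\<And>n. n \<ge> N \<Longrightarrow> L2_norm M (\<lambda>x. K (e (r n)) x - g x) < d / 2"
        using LIMSEQ_D[OF g(2), of "d / 2"] \<open>d > 0\<close> by fastforce
      define i where "i = r N"
      define j where "j = r (Suc N)"
      have "i \<noteq> j" using r by (simp add: i_def j_def strict_mono_eq)
      have "L2_norm M (\<lambda>x. K (e i) x - K (e j) x) \<le>
          L2_norm M (\<lambda>x. K (e i) x - g x) + L2_norm M (\<lambda>x. g x - K (e j) x)"
        by (intro L2_norm_diff_triangle) (use eD g in auto)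
      also have "\<dots> < d / 2 + d / 2"
        using N[of N] N[of "Suc N"] L2_norm_minus_commute[of M g "K (e j)"]
        by (intro add_strict_mono) (auto simp: i_def j_def)
      finally have "(L2_norm M (\<lambda>x. K (e i) x - K (e j) x))\<^sup>2 < d\<^sup>2"
        using \<open>d > 0\<close> by (intro power_strict_mono) auto
      moreover have "L2_inner M (K (e i)) (K (e j)) = 0"
        using inner_K_eigenfunction[OF eig[of i], of "K (e j)"] inner_K_eigenfunction[OF eig[of i], of "e j"]
          L2_inner_commute[of M "K (e i)" "K (e j)"] \<open>i \<noteq> j\<close>
        by (metis K_L2 K_symmetric eD(1) eD(2) eig inner_K_eigenfunction mult_zero_right)
      moreover have "d\<^sup>2 \<le> (\<mu> i)\<^sup>2" "0 \<le> (\<mu> j)\<^sup>2"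
        using big[of i] \<open>d > 0\<close> by (auto intro!: power_mono)
      ultimately show False
        by (simp add: L2_norm_diff_power2 eD norm_K)
    qed
    then obtain N where "\<mu> N < d" by blast
    then have "\<forall>n\<ge>N. norm (\<mu> n - 0) < d"
      using anti[of N] \<mu>_pos by (auto simp: abs_of_pos) (meson le_less_trans)
    then show "\<exists>N. \<forall>n\<ge>N. norm (\<mu> n - 0) < d" by blast
  qed
  moreover have "L2_orthonormal_basis M e"
    unfolding L2_orthonormal_basis_def
  proof (intro conjI ballI e)
    fix h assume h: "h \<in> L2 M"
    obtain g where g: "g \<in> L2 M" "\<And>n. L2_inner M g (e n) = L2_inner M h (e n)"
        "(\<lambda>N. L2_norm M (\<lambda>x. (\<Sum>n<N. L2_inner M h (e n) * e n x) - g x)) \<longlonglongrightarrow> 0"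
      using riesz_fischer[OF e finite bessel_summable[OF e h]] by blast
    \<comment> \<open>What the Fourier series of \<open>h\<close> fails to capture. It is orthogonal
      to every \<open>e n\<close>, so \<open>K q\<close> has norm at most \<open>\<mu> n\<close>
      times that of \<open>q\<close> for all \<open>n\<close>; hence \<open>K q\<close> is null, and
      injectivity makes \<open>q\<close> null.\<close>
    define q where "q = (\<lambda>x. h x - g x)"
    have q: "q \<in> L2 M" unfolding q_def using h g by auto
    have "q \<in> orthogonal_to (e ` {..<n})" for n
      using q h g by (auto simp: orthogonal_to_def q_def L2_inner_diff_left eD)
    then have "L2_norm M (K q) \<le> \<mu> n * L2_norm M q" for n by (rule le)
    then have "L2_norm M (K q) \<le> 0"
      using LIMSEQ_le_const[OF tendsto_mult_left_zero[OF \<open>\<mu> \<longlonglongrightarrow> 0\<close>, of "L2_norm M q"]] by blast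
    then have "L2_norm M (K q) = 0" using L2_norm_nonneg[of M "K q"] by linarith
    then have "AE x in M. K q x = 0" using q by (simp add: L2_norm_eq_0_iff)
    then have q0: "AE x in M. q x = 0" using K_injective[OF q] by simp
    have "L2_norm M (\<lambda>x. h x - (\<Sum>n<N. L2_inner M h (e n) * e n x))
        = L2_norm M (\<lambda>x. (\<Sum>n<N. L2_inner M h (e n) * e n x) - g x)" for N
      unfolding L2_norm_minus_commute[of M h]
      by (intro L2_norm_cong_AE) (use q0 h g eD in \<open>auto simp: q_def\<close>)
    then show "(\<lambda>N. L2_norm M (\<lambda>x. h x - (\<Sum>n<N. L2_inner M h (e n) * e n x))) \<longlonglongrightarrow> 0"
      using g(3) by simp
  qed
  ultimately show ?thesis using that[of e \<mu>] \<mu>_pos anti[OF le_SucI[OF order_refl]] eig by blast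
qed

end

section \<open>The inverse of \<open>K\<close> as a self-adjoint unbounded operator\<close>

context compact_positive_operator
begin

text \<open>The operator sends \<open>f = K g\<close> to \<open>g\<close>. Only measurability is
  asked of \<open>f\<close>, so that all its representatives are included; square-integrability then
  follows.\<close>

definition inverse_graph :: "'a operator_graph" where
  "inverse_graph = {(f, g). f \<in> borel_measurable M \<and> g \<in> L2 M \<and> (AE x in M. f x = K g x)}"

lemma inverse_graphD:
  assumes "(f, g) \<in> inverse_graph"
  shows "f \<in> L2 M" "g \<in> L2 M" "AE x in M. f x = K g x"
  using assms L2_AE_cong[of "K g" M f] by (auto simp: inverse_graph_def)

lemma inverse_graphI: "g \<in> L2 M \<Longrightarrow> (K g, g) \<in> inverse_graph"
  using K_L2[of g] by (auto simp: inverse_graph_def intro: L2_measurable)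

lemma linear_inverse_graph: "linear_operator_in M inverse_graph"
  unfolding linear_operator_in_def
proof (intro conjI allI impI)
  show "inverse_graph \<subseteq> L2 M \<times> L2 M" using inverse_graphD by auto
next
  fix f g f' g'
  assume *: "(f, g) \<in> inverse_graph \<and> f' \<in> borel_measurable M \<and> g' \<in> borel_measurable M \<and>
    (AE x in M. f' x = f x) \<and> (AE x in M. g' x = g x)"
  then have g': "g' \<in> L2 M" using L2_AE_cong[of g M g'] inverse_graphD by blast
  moreover have "AE x in M. K g' x = K g x"
    using * g' inverse_graphD(2) by (intro K_cong_AE) auto
  ultimately show "(f', g') \<in> inverse_graph" using * by (auto simp: inverse_graph_def)
next
  fix f g g' assume *: "(f, g) \<in> inverse_graph \<and> (f, g') \<in> inverse_graph"
  note g = inverse_graphD[OF conjunct1[OF *]] inverse_graphD[OF conjunct2[OF *]]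
  \<comment> \<open>Single-valuedness of the inverse is injectivity of \<open>K\<close>.\<close>
  have "AE x in M. g x - g' x = 0"
  proof (rule K_injective)
    have "AE x in M. K g x - K g' x = 0" using g(3,6) by eventually_elim simp
    then show "AE x in M. K (\<lambda>x. g x - g' x) x = 0" by (simp add: K_diff g(2,5))
  qed (use g in auto)
  then show "AE x in M. g x = g' x" by simp
next
  show "((\<lambda>x. 0), \<lambda>x. 0) \<in> inverse_graph" by (simp add: inverse_graph_def K_zero)
next
  fix f g f' g' assume *: "(f, g) \<in> inverse_graph \<and> (f', g') \<in> inverse_graph"
  note g = inverse_graphD[OF conjunct1[OF *]] inverse_graphD[OF conjunct2[OF *]]
  show "(\<lambda>x. f x + f' x, \<lambda>x. g x + g' x) \<in> inverse_graph"
    using g L2_measurable[OF g(1)] L2_measurable[OF g(4)] by (auto simp: inverse_graph_def K_add)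
next
  fix c f g assume *: "(f, g) \<in> inverse_graph"
  note g = inverse_graphD[OF *]
  show "(\<lambda>x. c * f x, \<lambda>x. c * g x) \<in> inverse_graph"
    using g L2_measurable[OF g(1)] by (auto simp: inverse_graph_def K_scale)
qed

text \<open>\<open>K\<close> is symmetric and defined on the whole space, so every vector occurs as
  a second component. The defining identity of the adjoint may therefore be tested at the defect
  \<open>d = u - K v\<close> itself, and it says that \<open>d\<close> has norm 0.\<close>

lemma adjoint_inverse_graph: "adjoint_graph M inverse_graph = inverse_graph"
proof (intro set_eqI iffI; clarify)
  fix u v assume "(u, v) \<in> adjoint_graph M inverse_graph"
  then have uv: "u \<in> L2 M" "v \<in> L2 M"
    and eq: "\<And>f g. (f, g) \<in> inverse_graph \<Longrightarrow> L2_inner M g u = L2_inner M f v"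
    by (auto simp: adjoint_graph_def)
  define d where "d = (\<lambda>x. u x - K v x)"
  have d: "d \<in> L2 M" unfolding d_def using uv by auto
  have "L2_inner M d u = L2_inner M d (K v)"
    using eq[OF inverse_graphI[OF d]] d uv by (simp add: K_symmetric)
  then have "L2_inner M d d = 0"
    using L2_inner_diff_right[OF uv(1) K_L2[OF uv(2)] d] by (simp add: d_def)
  then have "L2_norm M d = 0" by (simp add: L2_inner_self)
  then have "AE x in M. d x = 0" using d by (simp add: L2_norm_eq_0_iff)
  then show "(u, v) \<in> inverse_graph"
    using uv by (auto simp: inverse_graph_def d_def L2_measurable)
next
  fix u v assume uv: "(u, v) \<in> inverse_graph"
  note uvD = inverse_graphD[OF uv]
  have "L2_inner M g u = L2_inner M f v" if fg: "(f, g) \<in> inverse_graph" for f g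
  proof -
    note fgD = inverse_graphD[OF fg]
    have "L2_inner M g u = L2_inner M g (K v)"
      using uvD fgD by (intro L2_inner_cong_AE) auto
    also have "\<dots> = L2_inner M (K g) v" using uvD fgD by (simp add: K_symmetric)
    also have "\<dots> = L2_inner M f v"
      using uvD fgD by (intro L2_inner_cong_AE) auto
    finally show ?thesis .
  qed
  then show "(u, v) \<in> adjoint_graph M inverse_graph"
    using uvD by (auto simp: adjoint_graph_def)
qed

section \<open>Resolvent and spectrum in terms of an eigenbasis\<close>

context
  fixes e \<mu>
  assumes basis: "L2_orthonormal_basis M e"
    and \<mu>_pos: "\<And>n. \<mu> n > (0 :: real)"
    and \<mu>_antimono: "\<And>n. \<mu> (Suc n) \<le> \<mu> n"
    and \<mu>_null: "\<mu> \<longlonglongrightarrow> 0"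
    and eigen: "\<And>n. eigenfunction (complex_of_real (\<mu> n)) (e n)"
begin

lemma orthonormal: "L2_orthonormal M e"
  using basis by (simp add: L2_orthonormal_basis_def)

lemmas e_L2 [simp, intro] = L2_orthonormalD(1)[OF orthonormal]
lemmas e_inner = L2_orthonormalD(2)[OF orthonormal]
lemmas e_norm = L2_orthonormalD(3)[OF orthonormal]

lemma expansion:
  "f \<in> L2 M \<Longrightarrow> (\<lambda>N. L2_norm M (\<lambda>x. f x - (\<Sum>n<N. L2_inner M f (e n) * e n x))) \<longlonglongrightarrow> 0"
  using basis by (simp add: L2_orthonormal_basis_def)

lemma parseval:
  assumes f: "f \<in> L2 M"
  shows "(\<lambda>n. (cmod (L2_inner M f (e n)))\<^sup>2) sums (L2_norm M f)\<^sup>2"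
proof -
  have "(\<lambda>N. (L2_norm M f)\<^sup>2 - (L2_norm M (\<lambda>x. f x - (\<Sum>n<N. L2_inner M f (e n) * e n x)))\<^sup>2)
      \<longlonglongrightarrow> (L2_norm M f)\<^sup>2 - 0\<^sup>2"
    by (intro tendsto_intros expansion f)
  then show ?thesis
    by (simp add: sums_def bessel_identity[OF orthonormal f])
qed

lemma null_if_coefficients_zero:
  assumes f: "f \<in> L2 M" and "\<And>n. L2_inner M f (e n) = 0"
  shows "AE x in M. f x = 0"
proof -
  have "(\<lambda>n. 0) sums (L2_norm M f)\<^sup>2" using parseval[OF f] by (simp add: assms(2))
  then have "L2_norm M f = 0" using sums_unique2[OF sums_zero] by fastforce
  then show ?thesis using f by (simp add: L2_norm_eq_0_iff)
qed

lemma inner_K_e: "f \<in> L2 M \<Longrightarrow> L2_inner M (K f) (e n) = of_real (\<mu> n) * L2_inner M f (e n)"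
  using inner_K_eigenfunction[OF eigen[of n]] by simp

lemma inner_inverse_graph:
  assumes "(f, g) \<in> inverse_graph"
  shows "L2_inner M f (e n) = of_real (\<mu> n) * L2_inner M g (e n)"
proof -
  note fg = inverse_graphD[OF assms]
  have "L2_inner M f (e n) = L2_inner M (K g) (e n)"
    using fg by (intro L2_inner_cong_AE) auto
  then show ?thesis using fg by (simp add: inner_K_e)
qed

lemma e_in_eigenspace: "e n \<in> eigenspace M inverse_graph (complex_of_real (1 / \<mu> n))"
proof -
  have "K (\<lambda>x. complex_of_real (1 / \<mu> n) * e n x) = (\<lambda>x. complex_of_real (1 / \<mu> n) * K (e n) x)"
    by (rule K_scale) auto
  moreover have "(\<lambda>x. complex_of_real (1 / \<mu> n) * e n x) \<in> L2 M" by (intro L2_scale e_L2)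
  moreover have "AE x in M. complex_of_real (1 / \<mu> n) * K (e n) x = e n x"
    using eigen[of n] \<mu>_pos[of n] by (auto simp: eigenfunction_def)
  ultimately have "(e n, \<lambda>x. complex_of_real (1 / \<mu> n) * e n x) \<in> inverse_graph"
    using L2_measurable[OF e_L2[of n]] by (auto simp: inverse_graph_def)
  then show ?thesis by (auto simp: eigenspace_def)
qed

lemma e_nonnull: "\<not> (AE x in M. e n x = 0)"
  using L2_norm_eq_0_iff[OF e_L2[of n]] e_norm[of n] by simp

text \<open>The basis functions lie in the domain, so all partial sums of the expansion do as
  well.\<close>

lemma densely_defined_inverse_graph: "densely_defined M inverse_graph"
  unfolding densely_defined_def
proof (intro ballI allI impI)
  fix f and \<epsilon> :: real assume f: "f \<in> L2 M" and "\<epsilon> > 0"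
  obtain N where N: "L2_norm M (\<lambda>x. f x - (\<Sum>n<N. L2_inner M f (e n) * e n x)) < \<epsilon>"
    using LIMSEQ_D[OF expansion[OF f] \<open>\<epsilon> > 0\<close>] by auto
  have "(\<lambda>x. \<Sum>n<N. L2_inner M f (e n) * e n x) \<in> Domain inverse_graph"
  proof (induction N)
    case 0
    show ?case using linear_inverse_graph by (auto simp: linear_operator_in_def)
  next
    case (Suc N)
    then obtain g where "((\<lambda>x. \<Sum>n<N. L2_inner M f (e n) * e n x), g) \<in> inverse_graph" by auto
    moreover obtain g' where "(e N, g') \<in> inverse_graph"
      using e_in_eigenspace[of N] by (auto simp: eigenspace_def)
    then have "(\<lambda>x. L2_inner M f (e N) * e N x, \<lambda>x. L2_inner M f (e N) * g' x) \<in> inverse_graph"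
      using linear_inverse_graph unfolding linear_operator_in_def by blast
    ultimately have "(\<lambda>x. (\<Sum>n<N. L2_inner M f (e n) * e n x) + L2_inner M f (e N) * e N x,
        \<lambda>x. g x + L2_inner M f (e N) * g' x) \<in> inverse_graph"
      using linear_inverse_graph unfolding linear_operator_in_def by blast
    then show ?case by auto
  qed
  then show "\<exists>h\<in>Domain inverse_graph. L2_norm M (\<lambda>x. f x - h x) < \<epsilon>"
    using N by (intro bexI[where x="\<lambda>x. \<Sum>n<N. L2_inner M f (e n) * e n x"])
qed

text \<open>The reciprocals converge to 1 because \<open>\<mu>\<close> tends to 0, and a convergent
  sequence is bounded.\<close>

lemma resolvent_coefficient_bound:
  assumes "\<And>n. z \<noteq> complex_of_real (1 / \<mu> n)"
  obtains B where "\<And>n. cmod (inverse (1 - z * of_real (\<mu> n))) \<le> B" "\<And>n. 1 - z * of_real (\<mu> n) \<noteq> 0"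
proof -
  have "1 - z * of_real (\<mu> n) \<noteq> 0" for n
    using assms[of n] \<mu>_pos[of n] by (auto simp: field_simps)
  moreover have "(\<lambda>n. inverse (1 - z * complex_of_real (\<mu> n))) \<longlonglongrightarrow> inverse (1 - z * of_real 0)"
    by (intro tendsto_intros \<mu>_null) simp
  then have "Bseq (\<lambda>n. inverse (1 - z * complex_of_real (\<mu> n)))"
    by (intro convergent_imp_Bseq) (auto simp: convergent_def)
  then obtain B where "\<And>n. cmod (inverse (1 - z * of_real (\<mu> n))) \<le> B" by (auto elim!: BseqE)
  ultimately show ?thesis by (intro that)
qed

text \<open>In the eigenbasis the operator minus \<open>z\<close> is diagonal: for
  \<open>f = K g\<close> the n-th coefficient of \<open>g - z f\<close> is
  \<open>1 - z * \<mu> n\<close> times that of \<open>g\<close>. Parseval turns the bound on the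
  reciprocals into the resolvent estimate, and Riesz-Fischer turns it into solvability.\<close>

lemma in_resolvent_set:
  assumes z: "\<And>n. z \<noteq> complex_of_real (1 / \<mu> n)"
  shows "z \<in> resolvent_set M inverse_graph"
proof -
  obtain B where B: "\<And>n. cmod (inverse (1 - z * of_real (\<mu> n))) \<le> B"
    and nz: "\<And>n. 1 - z * of_real (\<mu> n) \<noteq> 0"
    using resolvent_coefficient_bound[OF z] by blast
  have "B \<ge> 0" using B[of 0] norm_ge_zero order_trans by blast
  have \<mu>_le: "\<mu> n \<le> \<mu> 0" for n
    by (induction n) (auto intro: order_trans[OF \<mu>_antimono])
  have bound: "L2_norm M f \<le> B * \<mu> 0 * L2_norm M (\<lambda>x. g x - z * f x)" if fg: "(f, g) \<in> inverse_graph" for f g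
  proof -
    note fgD = inverse_graphD[OF fg]
    define w where "w = (\<lambda>x. g x - z * f x)"
    have w: "w \<in> L2 M" unfolding w_def using fgD by auto
    \<comment> \<open>The coefficient of \<open>f\<close> is
      \<open>\<mu> n / (1 - z * \<mu> n)\<close> times that of \<open>w\<close>, and
      \<open>\<mu> n \<le> \<mu> 0\<close>.\<close>
    have coeff: "(cmod (L2_inner M f (e n)))\<^sup>2 \<le> (B * \<mu> 0)\<^sup>2 * (cmod (L2_inner M w (e n)))\<^sup>2" for n
    proof -
      have "L2_inner M w (e n) = (1 - z * of_real (\<mu> n)) * L2_inner M g (e n)"
        using fgD by (simp add: w_def L2_inner_diff_left L2_inner_scale_left inner_inverse_graph[OF fg] algebra_simps)
      then have "L2_inner M f (e n) = of_real (\<mu> n) * inverse (1 - z * of_real (\<mu> n)) * L2_inner M w (e n)"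
        using nz[of n] by (simp add: inner_inverse_graph[OF fg])
      then have "cmod (L2_inner M f (e n))
          = \<mu> n * cmod (inverse (1 - z * of_real (\<mu> n))) * cmod (L2_inner M w (e n))"
        using \<mu>_pos[of n] by (simp add: norm_mult)
      also have "\<dots> \<le> \<mu> 0 * B * cmod (L2_inner M w (e n))"
        using \<mu>_le[of n] B[of n] \<mu>_pos[of 0] by (intro mult_right_mono mult_mono) auto
      finally have "(cmod (L2_inner M f (e n)))\<^sup>2 \<le> (\<mu> 0 * B * cmod (L2_inner M w (e n)))\<^sup>2"
        by (intro power_mono) auto
      then show ?thesis by (simp add: power_mult_distrib mult_ac)
    qed
    have "(L2_norm M f)\<^sup>2 \<le> (B * \<mu> 0)\<^sup>2 * (L2_norm M w)\<^sup>2"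
      by (rule sums_le[OF coeff parseval[OF fgD(1)] sums_mult[OF parseval[OF w]]])
    then have "(L2_norm M f)\<^sup>2 \<le> (B * \<mu> 0 * L2_norm M w)\<^sup>2" by (simp add: power_mult_distrib)
    then show ?thesis
      unfolding w_def[symmetric]
      by (rule power2_le_imp_le) (use \<open>B \<ge> 0\<close> \<mu>_pos[of 0] in \<open>simp add: less_imp_le\<close>)
  qed
  have inj: "AE x in M. f x = 0" if fg: "(f, g) \<in> inverse_graph" and "AE x in M. g x - z * f x = 0" for f g
  proof -
    note fgD = inverse_graphD[OF fg]
    have "L2_norm M (\<lambda>x. g x - z * f x) = 0"
      using that(2) fgD by (subst L2_norm_eq_0_iff) auto
    then have "L2_norm M f = 0" using bound[OF fg] L2_norm_nonneg[of M f] by simp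
    then show ?thesis using fgD by (simp add: L2_norm_eq_0_iff)
  qed
  have surj: "\<exists>(f, g)\<in>inverse_graph. AE x in M. g x - z * f x = h x" if h: "h \<in> L2 M" for h
  proof -
    \<comment> \<open>The coefficients that \<open>g\<close> is forced to have if
      \<open>g - z * K g = h\<close>.\<close>
    define a where "a n = inverse (1 - z * of_real (\<mu> n)) * L2_inner M h (e n)" for n
    have "summable (\<lambda>n. (cmod (a n))\<^sup>2)"
    proof (rule summable_comparison_test')
      show "summable (\<lambda>n. B\<^sup>2 * (cmod (L2_inner M h (e n)))\<^sup>2)"
        by (intro summable_mult bessel_summable[OF orthonormal h])
      show "norm ((cmod (a n))\<^sup>2) \<le> B\<^sup>2 * (cmod (L2_inner M h (e n)))\<^sup>2" for n
        using mult_mono[OF power_mono[OF B[of n], of 2] order_refl[of "(cmod (L2_inner M h (e n)))\<^sup>2"]]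
        by (simp add: a_def norm_mult power_mult_distrib)
    qed
    then obtain g where g: "g \<in> L2 M" "\<And>n. L2_inner M g (e n) = a n"
      using riesz_fischer[OF orthonormal finite] by blast
    have *: "(\<lambda>x. (g x - z * K g x) - h x) \<in> L2 M" using g h by auto
    have "L2_inner M (\<lambda>x. (g x - z * K g x) - h x) (e n) = 0" for n
    proof -
      have "L2_inner M (\<lambda>x. (g x - z * K g x) - h x) (e n) = a n - z * (of_real (\<mu> n) * a n) - L2_inner M h (e n)"
        using g h by (simp add: L2_inner_diff_left L2_inner_scale_left inner_K_e)
      also have "\<dots> = (1 - z * of_real (\<mu> n)) * a n - L2_inner M h (e n)" by (simp add: algebra_simps)
      also have "\<dots> = 0" using nz[of n] by (simp add: a_def)
      finally show ?thesis .
    qed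
    from null_if_coefficients_zero[OF * this] have "AE x in M. g x - z * K g x = h x" by simp
    then show ?thesis using inverse_graphI[OF g(1)] by blast
  qed
  show ?thesis
    unfolding resolvent_set_def using bound inj surj by blast
qed

lemma spectrum_inverse_graph: "op_spectrum M inverse_graph = range (\<lambda>n. complex_of_real (1 / \<mu> n))"
proof -
  have "complex_of_real (1 / \<mu> n) \<notin> resolvent_set M inverse_graph" for n
  proof -
    obtain g where "(e n, g) \<in> inverse_graph" "AE x in M. g x = complex_of_real (1 / \<mu> n) * e n x"
      using e_in_eigenspace[of n] by (auto simp: eigenspace_def)
    then show ?thesis
      using e_nonnull[of n] unfolding resolvent_set_def by fastforce
  qed
  then show ?thesis
    using in_resolvent_set unfolding op_spectrum_def by blast
qed

lemma inverse_\<mu>_at_top: "filterlim (\<lambda>n. 1 / \<mu> n) at_top sequentially"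
proof -
  have "filterlim \<mu> (at_right 0) sequentially"
    using \<mu>_null \<mu>_pos \<mu>_pos[THEN less_imp_neq, THEN not_sym] by (simp add: filterlim_at)
  from filterlim_compose[OF filterlim_inverse_at_top_right this] show ?thesis
    by (simp add: inverse_eq_divide)
qed

text \<open>The common source of isolation and of finite multiplicity: only finitely many indices
  share a bounded range of eigenvalues.\<close>

lemma finite_eigenvalues_below: "Finite_Set.finite {n. 1 / \<mu> n \<le> c}"
proof -
  have "\<forall>\<^sub>F n in sequentially. c < 1 / \<mu> n"
    using inverse_\<mu>_at_top by (simp add: filterlim_at_top_dense)
  then obtain N where "\<And>n. n \<ge> N \<Longrightarrow> c < 1 / \<mu> n" by (auto simp: eventually_sequentially)
  then have "{n. 1 / \<mu> n \<le> c} \<subseteq> {..<N}" by (auto simp flip: not_le)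
  then show ?thesis by (rule finite_subset) simp
qed

lemma isolated_eigenvalue:
  "complex_of_real (1 / \<mu> n) isolated_in range (\<lambda>n. complex_of_real (1 / \<mu> n))"
proof -
  define l where "l = (\<lambda>n. complex_of_real (1 / \<mu> n))"
  have "Finite_Set.finite (l ` {k. 1 / \<mu> k \<le> 1 / \<mu> n + 1})"
    by (intro finite_imageI finite_eigenvalues_below)
  then obtain d where d: "d > 0" "\<And>y. y \<in> l ` {k. 1 / \<mu> k \<le> 1 / \<mu> n + 1} \<Longrightarrow> y \<noteq> l n \<Longrightarrow> d \<le> dist (l n) y"
    using finite_set_avoid[of "l ` {k. 1 / \<mu> k \<le> 1 / \<mu> n + 1}" "l n"] by blast
  \<comment> \<open>The cap 1 confines \<open>y\<close> to the finitely many eigenvalues up to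
    \<open>1 / \<mu> n + 1\<close>, and \<open>d\<close> separates \<open>l n\<close> from all of
    those.\<close>
  have "y = l n" if y: "y \<in> range l" and dist: "dist (l n) y < min d 1" for y
  proof -
    obtain k where k: "y = l k" using y by blast
    have "1 / \<mu> k \<le> 1 / \<mu> n + 1"
      using dist unfolding k l_def dist_norm of_real_diff[symmetric] norm_of_real by linarith
    then show ?thesis using d(2)[of y] dist k by fastforce
  qed
  then have "l n isolated_in range l"
    unfolding isolated_in_dist_Ex_iff using d(1) by (intro conjI exI[of _ "min d 1"]) auto
  then show ?thesis by (simp only: l_def)
qed

text \<open>Comparing coefficients in the eigenvalue equation shows that an eigenfunction has none
  outside the finite set \<open>I\<close> of indices with the same eigenvalue.\<close>

lemma finite_multiplicity_eigenvalue: "finite_multiplicity M inverse_graph (complex_of_real (1 / \<mu> n))"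
proof -
  define I where "I = {k. \<mu> k = \<mu> n}"
  have I: "Finite_Set.finite I"
    by (rule finite_subset[OF _ finite_eigenvalues_below[of "1 / \<mu> n"]]) (auto simp: I_def)
  \<comment> \<open>The definition indexes the coefficients of a combination by functions, so the
    sum over \<open>I\<close> has to be transported along \<open>e\<close>.\<close>
  have inj: "inj_on e I"
    using e_inner by (intro inj_onI) (metis zero_neq_one)
  show ?thesis
    unfolding finite_multiplicity_def
  proof (intro exI[of _ "e ` I"] conjI ballI)
    show "Finite_Set.finite (e ` I)" using I by simp
    show "e ` I \<subseteq> eigenspace M inverse_graph (complex_of_real (1 / \<mu> n))"
      using e_in_eigenspace by (auto simp: I_def) (metis of_real_1 of_real_divide)
  next
    fix f assume "f \<in> eigenspace M inverse_graph (complex_of_real (1 / \<mu> n))"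
    then obtain g where fg: "(f, g) \<in> inverse_graph" and ae: "AE x in M. g x = complex_of_real (1 / \<mu> n) * f x"
      by (auto simp: eigenspace_def)
    note fgD = inverse_graphD[OF fg]
    have zero: "L2_inner M f (e k) = 0" if "k \<notin> I" for k
    proof -
      have "L2_inner M g (e k) = L2_inner M (\<lambda>x. complex_of_real (1 / \<mu> n) * f x) (e k)"
        using fgD ae by (intro L2_inner_cong_AE L2_scale) auto
      then have "L2_inner M f (e k) = of_real (\<mu> k) * (of_real (1 / \<mu> n) * L2_inner M f (e k))"
        unfolding inner_inverse_graph[OF fg, of k] L2_inner_scale_left by simp
      then have "of_real (\<mu> n) * L2_inner M f (e k) = of_real (\<mu> k) * L2_inner M f (e k)"
        using \<mu>_pos[of n] by (simp add: field_simps)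
      then show ?thesis using that by (simp add: I_def)
    qed
    have sum: "(\<lambda>x. \<Sum>k\<in>I. L2_inner M f (e k) * e k x) \<in> L2 M" by (intro L2_sum L2_scale e_L2)
    have "AE x in M. f x - (\<Sum>k\<in>I. L2_inner M f (e k) * e k x) = 0"
    proof (rule null_if_coefficients_zero)
      show "L2_inner M (\<lambda>x. f x - (\<Sum>k\<in>I. L2_inner M f (e k) * e k x)) (e m) = 0" for m
        using zero[of m] by (simp add: L2_inner_diff_left fgD sum inner_orthonormal_sum[OF orthonormal I])
    qed (intro L2_diff fgD sum)
    then have "AE x in M. f x = (\<Sum>b\<in>e ` I. L2_inner M f b * b x)"
      by (simp add: sum.reindex[OF inj])
    then show "\<exists>c. AE x in M. f x = (\<Sum>b\<in>e ` I. c b * b x)" by (rule exI[of _ "L2_inner M f"])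
  qed
qed

lemma purely_discrete_inverse_graph: "purely_discrete_spectrum M inverse_graph"
proof -
  have "complex_of_real (1 / \<mu> n) \<in> discrete_spectrum M inverse_graph" for n
    unfolding discrete_spectrum_def spectrum_inverse_graph is_eigenvalue_def
    using isolated_eigenvalue finite_multiplicity_eigenvalue e_in_eigenspace e_nonnull by blast
  then show ?thesis
    unfolding purely_discrete_spectrum_def
    by (auto simp: spectrum_inverse_graph) (auto simp: discrete_spectrum_def spectrum_inverse_graph isolated_in_def)
qed

end

theorem inverse_graph_spectral:
  "self_adjoint_in M inverse_graph" (is ?A)
  "purely_discrete_spectrum M inverse_graph" (is ?B)
  "\<exists>(lam :: nat \<Rightarrow> real) e.
       (\<forall>n. 0 < (lam n)\<^sup>2) \<and> (\<forall>n. (lam n)\<^sup>2 \<le> (lam (Suc n))\<^sup>2) \<and>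
       filterlim (\<lambda>n. (lam n)\<^sup>2) at_top sequentially \<and>
       op_spectrum M inverse_graph = range (\<lambda>n. complex_of_real ((lam n)\<^sup>2)) \<and>
       (\<forall>n. e n \<in> eigenspace M inverse_graph (complex_of_real ((lam n)\<^sup>2))) \<and>
       L2_orthonormal_basis M e" (is ?C)
proof -
  obtain e \<mu> where *: "L2_orthonormal_basis M e" "\<And>n. \<mu> n > (0 :: real)" "\<And>n. \<mu> (Suc n) \<le> \<mu> n"
    "\<mu> \<longlonglongrightarrow> 0" "\<And>n. eigenfunction (complex_of_real (\<mu> n)) (e n)"
    using spectral_theorem by blast
  show ?A unfolding self_adjoint_in_def
    using linear_inverse_graph adjoint_inverse_graph densely_defined_inverse_graph[OF *] by simp
  show ?B by (rule purely_discrete_inverse_graph[OF *])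
  \<comment> \<open>The eigenvalues are stated as squares, so \<open>lam n\<close> is the square
    root of \<open>1 / \<mu> n\<close>.\<close>
  have sq: "(sqrt (1 / \<mu> n))\<^sup>2 = 1 / \<mu> n" for n using *(2)[of n] by simp
  show ?C
  proof (intro exI[of _ "\<lambda>n. sqrt (1 / \<mu> n)"] exI[of _ e], unfold sq, intro conjI allI)
    show "1 / \<mu> n \<le> 1 / \<mu> (Suc n)" for n
      using *(2)[of n] *(2)[of "Suc n"] *(3)[of n] by (intro divide_left_mono) auto
  qed (use *(2) inverse_\<mu>_at_top[OF *] spectrum_inverse_graph[OF *] e_in_eigenspace[OF *] *(1) in auto)
qed

end

section \<open>Bump functions\<close>

text \<open>The classical smooth function that is flat at 0, with a polynomial factor in
  \<open>1 / x\<close> so that derivatives keep the same shape. The rate \<open>s\<close> is kept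
  free because letting it tend to 0 produces indicator functions.\<close>

definition flat :: "real poly \<Rightarrow> real \<Rightarrow> real \<Rightarrow> real" where
  "flat p s x = (if x > 0 then poly p (1 / x) * exp (- s / x) else 0)"

lemma flat_uminus: "flat (- p) s x = - flat p s x"
  by (simp add: flat_def)

lemma tendsto_poly_exp_0:
  assumes "s > 0" shows "((\<lambda>y::real. poly p y * exp (- s * y)) \<longlongrightarrow> 0) at_top"
proof -
  have "((\<lambda>y. (s * y) ^ k / exp (s * y)) \<longlongrightarrow> 0) at_top" for k
    by (rule filterlim_compose[OF tendsto_power_div_exp_0])
       (rule filterlim_tendsto_pos_mult_at_top[OF tendsto_const assms filterlim_ident])
  then have "((\<lambda>y. \<Sum>k\<le>degree p. coeff p k / s ^ k * ((s * y) ^ k / exp (s * y))) \<longlongrightarrow> 0) at_top"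
    by (intro tendsto_null_sum tendsto_mult_right_zero)
  also have "(\<lambda>y. \<Sum>k\<le>degree p. coeff p k / s ^ k * ((s * y) ^ k / exp (s * y))) = (\<lambda>y. poly p y * exp (- s * y))"
  proof
    fix y
    have "(\<Sum>k\<le>degree p. coeff p k / s ^ k * ((s * y) ^ k / exp (s * y)))
        = (\<Sum>k\<le>degree p. coeff p k * y ^ k * exp (- s * y))"
      using assms by (intro sum.cong) (simp_all add: power_mult_distrib exp_minus divide_inverse)
    then show "(\<Sum>k\<le>degree p. coeff p k / s ^ k * ((s * y) ^ k / exp (s * y))) = poly p y * exp (- s * y)"
      by (simp add: poly_altdef sum_distrib_right)
  qed
  finally show ?thesis .
qed

text \<open>For positive \<open>x\<close>, differentiating \<open>p(1/x) * exp (-s/x)\<close> gives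
  the factor \<open>(s * p(1/x) - p'(1/x)) / x\<^sup>2\<close>, which is the new polynomial at
  \<open>1 / x\<close>. At 0 the exponential beats every power.\<close>

lemma flat_has_derivative:
  assumes "s > 0"
  shows "(flat p s has_field_derivative flat ([:0, 0, 1:] * (smult s p - pderiv p)) s x) (at x)"
proof (cases x "0 :: real" rule: linorder_cases)
  case less
  have "((\<lambda>x. 0) has_field_derivative 0) (at x)" by simp
  then have "(flat p s has_field_derivative 0) (at x)"
    by (rule DERIV_cong_ev[OF refl _ refl, THEN iffD1, rotated])
       (use less eventually_nhds_in_open[of "{..<0}" x] in \<open>auto elim!: eventually_mono simp: flat_def\<close>)
  then show ?thesis using less by (simp add: flat_def)
next
  case greater
  have "((\<lambda>x. poly p (1 / x) * exp (- s / x)) has_field_derivative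
      flat ([:0, 0, 1:] * (smult s p - pderiv p)) s x) (at x)"
    using greater
    by (auto intro!: derivative_eq_intros simp: flat_def field_simps power2_eq_square)
  then show ?thesis
    by (rule DERIV_cong_ev[OF refl _ refl, THEN iffD1, rotated])
       (use greater eventually_nhds_in_open[of "{0<..}" x] in \<open>auto elim!: eventually_mono simp: flat_def\<close>)
next
  case equal
  have "((\<lambda>y. flat p s y / y) \<longlongrightarrow> 0) (at 0)"
  proof (rule filterlim_split_at)
    show "((\<lambda>y. flat p s y / y) \<longlongrightarrow> 0) (at_left 0)"
      by (rule tendsto_eventually) (auto simp: eventually_at_filter flat_def)
    \<comment> \<open>Dividing by \<open>x\<close> multiplies the polynomial by its variable, so the
      difference quotient is again a polynomial times an exponential in
      \<open>inverse x\<close>.\<close>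
    have "((\<lambda>x. poly ([:0, 1:] * p) (inverse x) * exp (- s * inverse x)) \<longlongrightarrow> 0) (at_right 0)"
      by (rule filterlim_compose[OF tendsto_poly_exp_0[OF assms] filterlim_inverse_at_top_right])
    moreover have "\<forall>\<^sub>F x in at_right 0. poly ([:0, 1:] * p) (inverse x) * exp (- s * inverse x) = flat p s x / x"
      by (auto simp: eventually_at_filter flat_def field_simps)
    ultimately show "((\<lambda>y. flat p s y / y) \<longlongrightarrow> 0) (at_right 0)"
      by (rule Lim_transform_eventually)
  qed
  then have "(flat p s has_field_derivative 0) (at 0)"
    by (simp add: has_field_derivative_iff flat_def)
  then show ?thesis using equal by (simp add: flat_def)
qed

text \<open>A class closed under differentiation that contains the bumps. It reduces smoothness of
  every order to one differentiation step.\<close>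

inductive_set flat_algebra :: "real \<Rightarrow> real \<Rightarrow> real \<Rightarrow> (real \<Rightarrow> real) set" for c d s where
  left: "(\<lambda>x. flat p s (x - c)) \<in> flat_algebra c d s"
| right: "(\<lambda>x. flat p s (d - x)) \<in> flat_algebra c d s"
| add: "f \<in> flat_algebra c d s \<Longrightarrow> g \<in> flat_algebra c d s \<Longrightarrow> (\<lambda>x. f x + g x) \<in> flat_algebra c d s"
| mult: "f \<in> flat_algebra c d s \<Longrightarrow> g \<in> flat_algebra c d s \<Longrightarrow> (\<lambda>x. f x * g x) \<in> flat_algebra c d s"

lemma flat_algebra_deriv:
  assumes "s > 0" "f \<in> flat_algebra c d s"
  shows "\<exists>f'\<in>flat_algebra c d s. \<forall>x. (f has_field_derivative f' x) (at x)"
  using assms(2)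
proof induction
  case (left p)
  have "((\<lambda>x. flat p s (x - c)) has_field_derivative flat ([:0, 0, 1:] * (smult s p - pderiv p)) s (x - c)) (at x)" for x
  proof -
    have "((\<lambda>x. flat p s (x - c)) has_field_derivative
        flat ([:0, 0, 1:] * (smult s p - pderiv p)) s (x - c) * 1) (at x)"
      by (rule DERIV_chain'[where f="\<lambda>x. x - c", OF _ flat_has_derivative[OF assms(1)]]) (auto intro!: derivative_eq_intros)
    then show ?thesis by simp
  qed
  then show ?case by (intro bexI[OF _ flat_algebra.left] allI)
next
  case (right p)
  have "((\<lambda>x. flat p s (d - x)) has_field_derivative
      flat (- ([:0, 0, 1:] * (smult s p - pderiv p))) s (d - x)) (at x)" for x
  proof -
    have "((\<lambda>x. flat p s (d - x)) has_field_derivative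
      flat ([:0, 0, 1:] * (smult s p - pderiv p)) s (d - x) * (-1)) (at x)"
      by (rule DERIV_chain'[where f="\<lambda>x. d - x", OF _ flat_has_derivative[OF assms(1)]]) (auto intro!: derivative_eq_intros)
    then show ?thesis by (simp only: flat_uminus mult_minus1_right)
  qed
  then show ?case by (intro bexI[OF _ flat_algebra.right] allI)
next
  case (add f g)
  then obtain f' g' where "f' \<in> flat_algebra c d s" "g' \<in> flat_algebra c d s"
    "\<And>x. (f has_field_derivative f' x) (at x)" "\<And>x. (g has_field_derivative g' x) (at x)" by blast
  then show ?case
    by (intro bexI[of _ "\<lambda>x. f' x + g' x"] allI DERIV_add flat_algebra.add)
next
  case (mult f g)
  then obtain f' g' where "f' \<in> flat_algebra c d s" "g' \<in> flat_algebra c d s"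
    "\<And>x. (f has_field_derivative f' x) (at x)" "\<And>x. (g has_field_derivative g' x) (at x)" by blast
  then show ?case using mult.hyps
    by (intro bexI[of _ "\<lambda>x. f' x * g x + g' x * f x"] allI DERIV_mult flat_algebra.add flat_algebra.mult)
qed

definition bump :: "real \<Rightarrow> real \<Rightarrow> real \<Rightarrow> real \<Rightarrow> real" where
  "bump c d s x = flat 1 s (x - c) * flat 1 s (d - x)"

lemma bump_smooth:
  assumes "s > 0" shows "(deriv ^^ n) (bump c d s) field_differentiable at x"
proof -
  have "(deriv ^^ n) (bump c d s) \<in> flat_algebra c d s" for n
  proof (induction n)
    case 0
    then show ?case unfolding bump_def[abs_def] by (auto intro: flat_algebra.intros)
  next
    case (Suc n)
    obtain f' where "f' \<in> flat_algebra c d s" "\<And>x. ((deriv ^^ n) (bump c d s) has_field_derivative f' x) (at x)"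
      using flat_algebra_deriv[OF assms Suc] by blast
    moreover from this(2) have "deriv ((deriv ^^ n) (bump c d s)) = f'"
      by (intro ext DERIV_imp_deriv)
    ultimately show ?case by simp
  qed
  from flat_algebra_deriv[OF assms this[of n]] show ?thesis
    by (auto simp: field_differentiable_def)
qed

lemma bump_outside: "x \<notin> {c<..<d} \<Longrightarrow> bump c d s x = 0"
  by (auto simp: bump_def flat_def)

lemma bump_pos: "x \<in> {c<..<d} \<Longrightarrow> bump c d s x > 0"
  by (auto simp: bump_def flat_def)

lemma bump_nonneg: "bump c d s x \<ge> 0"
  by (simp add: bump_def flat_def)

lemma bump_le_1: "s > 0 \<Longrightarrow> bump c d s x \<le> 1"
  unfolding bump_def flat_def by (intro mult_le_one) auto

text \<open>On the interval both exponents tend to 0 with \<open>s\<close>, and outside it every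
  bump vanishes.\<close>

lemma bump_tendsto: "(\<lambda>n. bump c d (1 / real (Suc n)) x) \<longlonglongrightarrow> indicator {c<..<d} x"
proof (cases "x \<in> {c<..<d}")
  case True
  have "(\<lambda>n. exp (- (1 / real (Suc n)) / (x - c)) * exp (- (1 / real (Suc n)) / (d - x)))
      \<longlonglongrightarrow> exp (- 0 / (x - c)) * exp (- 0 / (d - x))"
    by (intro tendsto_intros LIMSEQ_Suc[OF lim_1_over_n]) (use True in auto)
  then show ?thesis using True by (simp add: bump_def flat_def)
qed (simp add: bump_outside)

lemma test_function_bump:
  assumes "s > 0" "a < c" "d < b" shows "test_function a b (bump c d s)"
  unfolding test_function_def using bump_smooth[OF assms(1)] assms(2,3)
  by (auto simp: bump_outside intro!: exI[of _ "{c..d}"])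

section \<open>Test functions\<close>

lemma test_function_deriv:
  assumes "test_function a b \<phi>" shows "test_function a b (deriv \<phi>)"
proof -
  obtain K where K: "compact K" "K \<subseteq> {a<..<b}" "\<And>x. x \<notin> K \<Longrightarrow> \<phi> x = 0"
    using assms by (auto simp: test_function_def)
  have "deriv \<phi> x = 0" if "x \<notin> K" for x
  proof -
    have "\<forall>\<^sub>F y in nhds x. y \<in> - K"
      using that compact_imp_closed[OF K(1)] by (intro eventually_nhds_in_open) auto
    then have "\<forall>\<^sub>F y in nhds x. \<phi> y = 0" by eventually_elim (use K(3) in auto)
    then have "deriv \<phi> x = deriv (\<lambda>x. 0) x" by (rule deriv_cong_ev) simp
    then show ?thesis by simp
  qed
  moreover have "(deriv ^^ n) (deriv \<phi>) field_differentiable at x" for n x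
    using assms unfolding test_function_def by (metis funpow_swap1 funpow.simps(2) comp_apply)
  ultimately show ?thesis using K unfolding test_function_def by blast
qed

lemma test_function_continuous:
  assumes "test_function a b \<phi>" shows "continuous_on S \<phi>"
proof -
  have "(deriv ^^ 0) \<phi> field_differentiable at x" for x using assms unfolding test_function_def by blast
  then show ?thesis
    by (intro continuous_at_imp_continuous_on) (auto intro: field_differentiable_imp_continuous_at)
qed

lemma test_function_has_deriv:
  assumes "test_function a b \<phi>" shows "(\<phi> has_field_derivative deriv \<phi> x) (at x)"
proof -
  have "(deriv ^^ 0) \<phi> field_differentiable at x" for x using assms unfolding test_function_def by blast
  then show ?thesis using DERIV_deriv_iff_field_differentiable by auto
qed

lemma test_function_endpoints:
  assumes "test_function a b \<phi>" "x \<notin> {a<..<b}" shows "\<phi> x = 0"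
  using assms by (auto simp: test_function_def)

lemma test_function_diff_scale:
  assumes "test_function a b \<phi>" "test_function a b \<psi>"
  shows "test_function a b (\<lambda>x. \<phi> x - k * \<psi> x)"
proof -
  obtain K L where "compact K" "K \<subseteq> {a<..<b}" "\<And>x. x \<notin> K \<Longrightarrow> \<phi> x = 0"
      "compact L" "L \<subseteq> {a<..<b}" "\<And>x. x \<notin> L \<Longrightarrow> \<psi> x = 0"
    using assms by (auto simp: test_function_def)
  then have "\<exists>K. compact K \<and> K \<subseteq> {a<..<b} \<and> (\<forall>x. x \<notin> K \<longrightarrow> \<phi> x - k * \<psi> x = 0)"
    by (intro exI[of _ "K \<union> L"]) auto
  moreover have D: "(deriv ^^ n) \<phi> field_differentiable at x" "(deriv ^^ n) \<psi> field_differentiable at x" for n x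
    using assms by (auto simp: test_function_def)
  have "(deriv ^^ n) (\<lambda>x. \<phi> x - k * \<psi> x) = (\<lambda>x. (deriv ^^ n) \<phi> x - k * (deriv ^^ n) \<psi> x)" for n
  proof (induction n)
    case (Suc n)
    have "deriv (\<lambda>x. (deriv ^^ n) \<phi> x - k * (deriv ^^ n) \<psi> x) x
        = deriv ((deriv ^^ n) \<phi>) x - k * deriv ((deriv ^^ n) \<psi>) x" for x
      using D by (intro DERIV_imp_deriv derivative_eq_intros)
        (auto simp: DERIV_deriv_iff_field_differentiable)
    then show ?case by (simp add: Suc)
  qed simp
  then have "(deriv ^^ n) (\<lambda>x. \<phi> x - k * \<psi> x) field_differentiable at x" for n x
    using D by (simp add: field_differentiable_diff field_differentiable_mult field_differentiable_const)
  ultimately show ?thesis by (simp add: test_function_def)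
qed

lemma test_function_integrable:
  assumes "test_function a b \<phi>" shows "integrable lborel \<phi>"
proof -
  obtain K where K: "compact K" "K \<subseteq> {a<..<b}" "\<And>x. x \<notin> K \<Longrightarrow> \<phi> x = 0"
    using assms by (auto simp: test_function_def)
  have "integrable lborel (\<lambda>x. indicator K x *\<^sub>R \<phi> x)"
    by (intro borel_integrable_compact K test_function_continuous[OF assms])
  also have "(\<lambda>x. indicator K x *\<^sub>R \<phi> x) = \<phi>" using K(3) by (auto simp: indicator_def fun_eq_iff)
  finally show ?thesis .
qed

text \<open>The zero integral is exactly what makes the integral from the left vanish again to the
  right of the support.\<close>

lemma test_function_antiderivative:
  assumes \<zeta>: "test_function a b \<zeta>" and zero: "(LINT x|lborel. \<zeta> x) = 0"
  obtains \<phi> where "test_function a b \<phi>" "deriv \<phi> = \<zeta>"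
proof -
  obtain K where K: "compact K" "K \<subseteq> {a<..<b}" "\<And>x. x \<notin> K \<Longrightarrow> \<zeta> x = 0"
    using \<zeta> by (auto simp: test_function_def)
  obtain c d where cd: "a < c" "d < b" "K \<subseteq> {c..d}"
  proof (cases "K = {}")
    \<comment> \<open>An empty support has no extreme points; these values meet the requirements
      even if \<open>c > d\<close>.\<close>
    case True
    then show ?thesis using that[of "a + 1" "b - 1"] by simp
  next
    case False
    then obtain c d where "c \<in> K" "d \<in> K" "\<And>x. x \<in> K \<Longrightarrow> c \<le> x" "\<And>x. x \<in> K \<Longrightarrow> x \<le> d"
      using compact_attains_inf[OF K(1)] compact_attains_sup[OF K(1)] by metis
    then have "a < c" "d < b" "K \<subseteq> {c..d}" using K(2) by auto
    then show ?thesis by (rule that)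
  qed
  have zero_out: "\<zeta> x = 0" if "x < c \<or> d < x" for x
    by (rule K(3)) (use that cd(3) in auto)
  \<comment> \<open>Starting at \<open>c - 1\<close> instead of \<open>c\<close> makes every
    \<open>x \<ge> c\<close> an interior point of the interval on which the antiderivative is
    differentiated.\<close>
  define \<phi> where "\<phi> x = integral {c - 1..x} \<zeta>" for x
  note cont = test_function_continuous[OF \<zeta>]
  have \<phi>0: "\<phi> x = 0" if "x < c" for x
  proof -
    have "\<phi> x = integral {c - 1..x} (\<lambda>x. 0)" unfolding \<phi>_def
      by (rule Henstock_Kurzweil_Integration.integral_cong) (use that zero_out in auto)
    then show ?thesis by simp
  qed
  have deriv: "(\<phi> has_field_derivative \<zeta> x) (at x)" for x
  proof (cases "x < c")
    case True
    have "((\<lambda>x. 0) has_field_derivative 0) (at x)" by simp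
    then have "(\<phi> has_field_derivative 0) (at x)"
      by (rule DERIV_cong_ev[OF refl _ refl, THEN iffD1, rotated])
         (use True eventually_nhds_in_open[of "{..<c}" x] in \<open>auto elim!: eventually_mono simp: \<phi>0\<close>)
    then show ?thesis using zero_out True by simp
  next
    case False
    have "(\<phi> has_real_derivative \<zeta> x) (at x within {c - 1..x + 1})"
      unfolding \<phi>_def by (rule integral_has_real_derivative[OF cont]) (use False in auto)
    moreover have "at x within {c - 1..x + 1} = at x"
      by (rule at_within_interior) (use False in simp)
    ultimately show ?thesis by metis
  qed
  then have deriv_eq: "deriv \<phi> = \<zeta>" by (intro ext DERIV_imp_deriv)
  have \<phi>1: "\<phi> x = 0" if "d < x" for x
  proof -
    have "set_integrable lborel {c - 1..x} \<zeta>"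
      unfolding set_integrable_def by (intro borel_integrable_compact cont) auto
    then have "\<phi> x = (LBINT t:{c - 1..x}. \<zeta> t)"
      unfolding \<phi>_def by (rule set_borel_integral_eq_integral(2)[symmetric])
    also have "\<dots> = (LINT t|lborel. \<zeta> t)"
      unfolding set_lebesgue_integral_def
    proof (rule Bochner_Integration.integral_cong)
      show "indicator {c - 1..x} t *\<^sub>R \<zeta> t = \<zeta> t" for t
        using that zero_out[of t] by (cases "t \<in> {c - 1..x}") auto
    qed simp
    finally show ?thesis by (simp add: zero)
  qed
  have "(deriv ^^ n) \<phi> field_differentiable at x" for n x
  proof (cases n)
    case 0
    then show ?thesis using deriv by (auto simp: field_differentiable_def)
  next
    case (Suc m)
    then have "(deriv ^^ n) \<phi> = (deriv ^^ m) \<zeta>"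
      using deriv_eq by (metis funpow_swap1 funpow.simps(2) comp_apply)
    then show ?thesis using \<zeta> by (simp add: test_function_def)
  qed
  moreover have "\<exists>K. compact K \<and> K \<subseteq> {a<..<b} \<and> (\<forall>x. x \<notin> K \<longrightarrow> \<phi> x = 0)"
    using cd \<phi>0 \<phi>1 by (intro exI[of _ "{c..d}"]) (auto simp: not_le)
  ultimately show ?thesis using that[of \<phi>] deriv_eq by (auto simp: test_function_def)
qed

section \<open>Weak derivatives\<close>

lemma lborel_on_simps [simp]:
  "space (lborel_on a b) = {a<..<b}"
  "borel_measurable (lborel_on a b) = borel_measurable (restrict_space borel {a<..<b})"
  by (auto simp: space_restrict_space intro!: measurable_cong_sets sets_restrict_space_cong)

lemma AE_lborel_on: "(AE x in lborel_on a b. P x) \<longleftrightarrow> (AE x in lborel. x \<in> {a<..<b} \<longrightarrow> P x)"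
  by (rule AE_restrict_space_iff) simp

lemma integrable_lborel_on: "integrable (lborel_on a b) f \<longleftrightarrow> set_integrable lborel {a<..<b} f"
  for f :: "real \<Rightarrow> 'a::{banach, second_countable_topology}"
  by (simp add: integrable_restrict_space set_integrable_def)

lemma integral_lborel_on: "integral\<^sup>L (lborel_on a b) f = (LBINT x:{a<..<b}. f x)"
  for f :: "real \<Rightarrow> 'a::{banach, second_countable_topology}"
  by (simp add: integral_restrict_space set_lebesgue_integral_def)

text \<open>Open intervals form an intersection-stable generator of the Borel sets, so vanishing
  integrals spread to all Borel sets; the total integral handles complements.\<close>

lemma AE_zero_if_interval_integrals_zero:
  fixes f :: "real \<Rightarrow> complex"
  assumes f: "integrable lborel f" and total: "(LINT x|lborel. f x) = 0"
    and zero: "\<And>x y. x < y \<Longrightarrow> (LBINT t:{x<..<y}. f t) = 0"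
  shows "AE x in lborel. f x = 0"
proof (rule sigma_finite_measure.density_zero[OF sigma_finite_lborel f])
  have int: "set_integrable lborel A f" if "A \<in> sets lborel" for A
    unfolding set_integrable_def using that f by (rule integrable_mult_indicator)
  define G where "G = range (\<lambda>(x, y). {x<..<y :: real})"
  have borel: "sets lborel = sigma_sets UNIV G"
    using arg_cong[OF borel_eq_box[where 'a=real], of sets] by (simp add: G_def)
  have "Int_stable G"
    by (auto simp: Int_stable_def G_def)
  moreover have "G \<subseteq> Pow UNIV" by simp
  moreover fix A :: "real set" assume "A \<in> sets lborel"
  then have "A \<in> sigma_sets UNIV G" by (simp only: borel)
  ultimately show "(LBINT x:A. f x) = 0"
  proof (induction rule: sigma_sets_induct_disjoint)
    case (basic A)
    then obtain x y where "A = {x<..<y}" by (auto simp: G_def)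
    then show ?case using zero[of x y] by (cases "x < y") (auto simp: set_lebesgue_integral_def)
  next
    case empty
    then show ?case by (simp add: set_lebesgue_integral_def)
  next
    case (compl A)
    then have A: "A \<in> sets lborel" by (simp only: borel)
    have "0 = (LBINT x:A \<union> (UNIV - A). f x)" using total by (simp add: set_lebesgue_integral_def)
    also have "\<dots> = (LBINT x:A. f x) + (LBINT x:UNIV - A. f x)"
      using A by (intro set_integral_Un int) auto
    finally show ?case using compl by simp
  next
    case (union A)
    have A: "A i \<in> sets lborel" for i using union(2) unfolding borel by blast
    have "(LBINT x:\<Union> (range A). f x) = (\<Sum>i. LBINT x:A i. f x)"
      using A union(1) by (intro lebesgue_integral_countable_add int) (auto simp: disjoint_family_on_def)
    then show ?case by (simp add: union)
  qed
qed

lemma locally_integrableD: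
  "locally_integrable a b f \<Longrightarrow> compact K \<Longrightarrow> K \<subseteq> {a<..<b} \<Longrightarrow> set_integrable lborel K f"
  by (simp add: locally_integrable_def)

text \<open>Only the compact support of \<open>\<phi>\<close> matters: there \<open>f\<close> is
  integrable and \<open>\<phi>\<close> is bounded.\<close>

lemma locally_integrable_times_test_function:
  assumes f: "locally_integrable a b f" and \<phi>: "test_function a b \<phi>"
  shows "set_integrable lborel {a<..<b} (\<lambda>x. f x * complex_of_real (\<phi> x))"
proof -
  obtain K where K: "compact K" "K \<subseteq> {a<..<b}" "\<And>x. x \<notin> K \<Longrightarrow> \<phi> x = 0"
    using \<phi> by (auto simp: test_function_def)
  have fK: "integrable lborel (\<lambda>x. indicator K x *\<^sub>R f x)"
    using f K by (auto simp: locally_integrable_def set_integrable_def)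
  have "bounded (\<phi> ` K)"
    by (intro compact_imp_bounded compact_continuous_image test_function_continuous[OF \<phi>] K)
  then obtain B where B: "\<And>x. x \<in> K \<Longrightarrow> \<bar>\<phi> x\<bar> \<le> B"
    unfolding bounded_iff by auto
  have [measurable]: "\<phi> \<in> borel_measurable borel"
    by (intro borel_measurable_continuous_onI test_function_continuous[OF \<phi>])
  have [measurable]: "(\<lambda>x. indicator K x *\<^sub>R f x) \<in> borel_measurable borel"
    using borel_measurable_integrable[OF fK] by simp
  have "integrable lborel (\<lambda>x. (indicator K x *\<^sub>R f x) * complex_of_real (\<phi> x))"
  proof (rule Bochner_Integration.integrable_bound)
    show "integrable lborel (\<lambda>x. \<bar>B\<bar> * norm (indicator K x *\<^sub>R f x))"
      using fK by (intro integrable_mult_right integrable_norm)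
    have "norm ((indicator K x *\<^sub>R f x) * complex_of_real (\<phi> x)) \<le> norm (\<bar>B\<bar> * norm (indicator K x *\<^sub>R f x))" for x
    proof (cases "x \<in> K")
      case True
      then have "\<bar>\<phi> x\<bar> \<le> \<bar>B\<bar>" using B[of x] by linarith
      then have "\<bar>\<phi> x\<bar> * norm (f x) \<le> \<bar>B\<bar> * norm (f x)" by (intro mult_right_mono) auto
      then show ?thesis using True by (simp add: norm_mult mult.commute)
    qed simp
    then show "AE x in lborel. norm ((indicator K x *\<^sub>R f x) * complex_of_real (\<phi> x))
        \<le> norm (\<bar>B\<bar> * norm (indicator K x *\<^sub>R f x))" by simp
  qed measurable
  also have "(\<lambda>x. (indicator K x *\<^sub>R f x) * complex_of_real (\<phi> x))
      = (\<lambda>x. indicator {a<..<b} x *\<^sub>R (f x * complex_of_real (\<phi> x)))"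
    using K by (auto simp: indicator_def fun_eq_iff subset_iff)
  finally show ?thesis by (simp add: set_integrable_def)
qed

text \<open>Testing with bump functions that increase to the indicator of an interval.\<close>

theorem fundamental_lemma_calculus_of_variations:
  assumes f: "locally_integrable a b f"
    and zero: "\<And>\<phi>. test_function a b \<phi> \<Longrightarrow> (LBINT x:{a<..<b}. f x * complex_of_real (\<phi> x)) = 0"
  shows "AE x in lborel_on a b. f x = 0"
proof -
  have sub: "(LBINT x:{c<..<d}. f x) = 0" if "a < c" "c < d" "d < b" for c d
  proof -
    \<comment> \<open>\<open>f\<close> is only locally integrable, so it is cut off to the closed
      interval to obtain a dominating function.\<close>
    have fK: "integrable lborel (\<lambda>x. indicator {c..d} x *\<^sub>R f x)"
    proof -
      have "{c..d} \<subseteq> {a<..<b}" using that by (simp add: subset_iff)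
      from locally_integrableD[OF f compact_Icc this] show ?thesis by (simp add: set_integrable_def)
    qed
    have [measurable]: "(\<lambda>x. indicator {c..d} x *\<^sub>R f x) \<in> borel_measurable borel"
      using borel_measurable_integrable[OF fK] by simp
    define \<psi> where "\<psi> n = bump c d (1 / real (Suc n))" for n
    have \<psi>: "test_function a b (\<psi> n)" for n
      unfolding \<psi>_def using that by (intro test_function_bump) auto
    have [measurable]: "\<psi> n \<in> borel_measurable borel" for n
      by (intro borel_measurable_continuous_onI test_function_continuous[OF \<psi>])
    have lim: "(\<lambda>n. LINT x|lborel. complex_of_real (\<psi> n x) * (indicator {c..d} x *\<^sub>R f x))
        \<longlonglongrightarrow> (LINT x|lborel. complex_of_real (indicator {c<..<d} x) * (indicator {c..d} x *\<^sub>R f x))"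
    proof (rule integral_dominated_convergence)
      show "AE x in lborel. (\<lambda>n. complex_of_real (\<psi> n x) * (indicator {c..d} x *\<^sub>R f x))
          \<longlonglongrightarrow> complex_of_real (indicator {c<..<d} x) * (indicator {c..d} x *\<^sub>R f x)"
        unfolding \<psi>_def by (intro always_eventually allI tendsto_intros bump_tendsto)
      show "integrable lborel (\<lambda>x. norm (indicator {c..d} x *\<^sub>R f x))" using fK by (rule integrable_norm)
      have "norm (complex_of_real (\<psi> n x) * (indicator {c..d} x *\<^sub>R f x)) \<le> norm (indicator {c..d} x *\<^sub>R f x)" for n x
        unfolding norm_mult norm_of_real \<psi>_def
        by (rule mult_left_le_one_le) (use bump_le_1 bump_nonneg in auto)
      then show "AE x in lborel. norm (complex_of_real (\<psi> n x) * (indicator {c..d} x *\<^sub>R f x))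
          \<le> norm (indicator {c..d} x *\<^sub>R f x)" for n by simp
    qed measurable
    have eq: "(LINT x|lborel. complex_of_real (indicator {c<..<d} x) * (indicator {c..d} x *\<^sub>R f x))
        = (LBINT x:{c<..<d}. f x)"
      unfolding set_lebesgue_integral_def
      by (rule Bochner_Integration.integral_cong) (auto simp: indicator_def)
    have "(LINT x|lborel. complex_of_real (\<psi> n x) * (indicator {c..d} x *\<^sub>R f x)) = 0" for n
    proof -
      have "complex_of_real (\<psi> n x) * (indicator {c..d} x *\<^sub>R f x)
          = indicator {a<..<b} x *\<^sub>R (f x * complex_of_real (\<psi> n x))" for x
        using that bump_outside[of x c d] by (cases "x \<in> {c<..<d}") (auto simp: \<psi>_def)
      then show ?thesis using zero[OF \<psi>[of n]] by (simp add: set_lebesgue_integral_def)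
    qed
    then show ?thesis using lim unfolding eq by (simp add: LIMSEQ_const_iff)
  qed
  have ae: "AE x in lborel. x \<in> {c<..<d} \<longrightarrow> f x = 0" if "a < c" "c < d" "d < b" for c d
  proof -
    have "set_integrable lborel {c<..<d} f"
      using that
      by (intro set_integrable_subset[of lborel "{c..d}" f "{c<..<d}"] locally_integrableD[OF f]) auto
    then have "AE x in lborel. indicator {c<..<d} x *\<^sub>R f x = 0"
    proof (intro AE_zero_if_interval_integrals_zero)
      show "(LINT x|lborel. indicator {c<..<d} x *\<^sub>R f x) = 0"
        using sub[OF that] by (simp add: set_lebesgue_integral_def)
      fix x y :: real assume "x < y"
      \<comment> \<open>The intersection of two open intervals is an open interval, still strictly
        inside \<open>{a<..<b}\<close>, so \<open>sub\<close> covers it.\<close>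
      have "(LBINT t:{x<..<y}. indicator {c<..<d} t *\<^sub>R f t) = (LBINT t:{max c x<..<min d y}. f t)"
        unfolding set_lebesgue_integral_def
        by (rule Bochner_Integration.integral_cong) (auto simp: indicator_def)
      also have "\<dots> = 0"
      proof (cases "max c x < min d y")
        case True
        then show ?thesis using that by (intro sub) auto
      qed (auto simp: set_lebesgue_integral_def)
      finally show "(LBINT t:{x<..<y}. indicator {c<..<d} t *\<^sub>R f t) = 0" .
    qed (simp add: set_integrable_def)
    then show ?thesis by eventually_elim (auto simp: indicator_def split: if_splits)
  qed
  show ?thesis
  proof (cases "a < b")
    case True
    \<comment> \<open>Countably many inner intervals exhaust \<open>{a<..<b}\<close>; the offset 3
      keeps the margins below half the length already for \<open>n = 0\<close>.\<close>
    define l where "l n = (b - a) / real (n + 3)" for n :: nat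
    have l: "l n > 0" "a + l n < b - l n" for n
    proof -
      have "(b - a) * 2 < (b - a) * real (n + 3)" using True by (intro mult_strict_left_mono) auto
      then have "2 * l n < b - a" by (simp add: l_def pos_divide_less_eq)
      then show "l n > 0" "a + l n < b - l n" using True by (auto simp: l_def)
    qed
    have "AE x in lborel. x \<in> {a + l n<..<b - l n} \<longrightarrow> f x = 0" for n
      by (rule ae) (use l[of n] in auto)
    then have "AE x in lborel. \<forall>n. x \<in> {a + l n<..<b - l n} \<longrightarrow> f x = 0"
      by (intro AE_all_countable[THEN iffD2] allI)
    then show ?thesis unfolding AE_lborel_on
    proof eventually_elim
      case (elim x)
      show ?case
      proof
        assume x: "x \<in> {a<..<b}"
        have "l \<longlonglongrightarrow> 0"
          using LIMSEQ_ignore_initial_segment[OF lim_const_over_n[of "b - a"], of 3] by (simp add: l_def[abs_def])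
        then have "\<forall>\<^sub>F n in sequentially. l n < min (x - a) (b - x)"
          by (rule order_tendstoD) (use x in auto)
        then obtain n where "l n < min (x - a) (b - x)" by (auto dest: eventually_happens)
        then show "f x = 0" using elim by (auto simp: algebra_simps)
      qed
    qed
  next
    case False
    then show ?thesis by (simp add: AE_lborel_on)
  qed
qed

lemma locally_integrable_diff:
  "locally_integrable a b f \<Longrightarrow> locally_integrable a b g \<Longrightarrow> locally_integrable a b (\<lambda>x. f x - g x)"
  by (auto simp: locally_integrable_def)

lemma has_weak_deriv_diff:
  assumes "has_weak_deriv a b f f'" "has_weak_deriv a b g g'"
  shows "has_weak_deriv a b (\<lambda>x. f x - g x) (\<lambda>x. f' x - g' x)"
  using assms
  by (simp add: has_weak_deriv_def locally_integrable_diff left_diff_distrib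
      locally_integrable_times_test_function test_function_deriv)

lemma weak_deriv_zero_AE:
  assumes "has_weak_deriv a b f g" "AE x in lborel_on a b. f x = 0"
  shows "AE x in lborel_on a b. g x = 0"
proof (rule fundamental_lemma_calculus_of_variations)
  fix \<phi> assume \<phi>: "test_function a b \<phi>"
  have "(LBINT x:{a<..<b}. f x * complex_of_real (deriv \<phi> x)) = 0"
    unfolding set_lebesgue_integral_def
    by (rule integral_eq_zero_AE) (use assms(2) in \<open>auto simp: AE_lborel_on indicator_def\<close>)
  then show "(LBINT x:{a<..<b}. g x * complex_of_real (\<phi> x)) = 0"
    using assms(1) \<phi> by (simp add: has_weak_deriv_def)
qed (use assms in \<open>auto simp: has_weak_deriv_def\<close>)

text \<open>Reconciles the weak derivatives that witness membership in the domain with those that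
  define the image.\<close>

lemma weak_deriv_unique:
  assumes "has_weak_deriv a b f g" "has_weak_deriv a b f' g'" "AE x in lborel_on a b. f x = f' x"
  shows "AE x in lborel_on a b. g x = g' x"
  using weak_deriv_zero_AE[OF has_weak_deriv_diff[OF assms(1,2)]] assms(3) by simp

text \<open>Every test function differs from a multiple of a fixed bump by the derivative of a
  test function.\<close>

theorem weak_deriv_zero_imp_constant:
  assumes ab: "a < b" and f: "has_weak_deriv a b f (\<lambda>x. 0)"
  obtains c where "AE x in lborel_on a b. f x = c"
proof -
  have loc: "locally_integrable a b f" using f by (simp add: has_weak_deriv_def)
  define c where "c = a + (b - a) / 3"
  define d where "d = b - (b - a) / 3"
  have cd: "a < c" "c < d" "d < b" using ab by (auto simp: c_def d_def field_simps)
  define \<eta> where "\<eta> = bump c d 1"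
  have \<eta>: "test_function a b \<eta>"
    unfolding \<eta>_def using cd by (intro test_function_bump) auto
  define I where "I = (LINT x|lborel. \<eta> x)"
  have "I \<noteq> 0"
  proof
    assume "I = 0"
    moreover have "AE x in lborel. 0 \<le> \<eta> x" by (simp add: \<eta>_def bump_nonneg)
    ultimately have "AE x in lborel. \<eta> x = 0"
      using integral_nonneg_eq_0_iff_AE[OF test_function_integrable[OF \<eta>]] by (simp add: I_def)
    then have "AE x in lborel. x \<notin> {c<..<d}"
    proof eventually_elim
      case (elim x)
      then show ?case using bump_pos[of x c d 1] by (auto simp: \<eta>_def)
    qed
    then have "{c<..<d} \<in> null_sets lborel" by (subst AE_iff_null_sets) auto
    then have "emeasure lborel {c<..<d} = 0" by (rule null_setsD1)
    then show False using cd by simp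
  qed
  \<comment> \<open>Testing a constant function against \<open>\<eta>\<close> gives the constant
    times \<open>I\<close>, so this is the only possible value.\<close>
  define C where "C = (LBINT x:{a<..<b}. f x * complex_of_real (\<eta> x)) / of_real I"
  have int: "set_integrable lborel {a<..<b} (\<lambda>x. f x * complex_of_real (\<psi> x))" if "test_function a b \<psi>" for \<psi>
    by (rule locally_integrable_times_test_function[OF loc that])
  have const: "locally_integrable a b (\<lambda>x. C)"
    unfolding locally_integrable_def
    by (auto simp: set_integrable_def intro!: borel_integrable_compact)
  have "AE x in lborel_on a b. f x - C = 0"
  proof (rule fundamental_lemma_calculus_of_variations[OF locally_integrable_diff[OF loc const]])
    fix \<psi> assume \<psi>: "test_function a b \<psi>"
    define J where "J = (LINT x|lborel. \<psi> x)"
    have \<zeta>: "test_function a b (\<lambda>x. \<psi> x - J / I * \<eta> x)"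
      by (rule test_function_diff_scale[OF \<psi> \<eta>])
    \<comment> \<open>The multiple \<open>J / I\<close> is chosen to cancel the integral, which
      makes the difference the derivative of a test function.\<close>
    have "(LINT x|lborel. \<psi> x - J / I * \<eta> x) = 0"
      using \<open>I \<noteq> 0\<close> test_function_integrable[OF \<psi>] test_function_integrable[OF \<eta>]
      by (simp add: J_def[symmetric] I_def[symmetric])
    then obtain \<phi> where "test_function a b \<phi>" "deriv \<phi> = (\<lambda>x. \<psi> x - J / I * \<eta> x)"
      using test_function_antiderivative[OF \<zeta>] by blast
    then have "(LBINT x:{a<..<b}. f x * complex_of_real (\<psi> x - J / I * \<eta> x)) = 0"
      using f by (auto simp: has_weak_deriv_def)
    also have "(LBINT x:{a<..<b}. f x * complex_of_real (\<psi> x - J / I * \<eta> x))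
        = (LBINT x:{a<..<b}. f x * complex_of_real (\<psi> x) - of_real (J / I) * (f x * complex_of_real (\<eta> x)))"
      by (simp add: algebra_simps)
    also have "\<dots> = (LBINT x:{a<..<b}. f x * complex_of_real (\<psi> x)) - of_real (J / I) * (C * of_real I)"
      using int[OF \<psi>] int[OF \<eta>] \<open>I \<noteq> 0\<close> by (subst set_integral_diff) (auto simp: C_def)
    finally have 1: "(LBINT x:{a<..<b}. f x * complex_of_real (\<psi> x)) = of_real J * C"
      using \<open>I \<noteq> 0\<close> by simp
    have "(LBINT x:{a<..<b}. \<psi> x) = J"
      unfolding J_def set_lebesgue_integral_def
      by (rule Bochner_Integration.integral_cong)
         (use test_function_endpoints[OF \<psi>] in \<open>auto simp: indicator_def of_bool_def\<close>)
    then have 2: "(LBINT x:{a<..<b}. C * complex_of_real (\<psi> x)) = C * of_real J"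
      by (simp add: set_integral_complex_of_real)
    show "(LBINT x:{a<..<b}. (f x - C) * complex_of_real (\<psi> x)) = 0"
      unfolding left_diff_distrib
      using set_integral_diff(2)[OF int[OF \<psi>] locally_integrable_times_test_function[OF const \<psi>]] 1 2
      by (simp only: mult.commute diff_self)
  qed
  then show ?thesis using that[of C] by simp
qed

section \<open>Indefinite integrals\<close>

text \<open>To the left of \<open>a\<close> the interval is empty and the value is 0, unlike an
  oriented integral.\<close>

definition primitive :: "real \<Rightarrow> (real \<Rightarrow> complex) \<Rightarrow> real \<Rightarrow> complex" where
  "primitive a f x = (LBINT t:{a<..<x}. f t)"

lemma primitive_start [simp]: "primitive a f a = 0"
  by (simp add: primitive_def set_lebesgue_integral_def)

text \<open>Passes to the gauge integral, whose continuity and additivity over adjacent intervals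
  are used below.\<close>

lemma primitive_eq_integral:
  assumes f: "set_integrable lborel {a<..<b} f" and x: "x \<in> {a..b}"
  shows "primitive a f x = integral {a..x} f" "f integrable_on {a..x}"
proof -
  have f: "set_integrable lborel {a<..<x} f"
    using f by (rule set_integrable_subset) (use x in auto)
  note I = set_borel_integral_eq_integral[OF f]
  show "f integrable_on {a..x}"
    using I(1) integrable_on_Icc_iff_Ioo by blast
  show "primitive a f x = integral {a..x} f"
    using I(2) by (simp add: primitive_def integral_open_interval_real)
qed

lemma primitive_continuous:
  assumes f: "set_integrable lborel {a<..<b} f"
  shows "continuous_on {a..b} (primitive a f)"
proof (cases "a \<le> b")
  case True
  have "continuous_on {a..b} (\<lambda>x. integral {a..x} f)"
    by (rule indefinite_integral_continuous_1) (use primitive_eq_integral(2)[OF f, of b] True in auto)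
  then show ?thesis
    by (rule continuous_on_cong[THEN iffD1, OF refl, rotated]) (simp add: primitive_eq_integral[OF f])
qed simp

text \<open>The product of the two total integrals is the integral of \<open>f x * g t\<close> over
  the square. The two triangles \<open>t < x\<close> and \<open>x < t\<close> contribute the two
  integrals on the left, so no differentiability enters.\<close>

lemma primitive_by_parts:
  assumes f: "set_integrable lborel {a<..<b} f" and g: "set_integrable lborel {a<..<b} g"
  shows "set_integrable lborel {a<..<b} (\<lambda>x. f x * primitive a g x)" (is ?I1)
    "set_integrable lborel {a<..<b} (\<lambda>x. primitive a f x * g x)" (is ?I2)
    "(LBINT x:{a<..<b}. f x * primitive a g x) + (LBINT x:{a<..<b}. primitive a f x * g x)
      = primitive a f b * primitive a g b" (is ?E)
proof -
  define F where "F = (\<lambda>x. indicator {a<..<b} x *\<^sub>R f x)"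
  define G where "G = (\<lambda>x. indicator {a<..<b} x *\<^sub>R g x)"
  have F: "integrable lborel F" and G: "integrable lborel G"
    using f g by (simp_all add: F_def G_def set_integrable_def)
  have [measurable]: "F \<in> borel_measurable borel" "G \<in> borel_measurable borel"
    using F G by (auto dest: borel_measurable_integrable)
  have FG: "integrable (lborel \<Otimes>\<^sub>M lborel) (\<lambda>(x, t). F x * G t)"
  proof (rule lborel_pair.Fubini_integrable)
    show "integrable lborel (\<lambda>x. LINT t|lborel. norm (case (x, t) of (x, t) \<Rightarrow> F x * G t))"
      using F G by (simp add: norm_mult)
    show "AE x in lborel. integrable lborel (\<lambda>t. case (x, t) of (x, t) \<Rightarrow> F x * G t)"
      using G by simp
  qed measurable
  define T1 where "T1 = {z :: real \<times> real. snd z < fst z}"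
  define T2 where "T2 = {z :: real \<times> real. fst z < snd z}"
  have T [measurable]: "T1 \<in> sets (lborel \<Otimes>\<^sub>M lborel)" "T2 \<in> sets (lborel \<Otimes>\<^sub>M lborel)"
  proof -
    have "open {z :: real \<times> real. snd z < fst z}" "open {z :: real \<times> real. fst z < snd z}"
      by (intro open_Collect_less continuous_intros)+
    then show "T1 \<in> sets (lborel \<Otimes>\<^sub>M lborel)" "T2 \<in> sets (lborel \<Otimes>\<^sub>M lborel)"
      by (simp_all only: lborel_prod sets_lborel T1_def T2_def borel_open)
  qed
  have 1: "integrable (lborel \<Otimes>\<^sub>M lborel) (\<lambda>(x, t). indicator T1 (x, t) *\<^sub>R (F x * G t))"
    using integrable_mult_indicator[OF T(1) FG] by (simp add: case_prod_beta')
  have 2: "integrable (lborel \<Otimes>\<^sub>M lborel) (\<lambda>(x, t). indicator T2 (x, t) *\<^sub>R (F x * G t))"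
    using integrable_mult_indicator[OF T(2) FG] by (simp add: case_prod_beta')
  have eq1: "(LINT t|lborel. indicator T1 (x, t) *\<^sub>R (F x * G t))
      = indicator {a<..<b} x *\<^sub>R (f x * primitive a g x)" for x
  proof -
    have "indicator T1 (x, t) *\<^sub>R (F x * G t)
        = F x * (indicator {a<..<x} t *\<^sub>R g t)" for t
      by (auto simp: T1_def F_def G_def indicator_def)
    then have "(LINT t|lborel. indicator T1 (x, t) *\<^sub>R (F x * G t)) = F x * primitive a g x"
      by (simp only: integral_mult_right_zero primitive_def set_lebesgue_integral_def)
    then show ?thesis by (simp add: F_def)
  qed
  have eq2: "(LINT x|lborel. indicator T2 (x, t) *\<^sub>R (F x * G t))
      = indicator {a<..<b} t *\<^sub>R (primitive a f t * g t)" for t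
  proof -
    have "indicator T2 (x, t) *\<^sub>R (F x * G t)
        = (indicator {a<..<t} x *\<^sub>R f x) * G t" for x
      by (auto simp: T2_def F_def G_def indicator_def)
    then have "(LINT x|lborel. indicator T2 (x, t) *\<^sub>R (F x * G t)) = primitive a f t * G t"
      by (simp only: integral_mult_left_zero primitive_def set_lebesgue_integral_def)
    then show ?thesis by (simp add: G_def)
  qed
  show ?I1
    using lborel_pair.integrable_fst[OF 1] by (simp add: eq1 set_integrable_def)
  show ?I2
    using lborel_pair.integrable_snd[OF 2] by (simp add: eq2 set_integrable_def)
  have "(LBINT x:{a<..<b}. f x * primitive a g x) + (LBINT x:{a<..<b}. primitive a f x * g x)
    = (LINT x|lborel. LINT t|lborel. indicator T1 (x, t) *\<^sub>R (F x * G t))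
      + (LINT t|lborel. LINT x|lborel. indicator T2 (x, t) *\<^sub>R (F x * G t))"
    by (simp add: eq1 eq2 set_lebesgue_integral_def)
  also have "\<dots> = integral\<^sup>L (lborel \<Otimes>\<^sub>M lborel) (\<lambda>(x, t). indicator T1 (x, t) *\<^sub>R (F x * G t))
      + integral\<^sup>L (lborel \<Otimes>\<^sub>M lborel) (\<lambda>(x, t). indicator T2 (x, t) *\<^sub>R (F x * G t))"
    by (simp only: lborel_pair.integral_fst[OF 1] lborel_pair.integral_snd[OF 2])
  also have "\<dots> = integral\<^sup>L (lborel \<Otimes>\<^sub>M lborel) (\<lambda>z. (case z of (x, t) \<Rightarrow> indicator T1 (x, t) *\<^sub>R (F x * G t))
      + (case z of (x, t) \<Rightarrow> indicator T2 (x, t) *\<^sub>R (F x * G t)))"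
    by (rule Bochner_Integration.integral_add[OF 1 2, symmetric])
  also have "\<dots> = (LINT x|lborel. LINT t|lborel. indicator T1 (x, t) *\<^sub>R (F x * G t)
      + indicator T2 (x, t) *\<^sub>R (F x * G t))"
    using lborel_pair.integral_fst[of "\<lambda>x t. indicator T1 (x, t) *\<^sub>R (F x * G t) + indicator T2 (x, t) *\<^sub>R (F x * G t)"]
      Bochner_Integration.integrable_add[OF 1 2]
    by (simp add: case_prod_beta')
  also have "\<dots> = (LINT x|lborel. LINT t|lborel. F x * G t)"
  proof (rule Bochner_Integration.integral_cong[OF refl])
    fix x
    show "(LINT t|lborel. indicator T1 (x, t) *\<^sub>R (F x * G t) + indicator T2 (x, t) *\<^sub>R (F x * G t))
        = (LINT t|lborel. F x * G t)"
    proof (rule Bochner_Integration.integral_cong_AE)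
      \<comment> \<open>The two triangles miss only the diagonal, a single point
        \<open>t = x\<close> for each \<open>x\<close>.\<close>
      show "AE t in lborel. indicator T1 (x, t) *\<^sub>R (F x * G t) + indicator T2 (x, t) *\<^sub>R (F x * G t) = F x * G t"
        using AE_lborel_singleton[of x]
        by eventually_elim (auto simp: T1_def T2_def indicator_def)
    qed measurable
  qed
  also have "\<dots> = (LINT x|lborel. F x) * (LINT t|lborel. G t)"
    by (simp only: integral_mult_right_zero integral_mult_left_zero)
  finally show ?E by (simp only: F_def G_def primitive_def set_lebesgue_integral_def)
qed

lemma continuous_locally_integrable:
  assumes "continuous_on {a..b} f" shows "locally_integrable a b f"
  unfolding locally_integrable_def set_integrable_def
proof (intro allI impI borel_integrable_compact; elim conjE)
  fix K assume "K \<subseteq> {a<..<b}"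
  then have "K \<subseteq> {a..b}" by (rule order_trans) auto
  then show "continuous_on K f" by (rule continuous_on_subset[OF assms])
qed

text \<open>Since \<open>\<phi> a = 0\<close>, a test function is the primitive of its derivative,
  the form in which \<open>primitive_by_parts\<close> applies to it.\<close>

lemma test_function_primitive:
  assumes \<phi>: "test_function a b \<phi>" and x: "a \<le> x"
  shows "complex_of_real (\<phi> x) = primitive a (\<lambda>t. complex_of_real (deriv \<phi> t)) x"
proof -
  have cont: "continuous_on {a..x} (\<lambda>t. complex_of_real (deriv \<phi> t))"
    by (intro continuous_intros test_function_continuous[OF test_function_deriv[OF \<phi>]])
  have "integral\<^sup>L lborel (\<lambda>t. indicator {a..x} t *\<^sub>R complex_of_real (deriv \<phi> t))
      = complex_of_real (\<phi> x) - complex_of_real (\<phi> a)"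
  proof (rule integral_FTC_atLeastAtMost[OF x _ cont])
    fix t
    have "(\<phi> has_vector_derivative deriv \<phi> t) (at t within {a..x})"
      using test_function_has_deriv[OF \<phi>, of t]
      by (simp add: has_real_derivative_iff_has_vector_derivative has_vector_derivative_at_within)
    then show "((\<lambda>t. complex_of_real (\<phi> t)) has_vector_derivative complex_of_real (deriv \<phi> t)) (at t within {a..x})"
      by (rule bounded_linear.has_vector_derivative[OF bounded_linear_of_real])
  qed
  also have "integral\<^sup>L lborel (\<lambda>t. indicator {a..x} t *\<^sub>R complex_of_real (deriv \<phi> t))
      = integral\<^sup>L lborel (\<lambda>t. indicator {a<..<x} t *\<^sub>R complex_of_real (deriv \<phi> t))"
  proof (rule Bochner_Integration.integral_cong_AE)
    have [measurable]: "deriv \<phi> \<in> borel_measurable borel"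
      by (intro borel_measurable_continuous_onI test_function_continuous[OF test_function_deriv[OF \<phi>]])
    show "(\<lambda>t. indicator {a..x} t *\<^sub>R complex_of_real (deriv \<phi> t)) \<in> borel_measurable lborel"
      "(\<lambda>t. indicator {a<..<x} t *\<^sub>R complex_of_real (deriv \<phi> t)) \<in> borel_measurable lborel"
      by measurable
    show "AE t in lborel. indicator {a..x} t *\<^sub>R complex_of_real (deriv \<phi> t)
        = indicator {a<..<x} t *\<^sub>R complex_of_real (deriv \<phi> t)"
      using AE_lborel_singleton[of a] AE_lborel_singleton[of x]
      by eventually_elim (auto simp: indicator_def)
  qed
  finally show ?thesis
    using test_function_endpoints[OF \<phi>, of a] by (simp add: primitive_def set_lebesgue_integral_def)
qed

text \<open>Integration by parts against a derivative whose primitive vanishes at \<open>b\<close>: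
  this removes the boundary term and the contribution of the constant \<open>C\<close>
  alike.\<close>

lemma has_weak_deriv_primitive:
  assumes ab: "a < b" and f: "set_integrable lborel {a<..<b} f"
  shows "has_weak_deriv a b (\<lambda>x. C + primitive a f x) f"
  unfolding has_weak_deriv_def
proof (intro conjI allI impI)
  show "locally_integrable a b (\<lambda>x. C + primitive a f x)"
    by (intro continuous_locally_integrable continuous_intros primitive_continuous f)
  show "locally_integrable a b f"
    unfolding locally_integrable_def
  proof (intro allI impI, elim conjE)
    fix K assume "compact K" "K \<subseteq> {a<..<b}"
    then show "set_integrable lborel K f"
      by (intro set_integrable_subset[OF f]) (auto dest: compact_imp_closed)
  qed
  fix \<phi> assume \<phi>: "test_function a b \<phi>"
  define d where "d = (\<lambda>t. complex_of_real (deriv \<phi> t))"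
  have d: "set_integrable lborel {a<..<b} d"
    unfolding d_def set_integrable_def
    by (intro integrable_mult_indicator integrable_of_real test_function_integrable[OF test_function_deriv[OF \<phi>]]) simp
  have prim: "primitive a d x = complex_of_real (\<phi> x)" if "a \<le> x" for x
    using test_function_primitive[OF \<phi> that] by (simp add: d_def)
  have end0: "primitive a d b = 0"
    using prim[of b] test_function_endpoints[OF \<phi>, of b] ab by simp
  have "(LBINT x:{a<..<b}. (C + primitive a f x) * d x)
      = (LBINT x:{a<..<b}. C * d x + primitive a f x * d x)"
    by (simp add: algebra_simps)
  also have "\<dots> = (LBINT x:{a<..<b}. C * d x) + (LBINT x:{a<..<b}. primitive a f x * d x)"
    using d primitive_by_parts(2)[OF f d] by (intro set_integral_add) auto
  also have "(LBINT x:{a<..<b}. C * d x) = 0" using end0 by (simp add: primitive_def)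
  also have "(LBINT x:{a<..<b}. primitive a f x * d x) = - (LBINT x:{a<..<b}. f x * primitive a d x)"
    using primitive_by_parts(3)[OF f d] end0 by (simp add: eq_neg_iff_add_eq_0 add.commute)
  also have "(LBINT x:{a<..<b}. f x * primitive a d x) = (LBINT x:{a<..<b}. f x * complex_of_real (\<phi> x))"
    by (rule set_lebesgue_integral_cong) (auto simp: prim)
  finally show "(LBINT x:{a<..<b}. (C + primitive a f x) * complex_of_real (deriv \<phi> x))
      = - (LBINT x:{a<..<b}. f x * complex_of_real (\<phi> x))"
    by (simp add: d_def)
qed

lemma has_weak_deriv_cong_AE:
  assumes wd: "has_weak_deriv a b f g"
    and f': "f' \<in> borel_measurable (lborel_on a b)" "AE x in lborel_on a b. f' x = f x"
    and g': "g' \<in> borel_measurable (lborel_on a b)" "AE x in lborel_on a b. g' x = g x"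
  shows "has_weak_deriv a b f' g'"
proof -
  have K: "set_integrable lborel K h'"
    if "set_integrable lborel K h" "compact K" "K \<subseteq> {a<..<b}" "h' \<in> borel_measurable (lborel_on a b)" "AE x in lborel_on a b. h' x = h x"
    for h h' :: "real \<Rightarrow> complex" and K
    unfolding set_integrable_def
  proof (rule Bochner_Integration.integrable_cong_AE_imp)
    show "integrable lborel (\<lambda>x. indicator K x *\<^sub>R h x)" using that(1) by (simp add: set_integrable_def)
    have "set_borel_measurable lborel {a<..<b} h'"
      using that(4) by (simp add: set_borel_measurable_def borel_measurable_restrict_space_iff)
    then have "set_borel_measurable lborel K h'"
      by (rule set_borel_measurable_subset) (use that in \<open>auto dest: compact_imp_closed\<close>)
    then show "(\<lambda>x. indicator K x *\<^sub>R h' x) \<in> borel_measurable lborel" by (simp add: set_borel_measurable_def)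
    show "AE x in lborel. indicator K x *\<^sub>R h x = indicator K x *\<^sub>R h' x"
      using that(5) unfolding AE_lborel_on by eventually_elim (use that(3) in \<open>auto simp: indicator_def\<close>)
  qed
  have loc: "locally_integrable a b f'" "locally_integrable a b g'"
    using K[OF _ _ _ f'] K[OF _ _ _ g'] wd
    unfolding has_weak_deriv_def locally_integrable_def by blast+
  have int: "(LBINT x:{a<..<b}. h' x * complex_of_real (\<psi> x)) = (LBINT x:{a<..<b}. h x * complex_of_real (\<psi> x))"
    if "locally_integrable a b h" "locally_integrable a b h'" "AE x in lborel_on a b. h' x = h x" "test_function a b \<psi>"
    for h h' \<psi>
    unfolding set_lebesgue_integral_def
  proof (rule Bochner_Integration.integral_cong_AE)
    show "AE x in lborel. indicator {a<..<b} x *\<^sub>R (h' x * complex_of_real (\<psi> x))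
        = indicator {a<..<b} x *\<^sub>R (h x * complex_of_real (\<psi> x))"
      using that(3) unfolding AE_lborel_on by eventually_elim (auto simp: indicator_def)
  qed (use that(1,2)[THEN locally_integrable_times_test_function[OF _ that(4)]] in
      \<open>auto simp: set_integrable_def dest: borel_measurable_integrable\<close>)
  show ?thesis
    using wd loc int[OF _ loc(1) f'(2) test_function_deriv] int[OF _ loc(2) g'(2)]
    by (simp add: has_weak_deriv_def)
qed

text \<open>The points of the open interval where \<open>f\<close> is nonzero form an open null set,
  hence none exist; continuity then reaches the endpoints, where the boundary values are read
  off.\<close>

lemma continuous_AE_zero_imp_zero:
  fixes f :: "real \<Rightarrow> complex"
  assumes "a < b" and f: "continuous_on {a..b} f" and ae: "AE x in lborel_on a b. f x = 0" and x: "x \<in> {a..b}"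
  shows "f x = 0"
proof -
  define N where "N = {a<..<b} \<inter> f -` (- {0})"
  have "open N"
    unfolding N_def
    by (intro continuous_open_preimage continuous_on_subset[OF f]) auto
  moreover have "negligible N"
  proof -
    have "AE x in lborel. x \<notin> N"
      using ae unfolding AE_lborel_on N_def by eventually_elim auto
    then have "N \<in> null_sets lborel" using \<open>open N\<close> by (subst AE_iff_null_sets) auto
    then show ?thesis by (simp add: negligible_iff_null_sets null_sets_completionI)
  qed
  ultimately have "N = {}" using open_not_negligible by blast
  then have "f y = 0" if "y \<in> {a<..<b}" for y using that by (auto simp: N_def)
  then show ?thesis
    using continuous_constant_on_closure[of "{a<..<b}" f 0 x] f x \<open>a < b\<close> by simp
qed

lemma has_weak_deriv_zero_if_AE_zero:
  assumes "has_weak_deriv a b f g" "AE x in lborel_on a b. g x = 0"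
  shows "has_weak_deriv a b f (\<lambda>x. 0)"
proof -
  have "(LBINT x:{a<..<b}. g x * complex_of_real (\<phi> x)) = 0" for \<phi>
    unfolding set_lebesgue_integral_def
    by (rule integral_eq_zero_AE) (use assms(2) in \<open>auto simp: AE_lborel_on indicator_def\<close>)
  then show ?thesis
    using assms(1) by (auto simp: has_weak_deriv_def intro!: continuous_locally_integrable)
qed

lemma L2_bounded_mult:
  assumes h: "h \<in> L2 M" and c: "c \<in> borel_measurable M" and le: "\<And>x. x \<in> space M \<Longrightarrow> cmod (c x) \<le> B"
  shows "(\<lambda>x. c x * h x) \<in> L2 M"
proof (rule L2I)
  note [measurable] = c L2_measurable[OF h]
  show "(\<lambda>x. c x * h x) \<in> borel_measurable M" by measurable
  have "integrable M (\<lambda>x. B\<^sup>2 * (cmod (h x))\<^sup>2)" using L2_integrable[OF h] by simp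
  then show "integrable M (\<lambda>x. (cmod (c x * h x))\<^sup>2)"
  proof (rule Bochner_Integration.integrable_bound)
    have "norm ((cmod (c x * h x))\<^sup>2) \<le> norm (B\<^sup>2 * (cmod (h x))\<^sup>2)" if "x \<in> space M" for x
      using power_mono[OF le[OF that], of 2] by (simp add: norm_mult power_mult_distrib mult_right_mono)
    then show "AE x in M. norm ((cmod (c x * h x))\<^sup>2) \<le> norm (B\<^sup>2 * (cmod (h x))\<^sup>2)" by simp
  qed measurable
qed

text \<open>Normalized indicators of disjoint sets of positive measure.\<close>

lemma exists_orthonormal_sequence:
  assumes fin: "finite_measure M" and A: "\<And>n :: nat. A n \<in> sets M" "\<And>n. measure M (A n) > 0"
    and disj: "disjoint_family A"
  shows "\<exists>\<omega>. L2_orthonormal M \<omega>"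
proof
  interpret finite_measure M by fact
  define \<omega> where "\<omega> n x = complex_of_real (indicator (A n) x / sqrt (measure M (A n)))" for n x
  note [measurable] = A(1)
  have "\<omega> n \<in> L2 M" for n
  proof (rule L2_norm_le_bound(1)[OF fin])
    show "\<omega> n \<in> borel_measurable M" unfolding \<omega>_def by measurable
    show "cmod (\<omega> n x) \<le> 1 / sqrt (measure M (A n))" for x
      unfolding \<omega>_def norm_of_real by (simp add: indicator_def)
  qed simp
  moreover have "L2_inner M (\<omega> m) (\<omega> n) = (if m = n then 1 else 0)" for m n
  proof (cases "m = n")
    case True
    have "\<omega> n x * cnj (\<omega> n x) = complex_of_real (indicator (A n) x / measure M (A n))" for x
      using A(2)[of n] by (simp add: \<omega>_def indicator_def flip: of_real_mult)
    then have "L2_inner M (\<omega> n) (\<omega> n) = complex_of_real (LINT x|M. indicator (A n) x / measure M (A n))"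
      by (simp only: L2_inner_def integral_complex_of_real)
    also have "(LINT x|M. indicator (A n) x / measure M (A n)) = 1"
      using A(2)[of n] sets.sets_into_space[OF A(1)[of n]] by (simp add: Int_absorb2)
    finally show ?thesis using True by simp
  next
    case False
    have "\<omega> m x * cnj (\<omega> n x) = 0" for x
      using disj False by (auto simp: \<omega>_def indicator_def disjoint_family_on_def)
    then show ?thesis using False by (simp only: L2_inner_def) simp
  qed
  ultimately show "L2_orthonormal M \<omega>" by (simp add: L2_orthonormal_def)
qed

section \<open>The Sturm--Liouville problem with Dirichlet boundary conditions\<close>

text \<open>Here \<open>q = 1 / p\<close>. A solution of \<open>- (p R')' = w h\<close> has the flux \<open>p R' = c - \<integral> w h\<close>,
  and \<open>c\<close> is determined by \<open>R(b) = 0\<close>.\<close>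

locale sturm_liouville =
  fixes a b :: real and w q :: "real \<Rightarrow> real"
  assumes ab: "a < b"
    and cont_w: "continuous_on {a..b} w" and cont_q: "continuous_on {a..b} q"
    and w_pos: "\<And>x. x \<in> {a..b} \<Longrightarrow> w x > 0" and q_pos: "\<And>x. x \<in> {a..b} \<Longrightarrow> q x > 0"
begin

definition M :: "real measure" where
  "M = density (lborel_on a b) (\<lambda>x. ennreal (w x))"

definition weighted :: "(real \<Rightarrow> complex) \<Rightarrow> real \<Rightarrow> complex" where
  "weighted h x = complex_of_real (w x) * h x"

text \<open>The mean of the primitive of \<open>w h\<close> with respect to the density
  \<open>q\<close>: precisely the constant for which the slope has integral 0.\<close>

definition flux_const :: "(real \<Rightarrow> complex) \<Rightarrow> complex" where
  "flux_const h = (LBINT t:{a<..<b}. complex_of_real (q t) * primitive a (weighted h) t)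
    / complex_of_real (LBINT t:{a<..<b}. q t)"

definition flux :: "(real \<Rightarrow> complex) \<Rightarrow> real \<Rightarrow> complex" where
  "flux h x = flux_const h - primitive a (weighted h) x"

definition slope :: "(real \<Rightarrow> complex) \<Rightarrow> real \<Rightarrow> complex" where
  "slope h x = complex_of_real (q x) * flux h x"

text \<open>Outside the closed interval nothing is known about \<open>h\<close> or \<open>w\<close>;
  the value 0 there makes additivity of \<open>K\<close> hold as an equation between
  functions.\<close>

definition K :: "(real \<Rightarrow> complex) \<Rightarrow> real \<Rightarrow> complex" where
  "K h x = (if x \<in> {a..b} then primitive a (slope h) x else 0)"

lemma space_M [simp]: "space M = {a<..<b}" by (simp add: M_def)

lemma borel_measurable_M: "borel_measurable M = borel_measurable (lborel_on a b)"
  by (auto simp: M_def)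

lemma continuous_measurable:
  fixes f :: "real \<Rightarrow> 'b :: topological_space"
  shows "continuous_on {a..b} f \<Longrightarrow> f \<in> borel_measurable (lborel_on a b)"
  unfolding lborel_on_simps
  by (rule borel_measurable_continuous_on_restrict, erule continuous_on_subset) auto

lemma continuous_bounded:
  fixes f :: "real \<Rightarrow> 'b :: real_normed_vector"
  assumes "continuous_on {a..b} f"
  obtains B where "\<And>x. x \<in> {a..b} \<Longrightarrow> norm (f x) \<le> B" "B \<ge> 0"
proof -
  have "bounded (f ` {a..b})" by (intro compact_imp_bounded compact_continuous_image assms) simp
  then obtain B where B: "\<forall>x\<in>{a..b}. norm (f x) \<le> B" unfolding bounded_iff by blast
  then have "norm (f x) \<le> B" if "x \<in> {a..b}" for x using that by blast
  moreover from this[of a] have "B \<ge> 0" using ab order_trans[OF norm_ge_zero] by simp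
  ultimately show ?thesis by (rule that)
qed

lemma continuous_set_integrable:
  fixes f :: "real \<Rightarrow> 'b :: {banach, second_countable_topology}"
  assumes "continuous_on {a..b} f"
  shows "set_integrable lborel {a<..<b} f"
proof (rule set_integrable_subset)
  show "set_integrable lborel {a..b} f"
    unfolding set_integrable_def by (rule borel_integrable_compact) (use assms in auto)
qed auto

section \<open>The weighted measure compared with Lebesgue measure\<close>

lemma w_measurable: "w \<in> borel_measurable (lborel_on a b)"
  by (rule continuous_measurable[OF cont_w])

lemma AE_M: "(AE x in M. P x) \<longleftrightarrow> (AE x in lborel_on a b. P x)"
proof -
  have "(AE x in M. P x) \<longleftrightarrow> (AE x in lborel_on a b. 0 < ennreal (w x) \<longrightarrow> P x)"
    unfolding M_def using w_measurable by (subst AE_density) auto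
  also have "\<dots> \<longleftrightarrow> (AE x in lborel_on a b. P x)"
    by (rule AE_cong) (use w_pos in auto)
  finally show ?thesis .
qed

lemma w_nonneg_AE: "AE x in lborel_on a b. 0 \<le> w x"
  by (rule AE_I2) (use w_pos in \<open>auto intro: less_imp_le\<close>)

lemma integrable_M:
  fixes f :: "real \<Rightarrow> 'b :: {banach, second_countable_topology}"
  assumes "f \<in> borel_measurable M"
  shows "integrable M f \<longleftrightarrow> set_integrable lborel {a<..<b} (\<lambda>x. w x *\<^sub>R f x)"
  using assms unfolding borel_measurable_M
  by (simp only: M_def integrable_density w_measurable w_nonneg_AE integrable_lborel_on)

lemma integral_M:
  fixes f :: "real \<Rightarrow> 'b :: {banach, second_countable_topology}"
  assumes "f \<in> borel_measurable M"
  shows "integral\<^sup>L M f = (LBINT x:{a<..<b}. w x *\<^sub>R f x)"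
  using assms unfolding borel_measurable_M
  by (simp only: M_def integral_density w_measurable w_nonneg_AE integral_lborel_on)

lemma finite_M: "finite_measure M"
proof
  have "integrable M (\<lambda>x. 1 :: real)"
    using continuous_set_integrable[OF cont_w] by (simp add: integrable_M)
  then show "emeasure M (space M) \<noteq> \<infinity>" unfolding integrable_iff_bounded by (simp add: less_top)
qed

lemma continuous_L2: "continuous_on {a..b} f \<Longrightarrow> f \<in> L2 M"
  using continuous_bounded[of f] L2_norm_le_bound(1)[OF finite_M, of f] continuous_measurable[of f]
  by (metis borel_measurable_M greaterThanLessThan_subseteq_atLeastAtMost_iff order_refl space_M subset_iff)

text \<open>The weight is bounded above and away from 0 by continuity on a compact interval. Sobolev
  functions live in the unweighted space and the operator in the weighted one; this identifies the
  two.\<close>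

lemma L2_M: "L2 M = L2 (lborel_on a b)"
proof -
  obtain W where W: "\<And>x. x \<in> {a..b} \<Longrightarrow> norm (w x) \<le> W" using continuous_bounded[OF cont_w] by blast
  have "continuous_on {a..b} (\<lambda>x. 1 / w x)"
    using w_pos by (intro continuous_intros cont_w) force
  from continuous_bounded[OF this] obtain V where V: "\<And>x. x \<in> {a..b} \<Longrightarrow> norm (1 / w x) \<le> V" by blast
  note [measurable] = w_measurable
  have "integrable M (\<lambda>x. (cmod (f x))\<^sup>2) \<longleftrightarrow> integrable (lborel_on a b) (\<lambda>x. (cmod (f x))\<^sup>2)"
    if f [measurable]: "f \<in> borel_measurable (lborel_on a b)" for f
  proof
    assume "integrable M (\<lambda>x. (cmod (f x))\<^sup>2)"
    then have "integrable (lborel_on a b) (\<lambda>x. V * (w x * (cmod (f x))\<^sup>2))"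
      unfolding M_def by (subst (asm) integrable_density) (auto simp: w_nonneg_AE w_measurable f)
    then show "integrable (lborel_on a b) (\<lambda>x. (cmod (f x))\<^sup>2)"
    proof (rule Bochner_Integration.integrable_bound)
      have "norm ((cmod (f x))\<^sup>2) \<le> norm (V * (w x * (cmod (f x))\<^sup>2))" if "x \<in> {a<..<b}" for x
      proof -
        have "w x > 0" "1 / w x \<le> V" using w_pos[of x] V[of x] that by auto
        then have "1 \<le> V * w x" by (simp add: pos_divide_le_eq)
        then have "1 * (cmod (f x))\<^sup>2 \<le> (V * w x) * (cmod (f x))\<^sup>2" by (intro mult_right_mono) auto
        then have "(cmod (f x))\<^sup>2 \<le> V * (w x * (cmod (f x))\<^sup>2)" by (simp add: mult.assoc)
        then have "(cmod (f x))\<^sup>2 \<le> \<bar>V * (w x * (cmod (f x))\<^sup>2)\<bar>" by (rule order_trans) simp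
        then show ?thesis by simp
      qed
      then show "AE x in lborel_on a b. norm ((cmod (f x))\<^sup>2) \<le> norm (V * (w x * (cmod (f x))\<^sup>2))"
        by (intro AE_I2) simp
    qed measurable
  next
    assume "integrable (lborel_on a b) (\<lambda>x. (cmod (f x))\<^sup>2)"
    then have "integrable (lborel_on a b) (\<lambda>x. W * (cmod (f x))\<^sup>2)" by simp
    then have "integrable (lborel_on a b) (\<lambda>x. w x *\<^sub>R (cmod (f x))\<^sup>2)"
    proof (rule Bochner_Integration.integrable_bound)
      have "norm (w x *\<^sub>R (cmod (f x))\<^sup>2) \<le> norm (W * (cmod (f x))\<^sup>2)" if "x \<in> {a<..<b}" for x
      proof -
        have "norm (w x) \<le> norm W" using W[of x] that by auto
        then show ?thesis by (simp add: abs_mult mult_right_mono)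
      qed
      then show "AE x in lborel_on a b. norm (w x *\<^sub>R (cmod (f x))\<^sup>2) \<le> norm (W * (cmod (f x))\<^sup>2)"
        by (intro AE_I2) simp
    qed measurable
    then show "integrable M (\<lambda>x. (cmod (f x))\<^sup>2)"
      unfolding M_def by (subst integrable_density) (auto simp: w_nonneg_AE w_measurable f)
  qed
  then show ?thesis by (auto simp: L2_def borel_measurable_M)
qed

subsection \<open>The solution operator\<close>

lemma weighted_integrable: "h \<in> L2 M \<Longrightarrow> set_integrable lborel {a<..<b} (weighted h)"
  using L2_imp_integrable(1)[OF finite_M, of h] L2_measurable[of h M]
  by (simp add: integrable_M weighted_def[abs_def] scaleR_conv_of_real)

lemma primitive_weighted_continuous: "h \<in> L2 M \<Longrightarrow> continuous_on {a..b} (primitive a (weighted h))"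
  by (intro primitive_continuous weighted_integrable)

lemma flux_continuous: "h \<in> L2 M \<Longrightarrow> continuous_on {a..b} (flux h)"
  unfolding flux_def[abs_def]
  by (rule continuous_on_diff[OF continuous_on_const primitive_weighted_continuous])

lemma slope_continuous: "h \<in> L2 M \<Longrightarrow> continuous_on {a..b} (slope h)"
  unfolding slope_def[abs_def] by (intro continuous_intros flux_continuous cont_q)

lemma slope_integrable: "h \<in> L2 M \<Longrightarrow> set_integrable lborel {a<..<b} (slope h)"
  by (intro continuous_set_integrable slope_continuous)

lemma K_continuous: "h \<in> L2 M \<Longrightarrow> continuous_on {a..b} (K h)"
  by (rule continuous_on_cong[THEN iffD1, OF refl _ primitive_continuous[OF slope_integrable]])
     (auto simp: K_def)

lemma K_L2: "h \<in> L2 M \<Longrightarrow> K h \<in> L2 M"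
  by (rule continuous_L2[OF K_continuous])

lemma integral_q_pos: "(LBINT t:{a<..<b}. q t) > 0"
proof -
  have int: "integrable lborel (\<lambda>t. indicator {a<..<b} t *\<^sub>R q t)"
    using continuous_set_integrable[OF cont_q] by (simp add: set_integrable_def)
  have nn: "AE t in lborel. 0 \<le> indicator {a<..<b} t *\<^sub>R q t"
    using q_pos by (intro AE_I2) (auto simp: indicator_def intro: less_imp_le)
  have "(LBINT t:{a<..<b}. q t) \<noteq> 0"
  proof
    assume "(LBINT t:{a<..<b}. q t) = 0"
    then have "AE t in lborel. indicator {a<..<b} t *\<^sub>R q t = 0"
      using integral_nonneg_eq_0_iff_AE[OF int nn] by (simp add: set_lebesgue_integral_def)
    then have "AE t in lborel_on a b. complex_of_real (q t) = 0"
      unfolding AE_lborel_on by eventually_elim (auto simp: indicator_def)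
    from continuous_AE_zero_imp_zero[OF ab _ this, of a] show False
      using q_pos[of a] ab cont_q by (force intro: continuous_intros)
  qed
  moreover have "(LBINT t:{a<..<b}. q t) \<ge> 0"
    unfolding set_lebesgue_integral_def by (rule integral_nonneg_AE[OF nn])
  ultimately show ?thesis by linarith
qed

lemma primitive_q: "primitive a (\<lambda>t. complex_of_real (q t)) b = complex_of_real (LBINT t:{a<..<b}. q t)"
  by (simp add: primitive_def set_integral_complex_of_real)

lemma K_endpoints:
  assumes h: "h \<in> L2 M" shows "K h a = 0" "K h b = 0" "primitive a (slope h) b = 0"
proof -
  have c: "set_integrable lborel {a<..<b} (\<lambda>t. complex_of_real (q t) * flux_const h)"
    "set_integrable lborel {a<..<b} (\<lambda>t. complex_of_real (q t) * primitive a (weighted h) t)"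
    using primitive_weighted_continuous[OF h]
    by (auto intro!: continuous_set_integrable continuous_intros cont_q)
  have "primitive a (slope h) b = (LBINT t:{a<..<b}. complex_of_real (q t) * flux_const h
      - complex_of_real (q t) * primitive a (weighted h) t)"
    by (simp add: primitive_def slope_def flux_def right_diff_distrib)
  also have "\<dots> = (LBINT t:{a<..<b}. complex_of_real (q t) * flux_const h)
      - (LBINT t:{a<..<b}. complex_of_real (q t) * primitive a (weighted h) t)"
    by (rule set_integral_diff(2)[OF c])
  also have "(LBINT t:{a<..<b}. complex_of_real (q t) * flux_const h)
      = complex_of_real (LBINT t:{a<..<b}. q t) * flux_const h"
    by (simp add: set_integral_complex_of_real)
  finally show *: "primitive a (slope h) b = 0"
    using integral_q_pos by (simp add: flux_const_def)
  show "K h a = 0" "K h b = 0" using * by (auto simp: K_def)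
qed

text \<open>The primitive of \<open>w h\<close> is at most the mean of the modulus of
  \<open>h\<close> under \<open>M\<close>, hence at most \<open>C\<close> times its norm, where
  \<open>C\<close> is the square root of the total mass. \<open>flux_const\<close> is a weighted
  average of that primitive and obeys the same bound, whence the factor 2.\<close>

lemma flux_bound:
  obtains C where "C \<ge> 0" "\<And>h x. h \<in> L2 M \<Longrightarrow> x \<in> {a..b} \<Longrightarrow> cmod (flux h x) \<le> C * L2_norm M h"
proof -
  define C where "C = sqrt (measure M (space M))"
  have U: "cmod (primitive a (weighted h) x) \<le> C * L2_norm M h" if h: "h \<in> L2 M" and x: "x \<in> {a..b}" for h x
  proof -
    have sub: "set_integrable lborel {a<..<x} (weighted h)"
      by (rule set_integrable_subset[OF weighted_integrable[OF h]]) (use x in auto)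
    have "cmod (primitive a (weighted h) x) \<le> (LINT t|lborel. norm (indicator {a<..<x} t *\<^sub>R weighted h t))"
      unfolding primitive_def set_lebesgue_integral_def by (rule integral_norm_bound)
    also have "\<dots> \<le> (LINT t|lborel. norm (indicator {a<..<b} t *\<^sub>R weighted h t))"
      using integrable_norm[OF sub[unfolded set_integrable_def]]
        integrable_norm[OF weighted_integrable[OF h, unfolded set_integrable_def]]
      by (rule integral_mono) (use x in \<open>auto simp: indicator_def\<close>)
    also have "\<dots> = (LBINT t:{a<..<b}. w t *\<^sub>R cmod (h t))"
      unfolding set_lebesgue_integral_def
    proof (rule Bochner_Integration.integral_cong)
      show "norm (indicator {a<..<b} t *\<^sub>R weighted h t) = indicator {a<..<b} t *\<^sub>R w t *\<^sub>R cmod (h t)" for t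
        using w_pos[of t] by (auto simp: indicator_def weighted_def norm_mult)
    qed simp
    also have "\<dots> = (LINT t|M. cmod (h t))"
      by (rule integral_M[symmetric]) (use L2_measurable[OF h] in measurable)
    also have "\<dots> \<le> L2_norm M h * C"
      unfolding C_def by (rule L2_imp_integrable(2)[OF finite_M h])
    finally show ?thesis by (simp add: mult.commute)
  qed
  define I where "I = (LBINT t:{a<..<b}. q t)"
  have c: "cmod (flux_const h) \<le> C * L2_norm M h" if h: "h \<in> L2 M" for h
  proof -
    have "cmod (LBINT t:{a<..<b}. complex_of_real (q t) * primitive a (weighted h) t)
        \<le> (LINT t|lborel. norm (indicator {a<..<b} t *\<^sub>R (complex_of_real (q t) * primitive a (weighted h) t)))"
      unfolding set_lebesgue_integral_def by (rule integral_norm_bound)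
    also have "\<dots> \<le> (LINT t|lborel. indicator {a<..<b} t *\<^sub>R (q t * (C * L2_norm M h)))"
    proof (rule integral_mono)
      have "continuous_on {a..b} (\<lambda>t. complex_of_real (q t) * primitive a (weighted h) t)"
        by (intro continuous_intros cont_q primitive_weighted_continuous h)
      then show "integrable lborel (\<lambda>t. norm (indicator {a<..<b} t *\<^sub>R (complex_of_real (q t) * primitive a (weighted h) t)))"
        using continuous_set_integrable unfolding set_integrable_def by (intro integrable_norm)
      show "integrable lborel (\<lambda>t. indicator {a<..<b} t *\<^sub>R (q t * (C * L2_norm M h)))"
        unfolding set_integrable_def[symmetric]
        by (intro continuous_set_integrable continuous_intros cont_q)
      show "norm (indicator {a<..<b} t *\<^sub>R (complex_of_real (q t) * primitive a (weighted h) t))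
          \<le> indicator {a<..<b} t *\<^sub>R (q t * (C * L2_norm M h))" for t
        using U[OF h, of t] q_pos[of t]
        by (cases "t \<in> {a<..<b}") (auto simp: norm_mult intro!: mult_left_mono)
    qed
    also have "\<dots> = I * (C * L2_norm M h)"
      by (simp add: I_def set_lebesgue_integral_def mult.assoc[symmetric])
    finally have "cmod (LBINT t:{a<..<b}. complex_of_real (q t) * primitive a (weighted h) t)
        \<le> I * (C * L2_norm M h)" .
    then show ?thesis
      using integral_q_pos by (simp add: flux_const_def norm_divide I_def[symmetric] pos_divide_le_eq mult.commute)
  qed
  have "cmod (flux h x) \<le> 2 * C * L2_norm M h" if "h \<in> L2 M" "x \<in> {a..b}" for h x
    using norm_triangle_ineq4[of "flux_const h" "primitive a (weighted h) x"] U[OF that] c[OF that(1)]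
    by (simp add: flux_def)
  then show ?thesis by (intro that[of "2 * C"]) (auto simp: C_def)
qed

text \<open>The slope is bounded by the norm of \<open>h\<close>. The constant is uniform in
  \<open>h\<close>, so the image of the unit ball is equicontinuous, and since
  \<open>K h a = 0\<close> it is also bounded.\<close>

lemma K_lipschitz:
  obtains C where "C > 0"
    "\<And>h x y. h \<in> L2 M \<Longrightarrow> x \<in> {a..b} \<Longrightarrow> y \<in> {a..b} \<Longrightarrow> cmod (K h x - K h y) \<le> C * L2_norm M h * \<bar>x - y\<bar>"
proof -
  obtain C where C: "C \<ge> 0" "\<And>h x. h \<in> L2 M \<Longrightarrow> x \<in> {a..b} \<Longrightarrow> cmod (flux h x) \<le> C * L2_norm M h"
    using flux_bound by blast
  obtain Q where Q: "\<And>x. x \<in> {a..b} \<Longrightarrow> norm (q x) \<le> Q" "Q \<ge> 0" using continuous_bounded[OF cont_q] by blast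
  \<comment> \<open>The summand 1 only makes the Lipschitz constant strictly positive.\<close>
  have *: "cmod (K h y - K h x) \<le> (Q * C + 1) * L2_norm M h * \<bar>y - x\<bar>"
    if h: "h \<in> L2 M" and xy: "a \<le> x" "x \<le> y" "y \<le> b" for h x y
  proof -
    note prim = primitive_eq_integral[OF slope_integrable[OF h]]
    have "K h y - K h x = integral {x..y} (slope h)"
      using prim[of x] prim[of y] xy
        Henstock_Kurzweil_Integration.integral_combine[of a x y "slope h"]
      by (auto simp: K_def algebra_simps)
    also have "norm \<dots> \<le> (Q * (C * L2_norm M h)) * (y - x)"
    proof (rule integral_bound)
      show "continuous_on {x..y} (slope h)"
        using slope_continuous[OF h] by (rule continuous_on_subset) (use xy in auto)
      show "norm (slope h t) \<le> Q * (C * L2_norm M h)" if "t \<in> {x..y}" for t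
        unfolding slope_def norm_mult norm_of_real
        using Q(1)[of t] C(2)[OF h, of t] Q(2) that xy by (intro mult_mono) auto
    qed fact
    also have "\<dots> \<le> ((Q * C + 1) * L2_norm M h) * (y - x)"
      using xy by (intro mult_right_mono) (auto simp: algebra_simps)
    finally show ?thesis using xy by simp
  qed
  have "cmod (K h x - K h y) \<le> (Q * C + 1) * L2_norm M h * \<bar>x - y\<bar>"
    if "h \<in> L2 M" "x \<in> {a..b}" "y \<in> {a..b}" for h x y
    using *[of h x y] *[of h y x] that by (cases "x \<le> y") (auto simp: norm_minus_commute abs_minus_commute)
  then show ?thesis using C(1) Q(2) by (intro that[of "Q * C + 1"]) (auto simp: add_nonneg_pos)
qed

lemma K_bound_pointwise:
  obtains C where "C > 0" "\<And>h x. h \<in> L2 M \<Longrightarrow> x \<in> {a..b} \<Longrightarrow> cmod (K h x) \<le> C * L2_norm M h"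
proof -
  obtain C where C: "C > 0" "\<And>h x y. h \<in> L2 M \<Longrightarrow> x \<in> {a..b} \<Longrightarrow> y \<in> {a..b} \<Longrightarrow>
      cmod (K h x - K h y) \<le> C * L2_norm M h * \<bar>x - y\<bar>"
    using K_lipschitz by blast
  have "cmod (K h x) \<le> C * (b - a) * L2_norm M h" if h: "h \<in> L2 M" and x: "x \<in> {a..b}" for h x
  proof -
    have "cmod (K h x) \<le> C * L2_norm M h * \<bar>x - a\<bar>"
      using C(2)[OF h x, of a] K_endpoints(1)[OF h] ab by simp
    also have "\<dots> \<le> C * L2_norm M h * (b - a)"
      using x C(1) by (intro mult_left_mono) auto
    finally show ?thesis by (simp add: mult_ac)
  qed
  then show ?thesis using C(1) ab by (intro that[of "C * (b - a)"]) auto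
qed

text \<open>The energy form of the problem. Its right-hand side is Hermitian in \<open>h\<close> and
  \<open>g\<close> and nonnegative for \<open>h = g\<close>, so symmetry and positivity of
  \<open>K\<close> can both be read off.\<close>

lemma inner_K:
  assumes h: "h \<in> L2 M" and g: "g \<in> L2 M"
  shows "L2_inner M (K h) g = (LBINT x:{a<..<b}. complex_of_real (q x) * (flux h x * cnj (flux g x)))"
proof -
  define v where "v = (\<lambda>x. cnj (weighted g x))"
  have v: "set_integrable lborel {a<..<b} v"
    using weighted_integrable[OF g] unfolding v_def set_integrable_def
    by (subst complex_integrable_cnj[symmetric]) (simp add: scaleR_conv_of_real)
  have prim_v: "primitive a v x = cnj (primitive a (weighted g) x)" for x
    unfolding primitive_def v_def set_lebesgue_integral_def Bochner_Integration.integral_cnj[symmetric]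
    by (simp add: scaleR_conv_of_real)
  have "L2_inner M (K h) g = (LBINT x:{a<..<b}. w x *\<^sub>R (K h x * cnj (g x)))"
    unfolding L2_inner_def
    by (rule integral_M) (use L2_measurable[OF g] L2_measurable[OF K_L2[OF h]] in measurable)
  also have "\<dots> = (LBINT x:{a<..<b}. primitive a (slope h) x * v x)"
    by (rule set_lebesgue_integral_cong) (auto simp: K_def v_def weighted_def scaleR_conv_of_real)
  also have "\<dots> = - (LBINT x:{a<..<b}. slope h x * primitive a v x)"
    using primitive_by_parts(3)[OF slope_integrable[OF h] v] K_endpoints(3)[OF h]
    by (simp add: eq_neg_iff_add_eq_0 add.commute)
  \<comment> \<open>The added term is zero because the slope of \<open>h\<close> has integral 0; it
    completes the primitive of \<open>g\<close> to the flux of \<open>g\<close>.\<close>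
  also have "\<dots> = (LBINT x:{a<..<b}. slope h x * cnj (flux_const g)) - (LBINT x:{a<..<b}. slope h x * primitive a v x)"
    using K_endpoints(3)[OF h] by (simp add: primitive_def)
  also have "\<dots> = (LBINT x:{a<..<b}. slope h x * cnj (flux_const g) - slope h x * primitive a v x)"
    using slope_integrable[OF h] primitive_by_parts(1)[OF slope_integrable[OF h] v]
    by (intro set_integral_diff(2)[symmetric]) auto
  also have "\<dots> = (LBINT x:{a<..<b}. complex_of_real (q x) * (flux h x * cnj (flux g x)))"
    by (simp add: prim_v slope_def flux_def algebra_simps)
  finally show ?thesis .
qed

lemma slope_weak_deriv: "h \<in> L2 M \<Longrightarrow> has_weak_deriv a b (primitive a (slope h)) (slope h)"
  using has_weak_deriv_primitive[OF ab slope_integrable, of h 0] by simp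

lemma flux_weak_deriv:
  assumes h: "h \<in> L2 M" shows "has_weak_deriv a b (flux h) (\<lambda>x. - weighted h x)"
proof -
  have "set_integrable lborel {a<..<b} (\<lambda>x. - weighted h x)"
    using weighted_integrable[OF h] by (simp add: set_integrable_def)
  from has_weak_deriv_primitive[OF ab this, of "flux_const h"] show ?thesis
    by (simp add: flux_def[abs_def] primitive_def set_lebesgue_integral_def)
qed

text \<open>Uniqueness of weak derivatives is used twice: \<open>K h\<close> null forces the slope
  and thus the flux to be null, and then \<open>w h\<close>; both \<open>q\<close> and
  \<open>w\<close> are positive.\<close>

lemma K_injective:
  assumes h: "h \<in> L2 M" and "AE x in M. K h x = 0" shows "AE x in M. h x = 0"
proof -
  have "AE x in lborel_on a b. primitive a (slope h) x = 0"
    using assms(2) unfolding AE_M AE_lborel_on by eventually_elim (auto simp: K_def)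
  from weak_deriv_zero_AE[OF slope_weak_deriv[OF h] this]
  have "AE x in lborel_on a b. flux h x = 0"
    unfolding AE_lborel_on
  proof eventually_elim
    case (elim x)
    then show ?case using q_pos[of x] by (auto simp: slope_def)
  qed
  from weak_deriv_zero_AE[OF flux_weak_deriv[OF h] this] show ?thesis
    unfolding AE_M AE_lborel_on
  proof eventually_elim
    case (elim x)
    then show ?case using w_pos[of x] by (auto simp: weighted_def)
  qed
qed

end

section \<open>Linearity and compactness of the solution operator\<close>

context sturm_liouville
begin

lemma primitive_add:
  assumes "set_integrable lborel {a<..<b} u" "set_integrable lborel {a<..<b} v" "x \<in> {a..b}"
  shows "primitive a (\<lambda>t. u t + v t) x = primitive a u x + primitive a v x"
  unfolding primitive_def
  by (intro set_integral_add(2) set_integrable_subset[OF assms(1)] set_integrable_subset[OF assms(2)])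
     (use assms(3) in auto)

lemma primitive_scale: "primitive a (\<lambda>t. c * u t) x = c * primitive a u x"
  unfolding primitive_def by simp

lemma primitive_cong:
  assumes "\<And>t. t \<in> {a<..<b} \<Longrightarrow> u t = v t" "x \<in> {a..b}"
  shows "primitive a u x = primitive a v x"
  unfolding primitive_def by (rule set_lebesgue_integral_cong) (use assms in auto)

lemma primitive_weighted_add:
  assumes f: "f \<in> L2 M" and g: "g \<in> L2 M" and "x \<in> {a..b}"
  shows "primitive a (weighted (\<lambda>x. f x + g x)) x = primitive a (weighted f) x + primitive a (weighted g) x"
proof -
  have "weighted (\<lambda>x. f x + g x) = (\<lambda>x. weighted f x + weighted g x)"
    by (simp add: weighted_def fun_eq_iff algebra_simps)
  then show ?thesis
    by (simp only: primitive_add[OF weighted_integrable[OF f] weighted_integrable[OF g] assms(3)])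
qed

lemma primitive_weighted_scale: "primitive a (weighted (\<lambda>x. c * f x)) x = c * primitive a (weighted f) x"
proof -
  have "weighted (\<lambda>x. c * f x) = (\<lambda>x. c * weighted f x)"
    by (simp add: weighted_def fun_eq_iff)
  then show ?thesis by (simp add: primitive_scale)
qed

lemma flux_add:
  assumes f: "f \<in> L2 M" and g: "g \<in> L2 M" and x: "x \<in> {a..b}"
  shows "flux (\<lambda>x. f x + g x) x = flux f x + flux g x"
proof -
  have int: "set_integrable lborel {a<..<b} (\<lambda>t. complex_of_real (q t) * primitive a (weighted h) t)"
    if "h \<in> L2 M" for h
    using primitive_weighted_continuous[OF that]
    by (auto intro!: continuous_set_integrable continuous_intros cont_q)
  have "(LBINT t:{a<..<b}. complex_of_real (q t) * primitive a (weighted (\<lambda>x. f x + g x)) t)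
      = (LBINT t:{a<..<b}. complex_of_real (q t) * primitive a (weighted f) t
        + complex_of_real (q t) * primitive a (weighted g) t)"
    by (rule set_lebesgue_integral_cong) (auto simp: primitive_weighted_add f g algebra_simps)
  also have "\<dots> = (LBINT t:{a<..<b}. complex_of_real (q t) * primitive a (weighted f) t)
      + (LBINT t:{a<..<b}. complex_of_real (q t) * primitive a (weighted g) t)"
    by (rule set_integral_add(2)[OF int[OF f] int[OF g]])
  finally have "flux_const (\<lambda>x. f x + g x) = flux_const f + flux_const g"
    by (simp add: flux_const_def add_divide_distrib)
  then show ?thesis using x by (simp add: flux_def primitive_weighted_add f g)
qed

lemma flux_scale: "flux (\<lambda>x. c * f x) x = c * flux f x"
proof -
  have "(LBINT t:{a<..<b}. complex_of_real (q t) * primitive a (weighted (\<lambda>x. c * f x)) t)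
      = (LBINT t:{a<..<b}. c * (complex_of_real (q t) * primitive a (weighted f) t))"
    by (simp add: primitive_weighted_scale mult_ac)
  then have "flux_const (\<lambda>x. c * f x) = c * flux_const f"
    by (simp add: flux_const_def)
  then show ?thesis by (simp add: flux_def primitive_weighted_scale algebra_simps)
qed

lemma K_add:
  assumes f: "f \<in> L2 M" and g: "g \<in> L2 M" shows "K (\<lambda>x. f x + g x) = (\<lambda>x. K f x + K g x)"
proof
  fix x
  have "primitive a (slope (\<lambda>x. f x + g x)) x = primitive a (\<lambda>t. slope f t + slope g t) x" if "x \<in> {a..b}"
    by (rule primitive_cong[OF _ that]) (simp add: slope_def flux_add f g algebra_simps)
  then show "K (\<lambda>x. f x + g x) x = K f x + K g x"
    by (simp add: K_def primitive_add slope_integrable f g)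
qed

lemma K_scale: "K (\<lambda>x. c * f x) = (\<lambda>x. c * K f x)"
proof -
  have "slope (\<lambda>x. c * f x) = (\<lambda>x. c * slope f x)"
    by (simp add: slope_def flux_scale fun_eq_iff)
  then show ?thesis by (intro ext) (simp add: K_def primitive_scale)
qed

lemma K_compact:
  assumes s: "\<And>n :: nat. s n \<in> L2 M" "\<And>n. L2_norm M (s n) \<le> 1"
  shows "\<exists>r g. strict_mono (r :: nat \<Rightarrow> nat) \<and> g \<in> L2 M \<and> (\<lambda>n. L2_norm M (\<lambda>x. K (s (r n)) x - g x)) \<longlonglongrightarrow> 0"
proof -
  obtain B where B: "B > 0" "\<And>h x. h \<in> L2 M \<Longrightarrow> x \<in> {a..b} \<Longrightarrow> cmod (K h x) \<le> B * L2_norm M h"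
    using K_bound_pointwise by blast
  obtain C where C: "C > 0" "\<And>h x y. h \<in> L2 M \<Longrightarrow> x \<in> {a..b} \<Longrightarrow> y \<in> {a..b} \<Longrightarrow>
      cmod (K h x - K h y) \<le> C * L2_norm M h * \<bar>x - y\<bar>"
    using K_lipschitz by blast
  have bound: "norm (K (s n) x) \<le> B" if "x \<in> {a..b}" for n x
  proof -
    have "B * L2_norm M (s n) \<le> B * 1" using B(1) s(2) by (intro mult_left_mono) auto
    then show ?thesis using B(2)[OF s(1) that, of n] by linarith
  qed
  have equicont: "\<exists>d>0. \<forall>n y. y \<in> {a..b} \<and> norm (x - y) < d \<longrightarrow> norm (K (s n) x - K (s n) y) < \<epsilon>"
    if x: "x \<in> {a..b}" and "\<epsilon> > 0" for x \<epsilon>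
  proof (intro exI[of _ "\<epsilon> / C"] conjI allI impI)
    fix n y assume y: "y \<in> {a..b} \<and> norm (x - y) < \<epsilon> / C"
    have "norm (K (s n) x - K (s n) y) \<le> C * L2_norm M (s n) * \<bar>x - y\<bar>" using C(2) s(1) x y by blast
    also have "\<dots> \<le> C * 1 * \<bar>x - y\<bar>"
      using C(1) s(2) by (intro mult_right_mono mult_left_mono) auto
    also have "\<dots> < \<epsilon>" using y C(1) by (simp add: pos_less_divide_eq mult.commute)
    finally show "norm (K (s n) x - K (s n) y) < \<epsilon>" .
  qed (use \<open>\<epsilon> > 0\<close> C(1) in auto)
  obtain g r where g: "continuous_on {a..b} g" and r: "strict_mono (r :: nat \<Rightarrow> nat)"
    and lim: "\<And>\<epsilon>. 0 < \<epsilon> \<Longrightarrow> \<exists>N. \<forall>n x. n \<ge> N \<and> x \<in> {a..b} \<longrightarrow> norm (K (s (r n)) x - g x) < \<epsilon>"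
    using Arzela_Ascoli[of "{a..b}" "\<lambda>n. K (s n)" B] bound equicont by (metis compact_Icc)
  note g_L2 = continuous_L2[OF g]
  have "(\<lambda>n. L2_norm M (\<lambda>x. K (s (r n)) x - g x)) \<longlonglongrightarrow> 0"
  proof (rule LIMSEQ_I)
    fix \<epsilon> :: real assume "\<epsilon> > 0"
    \<comment> \<open>Uniform distance below \<open>\<epsilon> / c\<close> gives mean-square
      distance below \<open>\<epsilon>\<close>, as \<open>c\<close> exceeds the square root of the
      total mass.\<close>
    define c where "c = sqrt (measure M (space M)) + 1"
    have c: "c > 0" by (simp add: c_def add_nonneg_pos)
    obtain N where N: "\<And>n x. n \<ge> N \<Longrightarrow> x \<in> {a..b} \<Longrightarrow> norm (K (s (r n)) x - g x) < \<epsilon> / c"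
      using lim[of "\<epsilon> / c"] \<open>\<epsilon> > 0\<close> c by auto
    have "norm (L2_norm M (\<lambda>x. K (s (r n)) x - g x) - 0) < \<epsilon>" if "n \<ge> N" for n
    proof -
      have "L2_norm M (\<lambda>x. K (s (r n)) x - g x) \<le> \<epsilon> / c * sqrt (measure M (space M))"
      proof (rule L2_norm_le_bound(2)[OF finite_M])
        show "(\<lambda>x. K (s (r n)) x - g x) \<in> borel_measurable M"
          using L2_measurable[OF g_L2] L2_measurable[OF K_L2[OF s(1)]] by measurable
        show "cmod (K (s (r n)) x - g x) \<le> \<epsilon> / c" if "x \<in> space M" for x
          using N[OF \<open>n \<ge> N\<close>, of x] that by simp
      qed (use \<open>\<epsilon> > 0\<close> c in simp)
      also have "\<dots> < \<epsilon> / c * c"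
        using \<open>\<epsilon> > 0\<close> c by (intro mult_strict_left_mono) (auto simp: c_def)
      finally show ?thesis using c by simp
    qed
    then show "\<exists>N. \<forall>n\<ge>N. norm (L2_norm M (\<lambda>x. K (s (r n)) x - g x) - 0) < \<epsilon>" by blast
  qed
  then show ?thesis using r g_L2 by blast
qed

lemma orthonormal_exists: "\<exists>\<omega>. L2_orthonormal M \<omega>"
proof -
  \<comment> \<open>The points \<open>a + l n\<close> decrease strictly towards \<open>a\<close>, so
    the gaps between neighbours are infinitely many disjoint intervals.\<close>
  define l where "l n = (b - a) / real (n + 1)" for n :: nat
  have l_pos: "l n > 0" and l_less: "l (Suc n) < l n" for n
    using ab by (auto simp: l_def field_simps)
  have l_anti: "l n \<le> l m" if "m \<le> n" for m n
    using that by (induction n rule: dec_induct) (auto intro: less_imp_le[OF l_less] order_trans)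
  have l_le: "l n \<le> b - a" for n using l_anti[of 0 n] by (simp add: l_def)
  define A where "A n = {a + l (Suc n)<..<a + l n}" for n
  have sub: "A n \<subseteq> {a<..<b}" for n
    using l_pos[of "Suc n"] l_le[of n] by (auto simp: A_def)
  have sets: "A n \<in> sets M" for n
    using sub[of n] by (simp add: M_def sets_restrict_space_iff A_def)
  have pos: "measure M (A n) > 0" for n
  proof (rule ccontr)
    interpret finite_measure M by (rule finite_M)
    assume "\<not> measure M (A n) > 0"
    then have "A n \<in> null_sets M"
      using sets by (intro null_setsI) (auto simp: emeasure_eq_measure less_le)
    then have "AE x in M. x \<notin> A n" by (rule AE_not_in)
    then have "AE x in lborel. x \<notin> A n"
      unfolding AE_M AE_lborel_on by eventually_elim (use sub[of n] in auto)
    then have "A n \<in> null_sets lborel" by (subst AE_iff_null_sets) (auto simp: A_def)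
    then have "emeasure lborel (A n) = 0" by (rule null_setsD1)
    then show False using l_less[of n] by (simp add: A_def)
  qed
  have "A m \<inter> A n = {}" if "m < n" for m n
    using l_anti[of "Suc m" n] that by (auto simp: A_def)
  then have "disjoint_family A"
    unfolding disjoint_family_on_def by (metis Int_commute linorder_neqE_nat)
  then show ?thesis by (rule exists_orthonormal_sequence[OF finite_M sets pos])
qed

sublocale op: compact_positive_operator M K
proof (rule compact_positive_operator.intro)
  have inner_nonneg: "0 \<le> Re (L2_inner M (K f) f)" if f: "f \<in> L2 M" for f
  proof -
    have "L2_inner M (K f) f = (LBINT x:{a<..<b}. complex_of_real (q x * (cmod (flux f x))\<^sup>2))"
      unfolding inner_K[OF f f]
      by (rule set_lebesgue_integral_cong) (simp_all add: complex_norm_square del: of_real_power)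
    also have "\<dots> = complex_of_real (LBINT x:{a<..<b}. q x * (cmod (flux f x))\<^sup>2)"
      by (rule set_integral_complex_of_real)
    finally have "Re (L2_inner M (K f) f) = (LBINT x:{a<..<b}. q x * (cmod (flux f x))\<^sup>2)" by simp
    also have "\<dots> \<ge> 0"
      unfolding set_lebesgue_integral_def
      by (rule Bochner_Integration.integral_nonneg) (use q_pos in \<open>auto simp: indicator_def less_imp_le\<close>)
    finally show ?thesis .
  qed
  have inner_sym: "L2_inner M (K f) g = L2_inner M f (K g)" if f: "f \<in> L2 M" and g: "g \<in> L2 M" for f g
  proof -
    have "L2_inner M f (K g) = cnj (L2_inner M (K g) f)" by (rule L2_inner_commute)
    also have "\<dots> = (LBINT x:{a<..<b}. complex_of_real (q x) * (flux f x * cnj (flux g x)))"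
      unfolding inner_K[OF g f] set_lebesgue_integral_def Bochner_Integration.integral_cnj[symmetric]
      by (simp add: scaleR_conv_of_real mult_ac)
    finally show ?thesis by (simp add: inner_K[OF f g])
  qed
  obtain B where B: "B > 0" "\<And>h x. h \<in> L2 M \<Longrightarrow> x \<in> {a..b} \<Longrightarrow> cmod (K h x) \<le> B * L2_norm M h"
    using K_bound_pointwise by blast
  have "L2_norm M (K f) \<le> (B * sqrt (measure M (space M))) * L2_norm M f" if f: "f \<in> L2 M" for f
  proof -
    have "L2_norm M (K f) \<le> (B * L2_norm M f) * sqrt (measure M (space M))"
      by (rule L2_norm_le_bound(2)[OF finite_M])
         (use L2_measurable[OF K_L2[OF f]] B(1) B(2)[OF f] in auto)
    then show ?thesis by (simp add: mult_ac)
  qed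
  then show "\<exists>C. \<forall>f\<in>L2 M. L2_norm M (K f) \<le> C * L2_norm M f" by blast
  show "finite_measure M" by (rule finite_M)
  show "\<And>f g. f \<in> L2 M \<Longrightarrow> g \<in> L2 M \<Longrightarrow> L2_inner M (K f) g = L2_inner M f (K g)" by (rule inner_sym)
  show "\<And>f. f \<in> L2 M \<Longrightarrow> 0 \<le> Re (L2_inner M (K f) f)" by (rule inner_nonneg)
qed (blast intro: K_L2 K_add K_scale K_injective K_compact orthonormal_exists)+

subsection \<open>Identification with the weakly defined operator\<close>

lemma primitive_continuous_nonzero: "primitive a (\<lambda>t. complex_of_real (q t)) b \<noteq> 0"
  using integral_q_pos by (simp add: primitive_q)

text \<open>Two applications of the constancy theorem: \<open>p D'\<close> is a constant
  \<open>c\<close>, so \<open>D'\<close> equals \<open>c * q\<close>, and \<open>D\<close> minus the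
  primitive of that is a constant \<open>d\<close>.\<close>

lemma weak_homogeneous_solution:
  assumes p: "\<And>x. x \<in> {a<..<b} \<Longrightarrow> p x * complex_of_real (q x) = 1"
    and D: "has_weak_deriv a b D D'" and pD: "has_weak_deriv a b (\<lambda>x. p x * D' x) (\<lambda>x. 0)"
  obtains c d where "AE x in lborel_on a b. D x = d + c * primitive a (\<lambda>t. complex_of_real (q t)) x"
proof -
  obtain c where "AE x in lborel_on a b. p x * D' x = c"
    using weak_deriv_zero_imp_constant[OF ab pD] by blast
  then have c: "AE x in lborel_on a b. D' x - c * complex_of_real (q x) = 0"
    unfolding AE_lborel_on
  proof eventually_elim
    case (elim x)
    have "D' x - c * complex_of_real (q x) = (1 - p x * complex_of_real (q x)) * D' x"
      if "x \<in> {a<..<b}" using elim that by (auto simp: algebra_simps)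
    then show ?case using p[of x] by auto
  qed
  have int: "set_integrable lborel {a<..<b} (\<lambda>x. c * complex_of_real (q x))"
    by (intro continuous_set_integrable continuous_intros cont_q)
  have "has_weak_deriv a b (\<lambda>x. D x - (0 + primitive a (\<lambda>x. c * complex_of_real (q x)) x))
      (\<lambda>x. D' x - c * complex_of_real (q x))"
    by (rule has_weak_deriv_diff[OF D has_weak_deriv_primitive[OF ab int]])
  from weak_deriv_zero_imp_constant[OF ab has_weak_deriv_zero_if_AE_zero[OF this c]]
  obtain d where "AE x in lborel_on a b. D x - (0 + primitive a (\<lambda>x. c * complex_of_real (q x)) x) = d"
    by blast
  then have "AE x in lborel_on a b. D x = d + c * primitive a (\<lambda>t. complex_of_real (q t)) x"
    by eventually_elim (simp add: primitive_scale algebra_simps)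
  then show ?thesis by (rule that)
qed

text \<open>One inclusion of the identification: any representative of \<open>K S\<close> lies in
  the weak domain, with the slope as derivative and minus \<open>w S\<close> as derivative of the
  flux.\<close>

lemma K_weak_solution:
  assumes p: "\<And>x. x \<in> {a<..<b} \<Longrightarrow> p x * complex_of_real (q x) = 1"
    and S: "S \<in> L2 M" and R: "R \<in> borel_measurable M" "AE x in M. R x = K S x"
  shows "R \<in> H1_0 a b" "has_weak_deriv a b R (slope S)"
    "has_weak_deriv a b (\<lambda>x. p x * slope S x) (\<lambda>x. - weighted S x)"
    "(\<lambda>x. - weighted S x) \<in> L2 M"
proof -
  have R_L2: "R \<in> L2 M" by (rule L2_AE_cong[OF K_L2[OF S] R])
  have meas: "slope S \<in> borel_measurable (lborel_on a b)"
    by (rule continuous_measurable[OF slope_continuous[OF S]])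
  have "AE x in lborel_on a b. R x = primitive a (slope S) x"
    using R(2) unfolding AE_M AE_lborel_on by eventually_elim (auto simp: K_def)
  then show wd: "has_weak_deriv a b R (slope S)"
    using R(1) meas unfolding borel_measurable_M
    by (intro has_weak_deriv_cong_AE[OF slope_weak_deriv[OF S]]) auto
  have eq: "p x * slope S x = flux S x" if "x \<in> {a<..<b}" for x
    using p[OF that] by (simp add: slope_def mult.assoc[symmetric])
  have wm: "(\<lambda>x. - weighted S x) \<in> borel_measurable (lborel_on a b)"
    using L2_measurable[OF S] w_measurable unfolding borel_measurable_M weighted_def by measurable
  show "has_weak_deriv a b (\<lambda>x. p x * slope S x) (\<lambda>x. - weighted S x)"
  proof (rule has_weak_deriv_cong_AE[OF flux_weak_deriv[OF S] _ _ wm])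
    show "(\<lambda>x. p x * slope S x) \<in> borel_measurable (lborel_on a b)"
      using continuous_measurable[OF flux_continuous[OF S]]
      by (subst measurable_cong[of _ _ "flux S"]) (use eq in auto)
    show "AE x in lborel_on a b. p x * slope S x = flux S x" by (rule AE_I2) (use eq in auto)
  qed simp
  show "R \<in> H1_0 a b"
    unfolding H1_0_def H1_def L2_M[symmetric]
  proof (intro CollectI conjI bexI[of _ "slope S"] exI[of _ "K S"] R_L2 wd K_continuous K_endpoints S)
    show "slope S \<in> L2 M" by (rule continuous_L2[OF slope_continuous[OF S]])
    show "AE x in lborel_on a b. R x = K S x" using R(2) by (simp add: AE_M)
  qed
  obtain W where W: "\<And>x. x \<in> {a..b} \<Longrightarrow> norm (w x) \<le> W" using continuous_bounded[OF cont_w] by blast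
  have "(\<lambda>x. complex_of_real (w x) * S x) \<in> L2 M"
    by (rule L2_bounded_mult[OF S, of _ W]) (use W w_measurable in \<open>auto simp: borel_measurable_M\<close>)
  then show "(\<lambda>x. - weighted S x) \<in> L2 M"
    unfolding weighted_def by (rule L2_uminus)
qed

text \<open>The right-hand side copies the shape of the operator definition, with one pair of
  derivatives for the domain and another for the image. In the converse direction,
  \<open>R - K S\<close> solves the homogeneous equation and vanishes at both ends.\<close>

theorem inverse_graph_eq_weak_graph:
  assumes p: "\<And>x. x \<in> {a<..<b} \<Longrightarrow> p x * complex_of_real (q x) = 1"
  shows "(R, S) \<in> op.inverse_graph \<longleftrightarrow> R \<in> H1_0 a b \<and>
    (\<exists>R' T. has_weak_deriv a b R R' \<and> has_weak_deriv a b (\<lambda>x. p x * R' x) T \<and> T \<in> L2 M) \<and>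
    S \<in> borel_measurable M \<and>
    (\<exists>R' T. has_weak_deriv a b R R' \<and> has_weak_deriv a b (\<lambda>x. p x * R' x) T \<and>
      (AE x in M. S x = - complex_of_real (1 / w x) * T x))" (is "_ \<longleftrightarrow> ?weak")
proof
  assume "(R, S) \<in> op.inverse_graph"
  then have S: "S \<in> L2 M" and R: "R \<in> borel_measurable M" "AE x in M. R x = K S x"
    by (auto simp: op.inverse_graph_def)
  have "AE x in M. S x = - complex_of_real (1 / w x) * (- weighted S x)"
  proof (rule AE_I2)
    show "S x = - complex_of_real (1 / w x) * (- weighted S x)" if "x \<in> space M" for x
      using that w_pos[of x] by (simp add: weighted_def)
  qed
  then show ?weak
    using K_weak_solution[OF p S R] L2_measurable[OF S] by blast
next
  assume weak: ?weak
  then obtain R1 T1 R2 T2 where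
    1: "has_weak_deriv a b R R1" "has_weak_deriv a b (\<lambda>x. p x * R1 x) T1" "T1 \<in> L2 M"
    and 2: "has_weak_deriv a b R R2" "has_weak_deriv a b (\<lambda>x. p x * R2 x) T2"
    and S2: "AE x in M. S x = - complex_of_real (1 / w x) * T2 x"
    and S: "S \<in> borel_measurable M" by blast
  \<comment> \<open>The two pairs of derivatives agree almost everywhere, so \<open>T2\<close> may
    be replaced by the square-integrable \<open>T1\<close>.\<close>
  have "AE x in lborel_on a b. R1 x = R2 x" by (rule weak_deriv_unique[OF 1(1) 2(1)]) simp
  then have "AE x in lborel_on a b. p x * R1 x = p x * R2 x" by eventually_elim simp
  from weak_deriv_unique[OF 1(2) 2(2) this] have "AE x in M. T1 x = T2 x" by (simp add: AE_M)
  then have S1: "AE x in M. S x = - complex_of_real (1 / w x) * T1 x"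
    using S2 by eventually_elim simp
  have S_L2: "S \<in> L2 M"
  proof (rule L2_AE_cong[OF _ S S1])
    have c: "continuous_on {a..b} (\<lambda>x. - complex_of_real (1 / w x))"
      using w_pos by (intro continuous_intros cont_w) force
    obtain V where V: "\<And>x. x \<in> {a..b} \<Longrightarrow> norm (- complex_of_real (1 / w x)) \<le> V"
      using continuous_bounded[OF c] by blast
    show "(\<lambda>x. - complex_of_real (1 / w x) * T1 x) \<in> L2 M"
      by (rule L2_bounded_mult[OF 1(3), of _ V])
         (use V continuous_measurable[OF c] in \<open>auto simp: borel_measurable_M\<close>)
  qed
  have "K S \<in> borel_measurable M" by (rule L2_measurable[OF K_L2[OF S_L2]])
  note KS = K_weak_solution[OF p S_L2 this AE_I2[OF refl]]
  define D where "D = (\<lambda>x. R x - K S x)"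
  have D: "has_weak_deriv a b D (\<lambda>x. R1 x - slope S x)"
    unfolding D_def by (rule has_weak_deriv_diff[OF 1(1) KS(2)])
  have "has_weak_deriv a b (\<lambda>x. p x * (R1 x - slope S x)) (\<lambda>x. 0)"
  proof (rule has_weak_deriv_zero_if_AE_zero)
    show "has_weak_deriv a b (\<lambda>x. p x * (R1 x - slope S x)) (\<lambda>x. T1 x - (- weighted S x))"
      using has_weak_deriv_diff[OF 1(2) KS(3)] by (simp add: right_diff_distrib)
    show "AE x in lborel_on a b. T1 x - (- weighted S x) = 0"
      using S1 unfolding AE_M AE_lborel_on
    proof eventually_elim
      case (elim x)
      then show ?case using w_pos[of x] by (auto simp: weighted_def)
    qed
  qed
  from weak_homogeneous_solution[OF p D this] obtain c d where
    cd: "AE x in lborel_on a b. D x = d + c * primitive a (\<lambda>t. complex_of_real (q t)) x" by blast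
  obtain u where u: "continuous_on {a..b} u" "AE x in lborel_on a b. R x = u x" "u a = 0" "u b = 0"
    using weak by (auto simp: H1_0_def)
  \<comment> \<open>Almost everywhere identities say nothing at the endpoints, so the continuous
    representative \<open>u\<close> is compared instead. Then \<open>a\<close> yields
    \<open>d = 0\<close>, and \<open>b\<close> yields \<open>c = 0\<close> because the integral of
    \<open>q\<close> is nonzero.\<close>
  define V where "V = (\<lambda>x. u x - K S x - (d + c * primitive a (\<lambda>t. complex_of_real (q t)) x))"
  have "V x = 0" if "x \<in> {a..b}" for x
  proof (rule continuous_AE_zero_imp_zero[OF ab _ _ that])
    have "set_integrable lborel {a<..<b} (\<lambda>t. complex_of_real (q t))"
      by (intro continuous_set_integrable continuous_intros cont_q)
    then show "continuous_on {a..b} V"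
      unfolding V_def by (intro continuous_intros u(1) K_continuous S_L2 primitive_continuous)
    show "AE x in lborel_on a b. V x = 0"
      using cd u(2) by eventually_elim (simp add: V_def D_def)
  qed
  from this[of a] this[of b] have "d = 0" "c = 0"
    using ab u(3,4) K_endpoints[OF S_L2] primitive_continuous_nonzero by (auto simp: V_def)
  then have "AE x in M. R x = K S x"
    using cd unfolding AE_M by (simp add: D_def)
  moreover have "R \<in> borel_measurable M"
    using weak L2_M by (auto simp: H1_0_def H1_def intro: L2_measurable)
  ultimately show "(R, S) \<in> op.inverse_graph"
    using S_L2 by (simp add: op.inverse_graph_def)
qed

end

section \<open>The concrete coefficients\<close>

theorem proposition3p1:
  fixes r0 r1 r2 :: real
  assumes "0 < r0" and "r0 < r1" and "r1 < r2"
  defines "H \<equiv> rho_measure r0 r1 r2"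
    and "L \<equiv> SL_operator r0 r1 r2"
  shows "self_adjoint_in H L \<and>
    purely_discrete_spectrum H L \<and>
    (\<exists>(lam :: nat \<Rightarrow> real) (e :: nat \<Rightarrow> real \<Rightarrow> complex).
       (\<forall>n. 0 < (lam n)\<^sup>2) \<and>
       (\<forall>n. (lam n)\<^sup>2 \<le> (lam (Suc n))\<^sup>2) \<and>
       filterlim (\<lambda>n. (lam n)\<^sup>2) at_top sequentially \<and>
       op_spectrum H L = range (\<lambda>n. complex_of_real ((lam n)\<^sup>2)) \<and>
       (\<forall>n. e n \<in> eigenspace H L (complex_of_real ((lam n)\<^sup>2))) \<and>
       L2_orthonormal_basis H e)"
proof -
  \<comment> \<open>Here \<open>p r = 1 / r\<close>, so \<open>q\<close> is the identity;
    \<open>r0 < r1\<close> makes the weight positive up to the left endpoint.\<close>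
  interpret sturm_liouville r1 r2 "weight_rho r0" "\<lambda>r. r"
  proof
    show "continuous_on {r1..r2} (weight_rho r0)"
      unfolding weight_rho_def[abs_def] using assms by (intro continuous_intros) auto
    show "weight_rho r0 r > 0" if "r \<in> {r1..r2}" for r
    proof -
      have "r0\<^sup>2 < r\<^sup>2" using that assms by (intro power_strict_mono) auto
      then show ?thesis using that assms by (auto simp: weight_rho_def)
    qed
  qed (use assms in \<open>auto intro: continuous_intros\<close>)
  have H: "H = M" by (simp add: H_def M_def rho_measure_def)
  have p: "complex_of_real (coeff_p r) * complex_of_real r = 1" if "r \<in> {r1<..<r2}" for r
    using that assms by (simp add: coeff_p_def)
  have "(R, S) \<in> L \<longleftrightarrow> (R, S) \<in> op.inverse_graph" for R S
    using inverse_graph_eq_weak_graph[of "\<lambda>r. complex_of_real (coeff_p r)" R S, OF p]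
    by (simp only: L_def SL_operator_def SL_domain_def H[unfolded H_def] mem_Collect_eq prod.case conj_assoc)
  then have L: "L = op.inverse_graph" by auto
  show ?thesis unfolding H L using op.inverse_graph_spectral by blast
qed

end
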